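(* Let $n\in\mathbb{N}$, $0<r\leq 1$, $1<p_1\leq 2$ and $1\leq p_2<\infty$. Let $\phi:\mathbb{R}^n\times\mathbb{R}^n\to\mathbb{R}$ be a real-valued measurable function, let $a:\mathbb{R}^n\times\mathbb{R}^n\to\mathbb{C}$ be a measurable function, and let $F$ be the Fourier integral operator with phase $\phi$ and symbol $a$, $$Ff(x)=\int_{\mathbb{R}^n}e^{i\phi(x,\xi)}a(x,\xi)\widehat{f}(\xi)\,d\xi .$$ Consider the following condition: (D) There exist sequences $(g_k)_{k\geq 1}$ in $L^{p_1}(\mathbb{R}^n)$ and $(h_k)_{k\geq 1}$ in $L^{p_2}(\mathbb{R}^n)$ such that $$\sum_{k=1}^{\infty}\|g_k\|_{L^{p_1}}^{r}\,\|h_k\|_{L^{p_2}}^{r}<\infty$$ and $$a(x,\xi)=\frac{1}{e^{i\phi(x,\xi)}}\sum_{k=1}^{\infty}h_k(x)\,g_k(\xi)\quad\text{for almost every }(x,\xi)\in\mathbb{R}^n\times\mathbb{R}^n .$$ Then: (i) If (D) holds, then $F:L^{p_1}(\mathbb{R}^n)\to L^{p_2}(\mathbb{R}^n)$ is $r$-nuclear. (ii) If $p_1=2$, then $F:L^{2}(\mathbb{R}^n)\to L^{p_2}(\mathbb{R}^n)$ is $r$-nuclear if and only if (D) holds (with $p_1=2$).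
   Context: The Fourier transform is $\widehat{f}(\xi)=(\mathscr{F}f)(\xi)=\int_{\mathbb{R}^n}e^{-2\pi i x\cdot\xi}f(x)\,dx$. The operator $F$ is initially defined on the Schwartz space $\mathscr{S}(\mathbb{R}^n)$, which is dense in $L^{p_1}(\mathbb{R}^n)$. Let $E,G$ be Banach spaces, $0<r\leq 1$, and let $T:D(T)\subset E\to G$ be a densely defined linear operator. $T$ is said to be (to extend to) an $r$-nuclear operator from $E$ into $G$ if there exist sequences $(e_k')_k$ in the dual space $E'$ and $(y_k)_k$ in $G$ such that $$Tf=\sum_{k}\langle e_k',f\rangle\,y_k\quad\text{for all }f\in D(T),\qquad\text{with}\qquad \sum_k\|e_k'\|_{E'}^{r}\,\|y_k\|_{G}^{r}<\infty .$$ Saying that $F:L^{p_1}(\mathbb{R}^n)\to L^{p_2}(\mathbb{R}^n)$ is $r$-nuclear means that this holds with $E=L^{p_1}(\mathbb{R}^n)$, $G=L^{p_2}(\mathbb{R}^n)$, $T=F$ and $D(T)=\mathscr{S}(\mathbb{R}^n)$; in particular it includes that, for every $f\in\mathscr{S}(\mathbb{R}^n)$, the (Lebesgue) integral defining $Ff(x)$ converges absolutely for almost every $x$ and $Ff\in L^{p_2}(\mathbb{R}^n)$. Lebesgue measure is used throughout. *)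

theory Defs
  imports "HOL-Analysis.Analysis"
begin

section \<open>Lebesgue spaces\<close>

text \<open>
  Elements of \<open>L\<^sup>p\<close> are handled through representatives: \<open>Lp_space p\<close> is the space of Lebesgue
  measurable functions with integrable \<open>p\<close>-th power, and \<open>Lp_norm p\<close> is the seminorm on it whose
  null functions are exactly those vanishing almost everywhere. \<open>Lp_norm p f\<close> is meaningful only
  for \<open>f\<close> in \<open>Lp_space p\<close>, and the exponents are finite.
\<close>

definition Lp_space :: "real \<Rightarrow> ('a::euclidean_space \<Rightarrow> complex) set" where
  "Lp_space p = {f. f \<in> borel_measurable lebesgue \<and> integrable lebesgue (\<lambda>x. norm (f x) powr p)}"

definition Lp_norm :: "real \<Rightarrow> ('a::euclidean_space \<Rightarrow> complex) \<Rightarrow> real" where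
  "Lp_norm p f = (LINT x|lebesgue. norm (f x) powr p) powr (1 / p)"


section \<open>Nuclear operators\<close>

text \<open>
  A Banach space whose elements are classes of complex functions is given by its space \<open>E\<close> of
  representatives and its seminorm \<open>nE\<close>. Boundedness makes the elements of the dual constant on
  the classes modulo \<open>nE\<close>-null functions, so they are the elements of the dual of the quotient.
\<close>

definition dual_space ::
    "('a \<Rightarrow> complex) set \<Rightarrow> (('a \<Rightarrow> complex) \<Rightarrow> real) \<Rightarrow> (('a \<Rightarrow> complex) \<Rightarrow> complex) set" where
  "dual_space E nE = {l.
     (\<forall>f\<in>E. \<forall>g\<in>E. l (\<lambda>x. f x + g x) = l f + l g) \<and>
     (\<forall>c. \<forall>f\<in>E. l (\<lambda>x. c * f x) = c * l f) \<and>
     (\<exists>C. \<forall>f\<in>E. norm (l f) \<le> C * nE f)}"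

definition dual_norm ::
    "('a \<Rightarrow> complex) set \<Rightarrow> (('a \<Rightarrow> complex) \<Rightarrow> real) \<Rightarrow> (('a \<Rightarrow> complex) \<Rightarrow> complex) \<Rightarrow> real" where
  "dual_norm E nE l = (SUP f\<in>{f\<in>E. nE f \<le> 1}. norm (l f))"

text \<open>
  Equality in the target space is vanishing of \<open>nG\<close> on the difference. The last conjunct makes
  the operator well defined on classes.
\<close>

definition densely_defined_operator ::
    "('a \<Rightarrow> complex) set \<Rightarrow> (('a \<Rightarrow> complex) \<Rightarrow> real) \<Rightarrow>
     ('b \<Rightarrow> complex) set \<Rightarrow> (('b \<Rightarrow> complex) \<Rightarrow> real) \<Rightarrow>
     ('a \<Rightarrow> complex) set \<Rightarrow> (('a \<Rightarrow> complex) \<Rightarrow> ('b \<Rightarrow> complex)) \<Rightarrow> bool" where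
  "densely_defined_operator E nE G nG D T \<longleftrightarrow>
     D \<subseteq> E \<and>
     (\<lambda>x. 0) \<in> D \<and>
     (\<forall>f\<in>D. \<forall>g\<in>D. (\<lambda>x. f x + g x) \<in> D) \<and>
     (\<forall>c. \<forall>f\<in>D. (\<lambda>x. c * f x) \<in> D) \<and>
     (\<forall>f\<in>E. \<forall>\<epsilon>>0. \<exists>g\<in>D. nE (\<lambda>x. f x - g x) < \<epsilon>) \<and>
     (\<forall>f\<in>D. T f \<in> G) \<and>
     (\<forall>f\<in>D. \<forall>g\<in>D. nG (\<lambda>y. T (\<lambda>x. f x + g x) y - (T f y + T g y)) = 0) \<and>
     (\<forall>c. \<forall>f\<in>D. nG (\<lambda>y. T (\<lambda>x. c * f x) y - c * T f y) = 0) \<and>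
     (\<forall>f\<in>D. \<forall>g\<in>D. nE (\<lambda>x. f x - g x) = 0 \<longrightarrow> nG (\<lambda>y. T f y - T g y) = 0)"

text \<open>The series representing \<open>T f\<close> converges in the norm of the target space.\<close>

definition r_nuclear ::
    "real \<Rightarrow>
     ('a \<Rightarrow> complex) set \<Rightarrow> (('a \<Rightarrow> complex) \<Rightarrow> real) \<Rightarrow>
     ('b \<Rightarrow> complex) set \<Rightarrow> (('b \<Rightarrow> complex) \<Rightarrow> real) \<Rightarrow>
     ('a \<Rightarrow> complex) set \<Rightarrow> (('a \<Rightarrow> complex) \<Rightarrow> ('b \<Rightarrow> complex)) \<Rightarrow> bool" where
  "r_nuclear r E nE G nG D T \<longleftrightarrow>
     densely_defined_operator E nE G nG D T \<and>
     (\<exists>(e :: nat \<Rightarrow> ('a \<Rightarrow> complex) \<Rightarrow> complex) (y :: nat \<Rightarrow> 'b \<Rightarrow> complex).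
        (\<forall>k. e k \<in> dual_space E nE) \<and>
        (\<forall>k. y k \<in> G) \<and>
        (\<forall>f\<in>D. (\<lambda>N. nG (\<lambda>x. T f x - (\<Sum>k<N. e k f * y k x))) \<longlonglongrightarrow> 0) \<and>
        summable (\<lambda>k. dual_norm E nE (e k) powr r * nG (y k) powr r))"


section \<open>Schwartz functions and Fourier integral operators\<close>

primrec iterated_partial ::
    "'n list \<Rightarrow> (real^'n::finite \<Rightarrow> complex) \<Rightarrow> (real^'n \<Rightarrow> complex)" where
  "iterated_partial [] f = f"
| "iterated_partial (j # js) f =
     (\<lambda>x. frechet_derivative (iterated_partial js f) (at x) (axis j 1))"

text \<open>
  Differentiability of all iterated partial derivatives, in any order, is smoothness.
\<close>

definition schwartz_space :: "(real^'n::finite \<Rightarrow> complex) set" where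
  "schwartz_space = {f. \<forall>js.
     iterated_partial js f differentiable_on UNIV \<and>
     (\<forall>m::nat. bounded (range (\<lambda>x. norm x ^ m *\<^sub>R iterated_partial js f x)))}"

definition fourier :: "(real^'n::finite \<Rightarrow> complex) \<Rightarrow> (real^'n \<Rightarrow> complex)" where
  "fourier f \<xi> = (LINT x|lebesgue. exp (- 2 * of_real pi * \<i> * of_real (x \<bullet> \<xi>)) * f x)"

definition FIO_integrand ::
    "(real^'n::finite \<Rightarrow> real^'n \<Rightarrow> real) \<Rightarrow> (real^'n \<Rightarrow> real^'n \<Rightarrow> complex) \<Rightarrow>
     (real^'n \<Rightarrow> complex) \<Rightarrow> real^'n \<Rightarrow> real^'n \<Rightarrow> complex" where
  "FIO_integrand \<phi> a f x \<xi> = exp (\<i> * of_real (\<phi> x \<xi>)) * a x \<xi> * fourier f \<xi>"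

definition FIO ::
    "(real^'n::finite \<Rightarrow> real^'n \<Rightarrow> real) \<Rightarrow> (real^'n \<Rightarrow> real^'n \<Rightarrow> complex) \<Rightarrow>
     (real^'n \<Rightarrow> complex) \<Rightarrow> (real^'n \<Rightarrow> complex)" where
  "FIO \<phi> a f x = (LINT \<xi>|lebesgue. FIO_integrand \<phi> a f x \<xi>)"

text \<open>
  The Bochner integral is 0 where the integrand is not integrable, so absolute convergence of the
  integral defining the operator has to be required separately.
\<close>

definition FIO_r_nuclear ::
    "real \<Rightarrow> real \<Rightarrow> real \<Rightarrow> (real^'n::finite \<Rightarrow> real^'n \<Rightarrow> real) \<Rightarrow>
     (real^'n \<Rightarrow> real^'n \<Rightarrow> complex) \<Rightarrow> bool" where
  "FIO_r_nuclear r p1 p2 \<phi> a \<longleftrightarrow>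
     (\<forall>f\<in>schwartz_space. AE x in lebesgue. integrable lebesgue (FIO_integrand \<phi> a f x)) \<and>
     r_nuclear r (Lp_space p1) (Lp_norm p1) (Lp_space p2) (Lp_norm p2) schwartz_space (FIO \<phi> a)"

definition symbol_decomposition ::
    "real \<Rightarrow> real \<Rightarrow> real \<Rightarrow> (real^'n::finite \<Rightarrow> real^'n \<Rightarrow> real) \<Rightarrow>
     (real^'n \<Rightarrow> real^'n \<Rightarrow> complex) \<Rightarrow> bool" where
  "symbol_decomposition r p1 p2 \<phi> a \<longleftrightarrow>
     (\<exists>(g :: nat \<Rightarrow> real^'n \<Rightarrow> complex) (h :: nat \<Rightarrow> real^'n \<Rightarrow> complex).
        (\<forall>k. g k \<in> Lp_space p1) \<and>
        (\<forall>k. h k \<in> Lp_space p2) \<and>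
        summable (\<lambda>k. Lp_norm p1 (g k) powr r * Lp_norm p2 (h k) powr r) \<and>
        (AE (x, \<xi>) in lebesgue.
           summable (\<lambda>k. h k x * g k \<xi>) \<and>
           a x \<xi> = 1 / exp (\<i> * of_real (\<phi> x \<xi>)) * (\<Sum>k. h k x * g k \<xi>)))"

end

theory Submission
  imports Defs "HOL-Probability.Characteristic_Functions" "HOL-Probability.Sinc_Integral"
    "HOL-Computational_Algebra.Polynomial"
begin

text \<open>
  The series for \<open>e\<^sup>i\<^sup>\<phi> a\<close> and the series for the operator are the same object seen from two sides.
  Write \<open>K x \<xi> = (\<Sum>k. h\<^sub>k x * g\<^sub>k \<xi>)\<close>. Since \<open>r \<le> 1\<close>, the hypothesis on the norms gives
  \<open>\<Sum>k. \<parallel>g\<^sub>k\<parallel> * \<parallel>h\<^sub>k\<parallel> < \<infinity>\<close>, so for almost every \<open>x\<close> the series \<open>\<Sum>k. h\<^sub>k x * g\<^sub>k\<close> converges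
  in \<open>L\<^sup>p\<^sup>1\<close>, and it may be integrated term by term against any function in the dual exponent \<open>q\<close>.

  From the symbol to the operator. If \<open>e\<^sup>i\<^sup>\<phi> a = K\<close>, then \<open>F f = (\<Sum>k. e\<^sub>k f * h\<^sub>k)\<close> with
  \<open>e\<^sub>k f = \<integral> g\<^sub>k * fourier f\<close>. The content is that \<open>e\<^sub>k\<close> is bounded on \<open>L\<^sup>p\<^sup>1\<close>, with norm at most
  \<open>C * \<parallel>g\<^sub>k\<parallel>\<close>: this is \<open>Hausdorff_Young\<close>, which needs \<open>1 < p1 \<le> 2\<close>. A non-sharp constant \<open>C\<close> is
  enough for summability, so the inequality is obtained by Marcinkiewicz interpolation between the
  trivial bound \<open>L\<^sup>1 \<rightarrow> L\<^sup>\<infinity>\<close> and \<open>Plancherel_inequality\<close>. As \<open>fourier\<close> is an integral and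
  is meaningful only on \<open>L\<^sup>1\<close>, the functional is first defined on \<open>L\<^sup>1 \<inter> L\<^sup>p\<^sup>1\<close> and then extended by
  truncation (\<open>extend_bounded_functional\<close>). The Schwartz functions are dense in \<open>L\<^sup>p\<^sup>1\<close>
  (\<open>schwartz_dense\<close>), as the definition of a densely defined operator requires.

  From the operator to the symbol, for \<open>p1 = 2\<close>. A functional \<open>e\<^sub>k\<close> on \<open>L\<^sup>2\<close>, composed with the
  inverse Fourier transform, is bounded on \<open>L\<^sup>1 \<inter> L\<^sup>2\<close> by Plancherel's inequality, hence it is
  represented there by some \<open>g\<^sub>k\<close> in \<open>L\<^sup>2\<close> (\<open>Riesz_representation_subspace\<close>). So
  \<open>e\<^sub>k f = \<integral> g\<^sub>k * fourier f\<close> at least for Gaussian translates \<open>f\<close>, whose transforms are known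
  explicitly. With these \<open>g\<^sub>k\<close> and the given \<open>h\<^sub>k\<close>, comparing the two expressions for \<open>F f\<close> shows that,
  for almost every \<open>x\<close>, the function \<open>(e\<^sup>i\<^sup>\<phi> a - K) x\<close> times a Gaussian is an integrable function whose
  Fourier transform vanishes at the centres of the translates. Countably many centres form a
  dense set, the transform is continuous, and the Fourier transform is injective on \<open>L\<^sup>1\<close>
  (\<open>fourier_injective\<close>); therefore \<open>e\<^sup>i\<^sup>\<phi> a = K\<close> almost everywhere on almost every section, and
  by Tonelli's theorem almost everywhere on the product.
\<close>

section \<open>Lebesgue spaces\<close>

lemma Lp_norm_nonneg: "0 \<le> Lp_norm p f"
  by (simp add: Lp_norm_def)

lemma Lp_space_measurable[measurable_dest]: "f \<in> Lp_space p \<Longrightarrow> f \<in> borel_measurable lebesgue"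
  by (simp add: Lp_space_def)

lemma Lp_space_integrable: "f \<in> Lp_space p \<Longrightarrow> integrable lebesgue (\<lambda>x. norm (f x) powr p)"
  by (simp add: Lp_space_def)

lemma Lp_norm_powr: "p \<noteq> 0 \<Longrightarrow> Lp_norm p f powr p = (LINT x|lebesgue. norm (f x) powr p)"
  by (simp add: Lp_norm_def powr_powr)

lemma Lp_norm_le_iff:
  assumes "0 < p" "0 \<le> c"
  shows "Lp_norm p f \<le> c \<longleftrightarrow> (LINT x|lebesgue. norm (f x) powr p) \<le> c powr p"
  by (metis Lp_norm_nonneg Lp_norm_powr assms linorder_not_le nless_le powr_less_mono2 powr_mono2)

text \<open>
  The completed product measure is not the product of the completed measures, so functions are
  replaced by Borel functions before integrals are interchanged.
\<close>

lemma borel_representative: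
  fixes f :: "'a::euclidean_space \<Rightarrow> complex"
  assumes f[measurable]: "f \<in> borel_measurable lebesgue"
  shows "\<exists>g\<in>borel_measurable borel. AE x in lebesgue. f x = g x"
proof -
  have "(\<lambda>x. Re (f x)) \<in> borel_measurable lebesgue" "(\<lambda>x. Im (f x)) \<in> borel_measurable lebesgue"
    by measurable
  from this[THEN completion_ex_borel_measurable_real] obtain u v
    where uv[measurable]: "u \<in> borel_measurable borel" "v \<in> borel_measurable borel"
      and ae: "AE x in lborel. Re (f x) = u x" "AE x in lborel. Im (f x) = v x" by auto
  have "AE x in lebesgue. f x = Complex (u x) (v x)"
    using AE_completion[OF ae(1)] AE_completion[OF ae(2)] by eventually_elim (simp add: complex_eq_iff)
  moreover have "(\<lambda>x. Complex (u x) (v x)) \<in> borel_measurable borel"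
    by (simp add: borel_measurable_complex_iff)
  ultimately show ?thesis by (intro bexI)
qed

lemma Lp_norm_zero: "Lp_norm p (\<lambda>x. 0) = 0"
  by (simp add: Lp_norm_def)

lemma zero_in_Lp_space: "(\<lambda>x. 0) \<in> Lp_space p"
  by (simp add: Lp_space_def)

lemma Lp_norm_cong_AE:
  assumes "f \<in> borel_measurable lebesgue" "g \<in> borel_measurable lebesgue" "AE x in lebesgue. f x = g x"
  shows "Lp_norm p f = Lp_norm p g"
  unfolding Lp_norm_def using assms
  by (intro arg_cong2[where f="(powr)"] integral_cong_AE) auto

lemma Lp_space_dominated:
  assumes "g \<in> Lp_space p" "0 < p" "f \<in> borel_measurable lebesgue"
    and "AE x in lebesgue. norm (f x) \<le> norm (g x)"
  shows "f \<in> Lp_space p" "Lp_norm p f \<le> Lp_norm p g"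
proof -
  have *: "AE x in lebesgue. norm (f x) powr p \<le> norm (g x) powr p"
    using assms(4) by eventually_elim (use assms(2) in \<open>auto intro: powr_mono2\<close>)
  have i: "integrable lebesgue (\<lambda>x. norm (f x) powr p)"
    by (rule Bochner_Integration.integrable_bound[OF Lp_space_integrable[OF assms(1)]])
       (use * assms(3) in auto)
  then show "f \<in> Lp_space p" using assms(3) by (simp add: Lp_space_def)
  have "(LINT x|lebesgue. norm (f x) powr p) \<le> (LINT x|lebesgue. norm (g x) powr p)"
    using * by (intro integral_mono_AE i Lp_space_integrable assms(1)) auto
  then show "Lp_norm p f \<le> Lp_norm p g"
    unfolding Lp_norm_def by (intro powr_mono2) (use assms(2) in auto)
qed

lemma Lp_space_cong_AE:
  assumes "g \<in> Lp_space p" "0 < p" "AE x in lebesgue. f x = g x"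
  shows "f \<in> Lp_space p"
proof -
  have "f \<in> borel_measurable lebesgue"
    using borel_measurable_AE[OF Lp_space_measurable[OF assms(1)], of f] assms(3) by (simp add: eq_commute)
  then show ?thesis by (rule Lp_space_dominated(1)[OF assms(1,2)]) (use assms(3) in auto)
qed

lemma Lp_space_scale:
  assumes "f \<in> Lp_space p"
  shows "(\<lambda>x. c * f x) \<in> Lp_space p"
  using assms by (auto simp: Lp_space_def norm_mult powr_mult)

lemma Lp_norm_scale:
  assumes "0 < p"
  shows "Lp_norm p (\<lambda>x. c * f x) = norm c * Lp_norm p f"
  using assms by (simp add: Lp_norm_def norm_mult powr_mult powr_powr)

lemma borel_measurable_cnj[measurable]:
  "f \<in> borel_measurable M \<Longrightarrow> (\<lambda>x. cnj (f x)) \<in> borel_measurable M"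
  by (rule borel_measurable_continuous_on[where f=cnj]) (auto intro: continuous_intros)

lemma Lp_space_cnj: "f \<in> Lp_space p \<Longrightarrow> (\<lambda>x. cnj (f x)) \<in> Lp_space p"
proof -
  assume f: "f \<in> Lp_space p"
  note [measurable] = Lp_space_measurable[OF f]
  have "(\<lambda>x. cnj (f x)) \<in> borel_measurable lebesgue" by measurable
  then show ?thesis using f by (simp add: Lp_space_def)
qed

lemma Lp_norm_eq_0_iff:
  assumes "f \<in> Lp_space p" "0 < p"
  shows "Lp_norm p f = 0 \<longleftrightarrow> (AE x in lebesgue. f x = 0)"
  using integral_nonneg_eq_0_iff_AE[OF Lp_space_integrable[OF assms(1)]] assms(2)
  by (simp add: Lp_norm_def)

text \<open>
  The fact \<open>powr_convex\<close> concerns \<open>{0<..}\<close>; at the origin \<open>c powr p \<le> c\<close> for \<open>c \<le> 1\<close> takes over.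
\<close>

lemma powr_convex_combination:
  fixes u v s t p :: real
  assumes "1 \<le> p" "0 \<le> u" "0 \<le> v" "0 \<le> s" "0 \<le> t" "s + t = 1"
  shows "(s * u + t * v) powr p \<le> s * u powr p + t * v powr p"
proof -
  have *: "(c * w) powr p \<le> c * w powr p" if "0 \<le> c" "c \<le> 1" "0 \<le> w" for c w :: real
    using that powr_mono'[of 1 p c] assms(1)
    by (cases "c = 0") (auto simp: powr_mult intro!: mult_right_mono)
  show ?thesis
  proof (cases "u = 0 \<or> v = 0")
    case True
    then show ?thesis using * [of s u] *[of t v] assms by auto
  next
    case False
    have s: "s = 1 - t" using assms by simp
    show ?thesis
      unfolding s using convex_onD[OF powr_convex[OF assms(1)], of t u v] False assms by simp
  qed
qed

text \<open>
  Minkowski's inequality. If \<open>a\<close> and \<open>b\<close> bound the two norms, then \<open>(f + g) / (a + b)\<close> is a convex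
  combination of \<open>f / a\<close> and \<open>g / b\<close>, and convexity of the \<open>p\<close>-th power bounds its norm by 1.
\<close>

lemma Lp_space_triangle:
  assumes p: "1 \<le> p" and f: "f \<in> Lp_space p" and g: "g \<in> Lp_space p"
  shows "(\<lambda>x. f x + g x) \<in> Lp_space p" and "Lp_norm p (\<lambda>x. f x + g x) \<le> Lp_norm p f + Lp_norm p g"
proof -
  note [measurable] = Lp_space_measurable[OF f] Lp_space_measurable[OF g]
  have bound: "(norm (f x + g x) / (a + b)) powr p
      \<le> a / (a + b) * (norm (f x) / a) powr p + b / (a + b) * (norm (g x) / b) powr p"
    if "0 < a" "0 < b" for a b :: real and x
  proof -
    have "norm (f x + g x) / (a + b) \<le> (norm (f x) + norm (g x)) / (a + b)"
      using that by (intro divide_right_mono norm_triangle_ineq) auto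
    also have "\<dots> = a / (a + b) * (norm (f x) / a) + b / (a + b) * (norm (g x) / b)"
      using that by (simp add: add_divide_distrib)
    finally have "(norm (f x + g x) / (a + b)) powr p \<le> (a / (a + b) * (norm (f x) / a) + b / (a + b) * (norm (g x) / b)) powr p"
      using that p by (intro powr_mono2) auto
    also have "\<dots> \<le> a / (a + b) * (norm (f x) / a) powr p + b / (a + b) * (norm (g x) / b) powr p"
      using that p by (intro powr_convex_combination) (auto simp: add_divide_distrib[symmetric])
    finally show ?thesis .
  qed
  have int: "integrable lebesgue (\<lambda>x. a / (a + b) * (norm (f x) / a) powr p + b / (a + b) * (norm (g x) / b) powr p)"
    if "0 < a" "0 < b" for a b
    using Lp_space_integrable[OF f] Lp_space_integrable[OF g] that by (simp add: powr_divide)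
  have int': "integrable lebesgue (\<lambda>x. (norm (f x + g x) / (a + b)) powr p)" if "0 < a" "0 < b" for a b
    by (rule Bochner_Integration.integrable_bound[OF int[OF that]])
       (use bound[OF that] in \<open>auto intro!: order_trans[OF _ abs_ge_self]\<close>)
  show s: "(\<lambda>x. f x + g x) \<in> Lp_space p"
    using int'[of "1/2" "1/2"] by (simp add: Lp_space_def)
  \<comment> \<open>Upper bounds \<open>a\<close>, \<open>b\<close> of the norms instead of the norms themselves avoid dividing by zero.\<close>
  have pos: "Lp_norm p (\<lambda>x. f x + g x) \<le> a + b" if ab: "0 < a" "0 < b" "Lp_norm p f \<le> a" "Lp_norm p g \<le> b" for a b
  proof -
    have "(LINT x|lebesgue. (norm (f x + g x) / (a + b)) powr p)
       \<le> (LINT x|lebesgue. a / (a + b) * (norm (f x) / a) powr p + b / (a + b) * (norm (g x) / b) powr p)"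
      by (intro integral_mono int int' bound ab)
    also have "\<dots> = a / (a + b) * ((LINT x|lebesgue. norm (f x) powr p) / a powr p) + b / (a + b) * ((LINT x|lebesgue. norm (g x) powr p) / b powr p)"
      using Lp_space_integrable[OF f] Lp_space_integrable[OF g] ab by (simp add: powr_divide)
    also have "\<dots> \<le> a / (a + b) * 1 + b / (a + b) * 1"
      using ab p by (intro add_mono mult_left_mono) (auto simp: Lp_norm_le_iff field_simps)
    also have "\<dots> = 1" using ab by (simp add: add_divide_distrib[symmetric])
    finally have "(LINT x|lebesgue. norm (f x + g x) powr p) \<le> (a + b) powr p"
      using ab by (simp add: powr_divide field_simps)
    then show ?thesis using ab p by (simp add: Lp_norm_le_iff)
  qed
  show "Lp_norm p (\<lambda>x. f x + g x) \<le> Lp_norm p f + Lp_norm p g"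
  proof (rule field_le_epsilon)
    fix e :: real assume "0 < e"
    then show "Lp_norm p (\<lambda>x. f x + g x) \<le> Lp_norm p f + Lp_norm p g + e"
      using pos[of "Lp_norm p f + e/2" "Lp_norm p g + e/2"] Lp_norm_nonneg[of p f] Lp_norm_nonneg[of p g] by simp
  qed
qed

lemma Lp_space_diff:
  assumes p: "1 \<le> p" and f: "f \<in> Lp_space p" and g: "g \<in> Lp_space p"
  shows "(\<lambda>x. f x - g x) \<in> Lp_space p" and "Lp_norm p (\<lambda>x. f x - g x) \<le> Lp_norm p f + Lp_norm p g"
  using Lp_space_triangle[OF p f Lp_space_scale[OF g, of "-1"]] Lp_norm_scale[of p "-1" g] p by simp_all

lemma Lp_norm_minus_commute: "Lp_norm p (\<lambda>x. f x - g x) = Lp_norm p (\<lambda>x. g x - f x)"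
  by (simp add: Lp_norm_def norm_minus_commute)

lemma Lp_norm_triangle_diff:
  assumes p: "1 \<le> p" and f: "f \<in> Lp_space p" and g: "g \<in> Lp_space p" and h: "h \<in> Lp_space p"
  shows "Lp_norm p (\<lambda>x. f x - h x) \<le> Lp_norm p (\<lambda>x. f x - g x) + Lp_norm p (\<lambda>x. g x - h x)"
  using Lp_space_triangle(2)[OF p Lp_space_diff(1)[OF p f g] Lp_space_diff(1)[OF p g h]] by simp

lemma Lp_norm_le_add_diff:
  assumes p: "1 \<le> p" and f: "f \<in> Lp_space p" and g: "g \<in> Lp_space p"
  shows "Lp_norm p f \<le> Lp_norm p g + Lp_norm p (\<lambda>x. f x - g x)"
  using Lp_space_triangle(2)[OF p g Lp_space_diff(1)[OF p f g]] by simp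

lemma Lp_space_sum:
  assumes p: "1 \<le> p" and "finite I" "\<And>k. k \<in> I \<Longrightarrow> u k \<in> Lp_space p"
  shows "(\<lambda>x. \<Sum>k\<in>I. u k x) \<in> Lp_space p \<and> Lp_norm p (\<lambda>x. \<Sum>k\<in>I. u k x) \<le> (\<Sum>k\<in>I. Lp_norm p (u k))"
  using assms(2,3)
proof (induction I)
  case empty
  then show ?case by (simp add: zero_in_Lp_space Lp_norm_zero)
next
  case (insert i I)
  then show ?case using Lp_space_triangle[OF p, of "u i" "\<lambda>x. \<Sum>k\<in>I. u k x"] by (auto intro: order_trans)
qed

lemma Lp_norm_of_norm: "Lp_norm p (\<lambda>x. of_real (norm (f x))) = Lp_norm p f"
  by (simp add: Lp_norm_def)

lemma Lp_space_of_norm: "f \<in> Lp_space p \<Longrightarrow> (\<lambda>x. of_real (norm (f x))) \<in> Lp_space p"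
proof -
  assume f: "f \<in> Lp_space p"
  note [measurable] = Lp_space_measurable[OF f]
  have "(\<lambda>x. complex_of_real (norm (f x))) \<in> borel_measurable lebesgue" by measurable
  then show ?thesis using f by (simp add: Lp_space_def)
qed

text \<open>
  Fatou's lemma, read in \<open>L\<^sup>p\<close>: balls are closed under almost everywhere convergence.
\<close>

lemma Lp_bounded_AE_convergent:
  fixes v :: "nat \<Rightarrow> 'a::euclidean_space \<Rightarrow> complex"
  assumes p: "0 < p" and v: "\<And>n. v n \<in> Lp_space p"
    and lim: "AE x in lebesgue. (\<lambda>n. v n x) \<longlonglongrightarrow> w x" and w: "w \<in> borel_measurable lebesgue"
    and b: "\<And>n. Lp_norm p (v n) \<le> B"
  shows "w \<in> Lp_space p" "Lp_norm p w \<le> B"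
proof -
  note [measurable] = Lp_space_measurable[OF v] w
  have B: "0 \<le> B" using b[of 0] Lp_norm_nonneg[of p "v 0"] by linarith
  have "(\<integral>\<^sup>+x. ennreal (norm (w x) powr p) \<partial>lebesgue) = (\<integral>\<^sup>+x. liminf (\<lambda>n. ennreal (norm (v n x) powr p)) \<partial>lebesgue)"
  proof (intro nn_integral_cong_AE, use lim in eventually_elim)
    fix x assume "(\<lambda>n. v n x) \<longlonglongrightarrow> w x"
    then have "(\<lambda>n. ennreal (norm (v n x) powr p)) \<longlonglongrightarrow> ennreal (norm (w x) powr p)"
      using p by (intro tendsto_ennrealI tendsto_powr' tendsto_norm tendsto_const) auto
    then show "ennreal (norm (w x) powr p) = liminf (\<lambda>n. ennreal (norm (v n x) powr p))"
      using lim_imp_Liminf[OF sequentially_bot] by metis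
  qed
  also have "\<dots> \<le> liminf (\<lambda>n. \<integral>\<^sup>+x. ennreal (norm (v n x) powr p) \<partial>lebesgue)"
    by (intro nn_integral_liminf) measurable
  also have "\<dots> \<le> liminf (\<lambda>n. ennreal (B powr p))"
  proof (intro Liminf_mono always_eventually allI)
    fix n
    have "(\<integral>\<^sup>+x. ennreal (norm (v n x) powr p) \<partial>lebesgue) = ennreal (LINT x|lebesgue. norm (v n x) powr p)"
      by (intro nn_integral_eq_integral Lp_space_integrable v) auto
    also have "\<dots> \<le> ennreal (B powr p)"
      using b[of n] Lp_norm_le_iff[OF p B] by (auto intro: ennreal_leI)
    finally show "(\<integral>\<^sup>+x. ennreal (norm (v n x) powr p) \<partial>lebesgue) \<le> ennreal (B powr p)" .
  qed
  also have "\<dots> = ennreal (B powr p)" by (simp add: Liminf_const)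
  finally have le: "(\<integral>\<^sup>+x. ennreal (norm (w x) powr p) \<partial>lebesgue) \<le> ennreal (B powr p)" .
  then have i: "integrable lebesgue (\<lambda>x. norm (w x) powr p)"
    by (auto simp: integrable_iff_bounded less_top[symmetric] top_unique)
  then show "w \<in> Lp_space p" by (simp add: Lp_space_def w)
  show "Lp_norm p w \<le> B"
    using le nn_integral_eq_integral[OF i] by (simp add: Lp_norm_le_iff[OF p B])
qed

lemma Lp_dominated_convergence:
  fixes v :: "nat \<Rightarrow> 'a::euclidean_space \<Rightarrow> complex"
  assumes p: "0 < p" and v: "\<And>n. v n \<in> borel_measurable lebesgue" and w: "w \<in> borel_measurable lebesgue"
    and lim: "AE x in lebesgue. (\<lambda>n. v n x) \<longlonglongrightarrow> w x"
    and h: "h \<in> Lp_space p" and bound: "\<And>n. AE x in lebesgue. norm (v n x) \<le> norm (h x)"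
  shows "(\<lambda>n. Lp_norm p (\<lambda>x. v n x - w x)) \<longlonglongrightarrow> 0"
proof -
  note [measurable] = v w Lp_space_measurable[OF h]
  have "AE x in lebesgue. \<forall>n. norm (v n x) \<le> norm (h x)" using bound by (simp add: AE_all_countable)
  with lim have bound': "AE x in lebesgue. \<forall>n. norm (v n x - w x) \<le> 2 * norm (h x)"
  proof eventually_elim
    case (elim x)
    have "norm (w x) \<le> norm (h x)"
      using tendsto_upperbound[OF tendsto_norm[OF elim(1)], of "norm (h x)"] elim(2) by simp
    moreover have "norm (v n x - w x) \<le> norm (v n x) + norm (w x)" for n by (rule norm_triangle_ineq4)
    ultimately show ?case using elim(2) by (smt (verit))
  qed
  have "(\<lambda>n. LINT x|lebesgue. norm (v n x - w x) powr p) \<longlonglongrightarrow> (LINT x|(lebesgue :: 'a measure). (0::real))"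
  proof (rule integral_dominated_convergence[where w = "\<lambda>x. 2 powr p * norm (h x) powr p"])
    show "AE x in lebesgue. (\<lambda>n. norm (v n x - w x) powr p) \<longlonglongrightarrow> 0"
      using lim
    proof eventually_elim
      case (elim x)
      have "(\<lambda>n. norm (v n x - w x)) \<longlonglongrightarrow> 0"
        using tendsto_norm[OF tendsto_diff[OF elim tendsto_const[of "w x"]]] by simp
      then show ?case using p by (intro tendsto_zero_powrI[OF _ tendsto_const]) auto
    qed
    show "AE x in lebesgue. norm (norm (v n x - w x) powr p) \<le> 2 powr p * norm (h x) powr p" for n
      using bound' by eventually_elim (use p in \<open>auto simp: powr_mult[symmetric] intro!: powr_mono2\<close>)
    show "integrable lebesgue (\<lambda>x. 2 powr p * norm (h x) powr p)"
      using Lp_space_integrable[OF h] by simp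
  qed measurable
  then show ?thesis
    unfolding Lp_norm_def using p by (intro tendsto_zero_powrI[OF _ tendsto_const]) auto
qed

text \<open>
  The Riesz--Fischer argument. By Minkowski's inequality the partial sums of the absolute values
  have \<open>p\<close>-th powers with bounded integrals; monotone convergence makes their supremum finite
  almost everywhere, and Fatou's lemma bounds the sum and the tails.
\<close>

lemma Lp_series:
  fixes u :: "nat \<Rightarrow> 'a::euclidean_space \<Rightarrow> complex"
  assumes p: "1 \<le> p" and u: "\<And>k. u k \<in> Lp_space p" and sm: "summable (\<lambda>k. Lp_norm p (u k))"
  shows "AE x in lebesgue. summable (\<lambda>k. norm (u k x))"
    and "(\<lambda>x. \<Sum>k. norm (u k x)) \<in> Lp_space p"
    and "(\<lambda>x. \<Sum>k. u k x) \<in> Lp_space p"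
    and "Lp_norm p (\<lambda>x. \<Sum>k. u k x) \<le> (\<Sum>k. Lp_norm p (u k))"
    and "(\<lambda>N. Lp_norm p (\<lambda>x. (\<Sum>k. u k x) - (\<Sum>k<N. u k x))) \<longlonglongrightarrow> 0"
proof -
  note [measurable] = Lp_space_measurable[OF u]
  have p0: "0 < p" using p by simp
  define B where "B = (\<Sum>k. Lp_norm p (u k))"
  have B: "0 \<le> B" unfolding B_def using sm Lp_norm_nonneg by (intro suminf_nonneg) auto
  let ?s = "\<lambda>N x. \<Sum>k<N. norm (u k x)"
  have s: "(\<lambda>x. complex_of_real (?s N x)) \<in> Lp_space p" "Lp_norm p (\<lambda>x. complex_of_real (?s N x)) \<le> B" for N
  proof -
    have "Lp_norm p (\<lambda>x. complex_of_real (?s N x)) \<le> (\<Sum>k<N. Lp_norm p (u k))"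
      using Lp_space_sum[OF p, of "{..<N}" "\<lambda>k x. complex_of_real (norm (u k x))"] u
      by (simp add: Lp_space_of_norm Lp_norm_of_norm)
    also have "\<dots> \<le> B" unfolding B_def by (intro sum_le_suminf sm) (auto simp: Lp_norm_nonneg)
    finally show "Lp_norm p (\<lambda>x. complex_of_real (?s N x)) \<le> B" .
    show "(\<lambda>x. complex_of_real (?s N x)) \<in> Lp_space p"
      using Lp_space_sum[OF p, of "{..<N}" "\<lambda>k x. complex_of_real (norm (u k x))"] u
      by (simp add: Lp_space_of_norm)
  qed
  have fin: "(\<integral>\<^sup>+x. ennreal (?s N x powr p) \<partial>lebesgue) \<le> ennreal (B powr p)" for N
  proof -
    have "(\<integral>\<^sup>+x. ennreal (?s N x powr p) \<partial>lebesgue) = (\<integral>\<^sup>+x. ennreal (norm (complex_of_real (?s N x)) powr p) \<partial>lebesgue)"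
      by (simp only: norm_of_real) (simp add: sum_nonneg)
    also have "\<dots> = ennreal (LINT x|lebesgue. norm (complex_of_real (?s N x)) powr p)"
      by (intro nn_integral_eq_integral Lp_space_integrable s(1)) auto
    also have "\<dots> \<le> ennreal (B powr p)"
      by (intro ennreal_leI iffD1[OF Lp_norm_le_iff[OF p0 B]] s(2))
    finally show ?thesis .
  qed
  have "(\<integral>\<^sup>+x. (SUP N. ennreal (?s N x powr p)) \<partial>lebesgue) = (SUP N. \<integral>\<^sup>+x. ennreal (?s N x powr p) \<partial>lebesgue)"
  proof (intro nn_integral_monotone_convergence_SUP)
    show "incseq (\<lambda>i x. ennreal ((\<Sum>k<i. norm (u k x)) powr p))"
      using p0 by (auto simp: incseq_def le_fun_def intro!: ennreal_leI powr_mono2 sum_mono2 sum_nonneg)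
  qed measurable
  also have "\<dots> \<le> ennreal (B powr p)" by (intro SUP_least fin)
  finally have "(\<integral>\<^sup>+x. (SUP N. ennreal (?s N x powr p)) \<partial>lebesgue) \<noteq> \<infinity>" by (auto simp: top_unique)
  then have "AE x in lebesgue. (SUP N. ennreal (?s N x powr p)) \<noteq> \<infinity>"
    by (intro nn_integral_noteq_infinite) measurable
  then show ae: "AE x in lebesgue. summable (\<lambda>k. norm (u k x))"
  proof eventually_elim
    case (elim x)
    then obtain c where c: "(SUP N. ennreal (?s N x powr p)) = ennreal c" "0 \<le> c"
      by (cases "SUP N. ennreal (?s N x powr p)") auto
    have "?s N x \<le> c powr (1/p)" for N
    proof -
      have "ennreal (?s N x powr p) \<le> ennreal c" unfolding c(1)[symmetric] by (intro SUP_upper) auto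
      then have "(?s N x powr p) powr (1/p) \<le> c powr (1/p)"
        using p0 c(2) by (intro powr_mono2) auto
      then show ?thesis using p0 by (simp add: powr_powr sum_nonneg)
    qed
    then show ?case by (intro summableI_nonneg_bounded[of _ "c powr (1/p)"]) auto
  qed
  have aes: "AE x in lebesgue. summable (\<lambda>k. u k x)"
    using ae by eventually_elim (rule summable_norm_cancel)
  have meas[measurable]: "(\<lambda>x. \<Sum>k. u k x) \<in> borel_measurable lebesgue" by measurable
  have N: "(\<lambda>x. \<Sum>k\<in>I. u k x) \<in> Lp_space p" "Lp_norm p (\<lambda>x. \<Sum>k\<in>I. u k x) \<le> (\<Sum>k\<in>I. Lp_norm p (u k))" if "finite I" for I
    using Lp_space_sum[OF p that, of u] u by auto
  have tot: "Lp_norm p (\<lambda>x. \<Sum>k<N. u k x) \<le> B" for N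
    using N(2)[of "{..<N}"] sum_le_suminf[OF sm, of "{..<N}"] Lp_norm_nonneg[of p] by (auto simp: B_def intro: order_trans)
  have lim: "AE x in lebesgue. (\<lambda>N. \<Sum>k<N. u k x) \<longlonglongrightarrow> (\<Sum>k. u k x)"
    using aes by eventually_elim (rule summable_LIMSEQ)
  show sp: "(\<lambda>x. \<Sum>k. u k x) \<in> Lp_space p" and "Lp_norm p (\<lambda>x. \<Sum>k. u k x) \<le> (\<Sum>k. Lp_norm p (u k))"
    using Lp_bounded_AE_convergent[OF p0 N(1) lim meas tot] by (auto simp: B_def)
  show "(\<lambda>x. \<Sum>k. norm (u k x)) \<in> Lp_space p"
  proof (rule Lp_bounded_AE_convergent(1)[OF p0 s(1) _ _ s(2)])
    show "AE x in lebesgue. (\<lambda>N. complex_of_real (?s N x)) \<longlonglongrightarrow> complex_of_real (\<Sum>k. norm (u k x))"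
      using ae by eventually_elim (intro tendsto_of_real summable_LIMSEQ)
  qed measurable
  have tail: "Lp_norm p (\<lambda>x. (\<Sum>k. u k x) - (\<Sum>k<N. u k x)) \<le> B - (\<Sum>k<N. Lp_norm p (u k))" for N
  proof (rule Lp_bounded_AE_convergent(2)[OF p0])
    show "(\<lambda>x. \<Sum>k\<in>{N..<N+n}. u k x) \<in> Lp_space p" for n by (rule N(1)) auto
    show "AE x in lebesgue. (\<lambda>n. \<Sum>k\<in>{N..<N+n}. u k x) \<longlonglongrightarrow> (\<Sum>k. u k x) - (\<Sum>k<N. u k x)"
      using lim
    proof eventually_elim
      case (elim x)
      have "(\<lambda>n. (\<Sum>k<n+N. u k x) - (\<Sum>k<N. u k x)) \<longlonglongrightarrow> (\<Sum>k. u k x) - (\<Sum>k<N. u k x)"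
        by (intro tendsto_diff tendsto_const LIMSEQ_ignore_initial_segment[OF elim])
      moreover have "(\<Sum>k<n+N. u k x) - (\<Sum>k<N. u k x) = (\<Sum>k\<in>{N..<N+n}. u k x)" for n
        using sum.atLeastLessThan_concat[of 0 N "N+n" "\<lambda>k. u k x"] by (simp add: atLeast0LessThan algebra_simps)
      ultimately show ?case by simp
    qed
    show "Lp_norm p (\<lambda>x. \<Sum>k\<in>{N..<N+n}. u k x) \<le> B - (\<Sum>k<N. Lp_norm p (u k))" for n
    proof -
      have "(\<Sum>k\<in>{N..<N+n}. Lp_norm p (u k)) + (\<Sum>k<N. Lp_norm p (u k)) = (\<Sum>k<N+n. Lp_norm p (u k))"
        using sum.atLeastLessThan_concat[of 0 N "N+n" "\<lambda>k. Lp_norm p (u k)"] by (simp add: atLeast0LessThan algebra_simps)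
      also have "\<dots> \<le> B" unfolding B_def by (intro sum_le_suminf sm) (auto simp: Lp_norm_nonneg)
      finally show ?thesis using N(2)[of "{N..<N+n}"] by simp
    qed
  qed measurable
  have "(\<lambda>N. B - (\<Sum>k<N. Lp_norm p (u k))) \<longlonglongrightarrow> B - B"
    unfolding B_def by (intro tendsto_diff tendsto_const summable_LIMSEQ sm)
  then show "(\<lambda>N. Lp_norm p (\<lambda>x. (\<Sum>k. u k x) - (\<Sum>k<N. u k x))) \<longlonglongrightarrow> 0"
    using real_tendsto_sandwich[where f = "\<lambda>_. 0" and h = "\<lambda>N. B - (\<Sum>k<N. Lp_norm p (u k))"
      and g = "\<lambda>N. Lp_norm p (\<lambda>x. (\<Sum>k. u k x) - (\<Sum>k<N. u k x))"]
    by (simp add: tail Lp_norm_nonneg)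
qed

lemma Lp_complete:
  fixes f :: "nat \<Rightarrow> 'a::euclidean_space \<Rightarrow> complex"
  assumes p: "1 \<le> p" and f: "\<And>n. f n \<in> Lp_space p"
    and cauchy: "\<And>e. 0 < e \<Longrightarrow> \<exists>N. \<forall>m\<ge>N. \<forall>n\<ge>N. Lp_norm p (\<lambda>x. f m x - f n x) < e"
  shows "\<exists>g\<in>Lp_space p. (\<lambda>n. Lp_norm p (\<lambda>x. f n x - g x)) \<longlonglongrightarrow> 0"
proof -
  have "\<exists>N. \<forall>k. (\<forall>m\<ge>N k. \<forall>n\<ge>N k. Lp_norm p (\<lambda>x. f m x - f n x) < (1/2)^k)"
    by (intro choice allI cauchy) auto
  then obtain N0 where N0: "\<And>k m n. m \<ge> N0 k \<Longrightarrow> n \<ge> N0 k \<Longrightarrow> Lp_norm p (\<lambda>x. f m x - f n x) < (1/2)^k" by blast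
  define N where "N k = (\<Sum>i\<le>k. N0 i)" for k
  have N_ge: "N0 k \<le> N j" if "k \<le> j" for k j
    using that member_le_sum[of k "{..j}" N0] by (auto simp: N_def)
  define u where "u k = (\<lambda>x. f (N (Suc k)) x - f (N k) x)" for k
  have u: "u k \<in> Lp_space p" for k unfolding u_def by (intro Lp_space_diff p f)
  have "summable (\<lambda>k. Lp_norm p (u k))"
  proof (rule summable_comparison_test'[of "\<lambda>k. (1/2)^k" 0])
    show "norm (Lp_norm p (u k)) \<le> (1/2)^k" for k
      using N0[of k "N (Suc k)" "N k"] N_ge[of k k] N_ge[of k "Suc k"] Lp_norm_nonneg[of p "u k"] by (simp add: u_def)
  qed simp
  note ser = Lp_series[OF p u this]
  define g where "g x = f (N 0) x + (\<Sum>k. u k x)" for x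
  have g: "g \<in> Lp_space p" unfolding g_def by (intro Lp_space_triangle p f ser)
  have tel: "(\<Sum>k<n. u k x) = f (N n) x - f (N 0) x" for n x
    unfolding u_def by (subst sum_lessThan_telescope) simp
  have lim: "(\<lambda>n. Lp_norm p (\<lambda>x. g x - f (N n) x)) \<longlonglongrightarrow> 0"
    using ser(5) by (simp add: tel g_def algebra_simps)
  show ?thesis
  proof (intro bexI[OF _ g] LIMSEQ_I)
    fix e :: real assume e: "0 < e"
    obtain k where k: "(1/2::real)^k < e/2" using real_arch_pow_inv[of "e/2" "1/2"] e by auto
    obtain M where M: "\<And>n. n \<ge> M \<Longrightarrow> Lp_norm p (\<lambda>x. g x - f (N n) x) < e/2"
      using LIMSEQ_D[OF lim, of "e/2"] e
      by (auto simp: abs_of_nonneg[OF Lp_norm_nonneg])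
    have "Lp_norm p (\<lambda>x. f n x - g x) < e" if "n \<ge> N0 k" for n
    proof -
      let ?m = "max M k"
      have "Lp_norm p (\<lambda>x. f n x - g x) \<le> Lp_norm p (\<lambda>x. f n x - f (N ?m) x) + Lp_norm p (\<lambda>x. f (N ?m) x - g x)"
        by (intro Lp_norm_triangle_diff p f g)
      also have "Lp_norm p (\<lambda>x. f n x - f (N ?m) x) < e/2"
        using N0[of k n "N ?m"] N_ge[of k ?m] that k by simp
      also have "Lp_norm p (\<lambda>x. f (N ?m) x - g x) < e/2"
        using M[of ?m] by (subst Lp_norm_minus_commute) simp
      finally show ?thesis by simp
    qed
    then show "\<exists>no. \<forall>n\<ge>no. norm (Lp_norm p (\<lambda>x. f n x - g x) - 0) < e"
      by (auto simp: abs_of_nonneg[OF Lp_norm_nonneg] intro!: exI[of _ "N0 k"])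
  qed
qed

text \<open>
  Young's inequality is integrated after dividing \<open>f\<close> and \<open>g\<close> by upper bounds of their norms;
  letting these bounds decrease to the norms covers the case of norm zero as well.
\<close>

lemma Holder:
  fixes f g :: "'a::euclidean_space \<Rightarrow> complex"
  assumes pq: "1 < p" "1 < q" "1/p + 1/q = 1" and f: "f \<in> Lp_space p" and g: "g \<in> Lp_space q"
  shows "integrable lebesgue (\<lambda>x. f x * g x)"
    and "(LINT x|lebesgue. norm (f x * g x)) \<le> Lp_norm p f * Lp_norm q g"
proof -
  note [measurable] = Lp_space_measurable[OF f] Lp_space_measurable[OF g]
  have Y: "norm (f x) * norm (g x) \<le> a * b * (norm (f x) powr p / a powr p / p + norm (g x) powr q / b powr q / q)"
    if "0 < a" "0 < b" for a b x
  proof -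
    have "(norm (f x) / a) * (norm (g x) / b) \<le> (norm (f x) / a) powr p / p + (norm (g x) / b) powr q / q"
      using pq that by (intro Youngs_inequality) auto
    then show ?thesis using that by (simp add: powr_divide field_simps)
  qed
  have int: "integrable lebesgue (\<lambda>x. a * b * (norm (f x) powr p / a powr p / p + norm (g x) powr q / b powr q / q))" for a b
    using Lp_space_integrable[OF f] Lp_space_integrable[OF g] by simp
  show i: "integrable lebesgue (\<lambda>x. f x * g x)"
    by (rule Bochner_Integration.integrable_bound[OF int[of 1 1]])
       (use Y[of 1 1] in \<open>auto simp: norm_mult intro!: order_trans[OF _ abs_ge_self]\<close>)
  have pos: "(LINT x|lebesgue. norm (f x * g x)) \<le> a * b"
    if ab: "0 < a" "0 < b" "Lp_norm p f \<le> a" "Lp_norm q g \<le> b" for a b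
  proof -
    have "(LINT x|lebesgue. norm (f x * g x)) \<le> (LINT x|lebesgue. a * b * (norm (f x) powr p / a powr p / p + norm (g x) powr q / b powr q / q))"
      using Y[OF ab(1,2)] by (intro integral_mono integrable_norm i int) (simp add: norm_mult)
    also have "\<dots> = a * b * ((LINT x|lebesgue. norm (f x) powr p) / a powr p / p + (LINT x|lebesgue. norm (g x) powr q) / b powr q / q)"
      using Lp_space_integrable[OF f] Lp_space_integrable[OF g] by simp
    also have "\<dots> \<le> a * b * (1 / p + 1 / q)"
      using ab pq by (intro mult_left_mono add_mono divide_right_mono) (auto simp: Lp_norm_le_iff)
    finally show ?thesis using pq by simp
  qed
  have "((\<lambda>e. (Lp_norm p f + e) * (Lp_norm q g + e)) \<longlongrightarrow> (Lp_norm p f + 0) * (Lp_norm q g + 0)) (at_right 0)"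
    by (intro tendsto_intros)
  moreover have "\<forall>\<^sub>F e in at_right 0. (LINT x|lebesgue. norm (f x * g x)) \<le> (Lp_norm p f + e) * (Lp_norm q g + e)"
    using Lp_norm_nonneg[of p f] Lp_norm_nonneg[of q g]
    by (intro eventually_at_right_less[THEN eventually_mono] pos) auto
  ultimately show "(LINT x|lebesgue. norm (f x * g x)) \<le> Lp_norm p f * Lp_norm q g"
    by (intro tendsto_lowerbound[where F="at_right 0"]) auto
qed

section \<open>Riesz representation on a subspace of square integrable functions\<close>

lemma L2_integrable_square: "f \<in> Lp_space 2 \<Longrightarrow> integrable lebesgue (\<lambda>x. (norm (f x))\<^sup>2)"
  using Lp_space_integrable[of f 2] by simp

lemma L2_norm_square: "(Lp_norm 2 f)\<^sup>2 = (LINT x|lebesgue. (norm (f x))\<^sup>2)"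
  using Lp_norm_powr[of 2 f] Lp_norm_nonneg[of 2 f] by simp

lemma L2_Cauchy_Schwarz:
  assumes "f \<in> Lp_space 2" "g \<in> Lp_space 2"
  shows "integrable lebesgue (\<lambda>x. f x * g x)"
    and "norm (LINT x|lebesgue. f x * g x) \<le> Lp_norm 2 f * Lp_norm 2 g"
  using Holder[of 2 2 f g] assms order_trans[OF integral_norm_bound[of lebesgue "\<lambda>x. f x * g x"]] by simp_all

lemma L2_norm_square_add:
  fixes t :: real and f h :: "'a::euclidean_space \<Rightarrow> complex"
  assumes f: "f \<in> Lp_space 2" and h: "h \<in> Lp_space 2"
  shows "(Lp_norm 2 (\<lambda>x. f x + t * h x))\<^sup>2
    = (Lp_norm 2 f)\<^sup>2 + 2 * t * Re (LINT x|lebesgue. h x * cnj (f x)) + t\<^sup>2 * (Lp_norm 2 h)\<^sup>2"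
proof -
  have i: "integrable lebesgue (\<lambda>x. h x * cnj (f x))"
    by (intro L2_Cauchy_Schwarz h Lp_space_cnj f)
  have "(norm (f x + t * h x))\<^sup>2 = (norm (f x))\<^sup>2 + 2 * t * Re (h x * cnj (f x)) + t\<^sup>2 * (norm (h x))\<^sup>2" for x
    unfolding cmod_power2 by (simp add: power2_eq_square algebra_simps)
  then have "(LINT x|lebesgue. (norm (f x + t * h x))\<^sup>2)
    = (LINT x|lebesgue. (norm (f x))\<^sup>2 + 2 * t * Re (h x * cnj (f x)) + t\<^sup>2 * (norm (h x))\<^sup>2)" by presburger
  then show ?thesis
    using L2_integrable_square[OF f] L2_integrable_square[OF h] i
    by (simp add: L2_norm_square del: times_complex.sel)
qed

text \<open>
  In the application \<open>V\<close> is not complete, so the representing function is sought in \<open>L\<^sup>2\<close>. A minimising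
  sequence of \<open>J f = \<parallel>f\<parallel>\<^sup>2 - 2 * Re (l f)\<close> in \<open>V\<close> is a Cauchy sequence by the parallelogram law,
  and its limit \<open>u\<close> in \<open>L\<^sup>2\<close> satisfies the Euler equation \<open>Re (l h) = Re \<langle>h, u\<rangle>\<close> for all \<open>h\<close> in \<open>V\<close>.
  The factor 2 in the bound is what comes out of \<open>J (f n) \<le> 1 / Suc n\<close> directly.
\<close>

lemma Riesz_representation_subspace:
  fixes V :: "('a::euclidean_space \<Rightarrow> complex) set"
  assumes V: "V \<subseteq> Lp_space 2" and V0: "(\<lambda>x. 0) \<in> V"
    and V_add: "\<And>f g. f \<in> V \<Longrightarrow> g \<in> V \<Longrightarrow> (\<lambda>x. f x + g x) \<in> V"
    and V_scale: "\<And>c f. f \<in> V \<Longrightarrow> (\<lambda>x. c * f x) \<in> V"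
    and l_add: "\<And>f g. f \<in> V \<Longrightarrow> g \<in> V \<Longrightarrow> l (\<lambda>x. f x + g x) = l f + l g"
    and l_scale: "\<And>c f. f \<in> V \<Longrightarrow> l (\<lambda>x. c * f x) = c * l f"
    and bound: "\<And>f. f \<in> V \<Longrightarrow> norm (l f) \<le> C * Lp_norm 2 f" and C: "0 \<le> C"
  shows "\<exists>u\<in>Lp_space 2. Lp_norm 2 u \<le> 2 * C \<and> (\<forall>f\<in>V. l f = (LINT x|lebesgue. f x * u x))"
proof -
  define J where "J f = (Lp_norm 2 f)\<^sup>2 - 2 * Re (l f)" for f
  have inL: "f \<in> Lp_space 2" if "f \<in> V" for f using V that by auto
  have Re_l: "Re (l f) \<le> C * Lp_norm 2 f" if "f \<in> V" for f
    using bound[OF that] complex_Re_le_cmod[of "l f"] by linarith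
  have J_ge: "- C\<^sup>2 \<le> J f" if "f \<in> V" for f
    using Re_l[OF that] zero_le_power2[of "Lp_norm 2 f - C"] by (simp add: J_def power2_eq_square algebra_simps)
  define d where "d = Inf (J ` V)"
  have bdd: "bdd_below (J ` V)" using J_ge by (auto intro!: bdd_belowI2)
  have d_le: "d \<le> J f" if "f \<in> V" for f unfolding d_def by (intro cInf_lower bdd imageI that)
  have "\<exists>f\<in>V. J f < d + 1 / Suc n" for n
  proof -
    have "\<exists>y\<in>J ` V. y < d + 1 / Suc n"
      unfolding d_def by (rule cInf_lessD) (use V0 in \<open>auto\<close>)
    then show ?thesis by auto
  qed
  then obtain f where f: "\<And>n. f n \<in> V" and Jf: "\<And>n. J (f n) < d + 1 / Suc n" by metis
  note fL = inL[OF f]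
  have J_add: "J (\<lambda>x. g x + t * h x) = J g + 2 * t * (Re (LINT x|lebesgue. h x * cnj (g x)) - Re (l h)) + t\<^sup>2 * (Lp_norm 2 h)\<^sup>2"
    if "g \<in> V" "h \<in> V" for g h :: "'a \<Rightarrow> complex" and t :: real
    unfolding J_def using that L2_norm_square_add[OF inL inL, of g h t]
    by (simp add: l_add l_scale V_scale algebra_simps)
  have para: "(Lp_norm 2 (\<lambda>x. g x - h x))\<^sup>2 \<le> 2 * J g + 2 * J h - 4 * d" if g: "g \<in> V" and h: "h \<in> V" for g h
  proof -
    have "d \<le> J (\<lambda>x. (1/2) * (g x + of_real 1 * h x))"
      by (intro d_le V_scale V_add) (use g h in auto)
    also have "\<dots> = (Lp_norm 2 (\<lambda>x. g x + of_real 1 * h x))\<^sup>2 / 4 - Re (l g) - Re (l h)"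
    proof -
      have gh: "(\<lambda>x. g x + of_real 1 * h x) \<in> V" by (intro V_add V_scale g h)
      have "l (\<lambda>x. g x + of_real 1 * h x) = l g + l h" using l_add[OF g h] by simp
      then show ?thesis
        unfolding J_def l_scale[OF gh] by (subst Lp_norm_scale) (simp_all add: power2_eq_square add_divide_distrib)
    qed
    finally have "4 * d \<le> (Lp_norm 2 (\<lambda>x. g x + of_real 1 * h x))\<^sup>2 - 4 * Re (l g) - 4 * Re (l h)" by simp
    moreover have "(Lp_norm 2 (\<lambda>x. g x - h x))\<^sup>2 + (Lp_norm 2 (\<lambda>x. g x + of_real 1 * h x))\<^sup>2 = 2 * (Lp_norm 2 g)\<^sup>2 + 2 * (Lp_norm 2 h)\<^sup>2"
      using L2_norm_square_add[OF inL[OF g] inL[OF h], of 1] L2_norm_square_add[OF inL[OF g] inL[OF h], of "-1"] by simp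
    ultimately show ?thesis by (simp add: J_def)
  qed
  have "\<exists>u\<in>Lp_space 2. (\<lambda>n. Lp_norm 2 (\<lambda>x. f n x - u x)) \<longlonglongrightarrow> 0"
  proof (rule Lp_complete)
    fix e :: real assume e: "0 < e"
    obtain N :: nat where N: "1 / (e\<^sup>2 / 4) < N" using reals_Archimedean2 by blast
    have Nk: "1 / Suc k < e\<^sup>2 / 4" if "k \<ge> N" for k
    proof -
      have "1 / (e\<^sup>2 / 4) < Suc k" using N that by simp
      then show ?thesis using e by (simp add: field_simps)
    qed
    have "Lp_norm 2 (\<lambda>x. f m x - f n x) < e" if "m \<ge> N" "n \<ge> N" for m n
    proof (rule power_less_imp_less_base)
      show "(Lp_norm 2 (\<lambda>x. f m x - f n x))\<^sup>2 < e\<^sup>2"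
        using para[OF f f, of m n] Jf[of m] Jf[of n] Nk[OF that(1)] Nk[OF that(2)] by linarith
    qed (use e in auto)
    then show "\<exists>N. \<forall>m\<ge>N. \<forall>n\<ge>N. Lp_norm 2 (\<lambda>x. f m x - f n x) < e" by blast
  qed (use fL in auto)
  then obtain u where u: "u \<in> Lp_space 2" and lim: "(\<lambda>n. Lp_norm 2 (\<lambda>x. f n x - u x)) \<longlonglongrightarrow> 0" by blast
  let ?ip = "\<lambda>h u. LINT x|lebesgue. h x * cnj (u x)"
  have Re_eq: "Re (l h) = Re (?ip h u)" if h: "h \<in> V" for h
  proof -
    have ih: "integrable lebesgue (\<lambda>x. h x * cnj (f n x))" for n
      by (intro L2_Cauchy_Schwarz inL h f Lp_space_cnj)
    have iu: "integrable lebesgue (\<lambda>x. h x * cnj (u x))"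
      by (intro L2_Cauchy_Schwarz inL h u Lp_space_cnj)
    have "(\<lambda>n. (?ip h (f n)) - (?ip h u)) \<longlonglongrightarrow> 0"
    proof (rule Lim_null_comparison)
      show "\<forall>\<^sub>F n in sequentially. norm ((?ip h (f n)) - (?ip h u))
          \<le> Lp_norm 2 h * Lp_norm 2 (\<lambda>x. f n x - u x)"
      proof (intro always_eventually allI)
        fix n
        have "(?ip h (f n)) - (?ip h u) = (LINT x|lebesgue. h x * cnj (f n x - u x))"
          using ih[of n] iu by (simp add: algebra_simps)
        also have "norm \<dots> \<le> Lp_norm 2 h * Lp_norm 2 (\<lambda>x. cnj (f n x - u x))"
          by (intro L2_Cauchy_Schwarz inL h Lp_space_cnj Lp_space_diff fL u) simp
        also have "Lp_norm 2 (\<lambda>x. cnj (f n x - u x)) = Lp_norm 2 (\<lambda>x. f n x - u x)"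
          unfolding Lp_norm_def by (simp only: complex_mod_cnj)
        finally show "norm ((?ip h (f n)) - (?ip h u))
          \<le> Lp_norm 2 h * Lp_norm 2 (\<lambda>x. f n x - u x)" .
      qed
      show "(\<lambda>n. Lp_norm 2 h * Lp_norm 2 (\<lambda>x. f n x - u x)) \<longlonglongrightarrow> 0"
        using tendsto_mult_right_zero[OF lim] .
    qed
    then have L: "(\<lambda>n. Re (?ip h (f n))) \<longlonglongrightarrow> Re (?ip h u)"
      by (intro tendsto_Re) (simp add: Lim_null[symmetric])
    define a where "a = Re (?ip h u) - Re (l h)"
    define b where "b = (Lp_norm 2 h)\<^sup>2"
    have ineq: "0 \<le> 2 * t * a + t\<^sup>2 * b" for t
    proof -
      have "(\<lambda>n. 1 / Suc n + 2 * t * (Re (?ip h (f n)) - Re (l h)) + t\<^sup>2 * b)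
          \<longlonglongrightarrow> 0 + 2 * t * a + t\<^sup>2 * b"
        unfolding a_def using lim_inverse_n'
        by (intro tendsto_intros L) (use LIMSEQ_Suc[OF lim_1_over_n] in simp)
      moreover have "0 \<le> 1 / Suc n + 2 * t * (Re (?ip h (f n)) - Re (l h)) + t\<^sup>2 * b" for n
      proof -
        have "d \<le> J (\<lambda>x. f n x + t * h x)" by (intro d_le V_add V_scale f h)
        then show ?thesis using J_add[OF f h, of n t] Jf[of n] by (simp add: b_def)
      qed
      ultimately show ?thesis by (intro LIMSEQ_le_const[of _ "2 * t * a + t\<^sup>2 * b"]) auto
    qed
    have b0: "0 \<le> b" by (simp add: b_def)
    \<comment> \<open>A parabola through the origin which is nonnegative has slope 0 there.\<close>
    have "a = 0"
    proof (rule ccontr)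
      assume "a \<noteq> 0"
      define t where "t = - a / (b + 1)"
      have "t \<noteq> 0" and a: "a = - t * (b + 1)" using b0 \<open>a \<noteq> 0\<close> by (auto simp: t_def)
      have "2 * t * a + t\<^sup>2 * b = - (t\<^sup>2 * (b + 2))" unfolding a by (simp add: algebra_simps power2_eq_square)
      moreover have "0 < t\<^sup>2 * (b + 2)" using b0 \<open>t \<noteq> 0\<close> by (intro mult_pos_pos) auto
      ultimately show False using ineq[of t] by simp
    qed
    then show ?thesis by (simp add: a_def)
  qed
  have eq: "l h = (?ip h u)" if h: "h \<in> V" for h
  proof (rule complex_eqI)
    show "Re (l h) = Re (?ip h u)" by (rule Re_eq[OF h])
    have "Re (l (\<lambda>x. \<i> * h x)) = Re (LINT x|lebesgue. \<i> * (h x * cnj (u x)))"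
      using Re_eq[OF V_scale[OF h, of \<i>]] by (simp add: mult.assoc)
    then show "Im (l h) = Im (?ip h u)"
      using l_scale[OF h, of \<i>] by simp
  qed
  have "Lp_norm 2 u \<le> 2 * C"
  proof -
    have "l (\<lambda>x. 0) = 0" using l_scale[OF V0, of 0] by simp
    then have J0: "J (\<lambda>x. 0) = 0" by (simp add: J_def Lp_norm_zero)
    have "(\<lambda>n. Lp_norm 2 (f n) - Lp_norm 2 u) \<longlonglongrightarrow> 0"
    proof (rule Lim_null_comparison[OF always_eventually lim], intro allI)
      show "norm (Lp_norm 2 (f n) - Lp_norm 2 u) \<le> Lp_norm 2 (\<lambda>x. f n x - u x)" for n
        using Lp_norm_le_add_diff[of 2, OF _ fL[of n] u] Lp_norm_le_add_diff[of 2, OF _ u fL[of n]]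
        by (simp add: Lp_norm_minus_commute[of 2 u] abs_le_iff)
    qed
    then have L: "(\<lambda>n. Lp_norm 2 (f n)) \<longlonglongrightarrow> Lp_norm 2 u" by (simp add: Lim_null[symmetric])
    have "(Lp_norm 2 (f n))\<^sup>2 \<le> 2 * C * Lp_norm 2 (f n) + 1 / Suc n" for n
      using Jf[of n] d_le[OF V0] J0 Re_l[OF f[of n]] by (simp add: J_def)
    moreover have "(\<lambda>n. 2 * C * Lp_norm 2 (f n) + 1 / Suc n) \<longlonglongrightarrow> 2 * C * Lp_norm 2 u + 0"
      by (intro tendsto_intros L) (use LIMSEQ_Suc[OF lim_1_over_n] in simp)
    moreover have "(\<lambda>n. (Lp_norm 2 (f n))\<^sup>2) \<longlonglongrightarrow> (Lp_norm 2 u)\<^sup>2" by (intro tendsto_intros L)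
    ultimately have "(Lp_norm 2 u)\<^sup>2 \<le> 2 * C * Lp_norm 2 u"
      using LIMSEQ_le[of "\<lambda>n. (Lp_norm 2 (f n))\<^sup>2" _ "\<lambda>n. 2 * C * Lp_norm 2 (f n) + 1 / Suc n"] by auto
    then have "Lp_norm 2 u * (Lp_norm 2 u - 2 * C) \<le> 0" by (simp add: power2_eq_square algebra_simps)
    then show ?thesis using Lp_norm_nonneg[of 2 u] C by (auto simp: mult_le_0_iff)
  qed
  moreover have "Lp_norm 2 (\<lambda>x. cnj (u x)) = Lp_norm 2 u" by (simp add: Lp_norm_def)
  ultimately show ?thesis using eq by (intro bexI[OF _ Lp_space_cnj[OF u]]) auto
qed

section \<open>Schwartz functions\<close>

lemma schwartz_iterated_differentiable:
  "f \<in> schwartz_space \<Longrightarrow> iterated_partial js f differentiable (at x)"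
  by (auto simp: schwartz_space_def differentiable_on_def)

lemma iterated_partial_add:
  assumes "f \<in> schwartz_space" "g \<in> schwartz_space"
  shows "iterated_partial js (\<lambda>x. f x + g x) = (\<lambda>x. iterated_partial js f x + iterated_partial js g x)"
proof (induction js)
  case (Cons j js)
  have "frechet_derivative (\<lambda>x. iterated_partial js f x + iterated_partial js g x) (at x)
      = (\<lambda>h. frechet_derivative (iterated_partial js f) (at x) h + frechet_derivative (iterated_partial js g) (at x) h)" for x
    using assms by (intro frechet_derivative_at[symmetric] has_derivative_add)
      (simp_all add: frechet_derivative_works[symmetric] schwartz_iterated_differentiable)
  then show ?case by (simp add: Cons)
qed simp

lemma iterated_partial_scale:
  assumes "f \<in> schwartz_space"
  shows "iterated_partial js (\<lambda>x. c * f x) = (\<lambda>x. c * iterated_partial js f x)"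
proof (induction js)
  case (Cons j js)
  have "frechet_derivative (\<lambda>x. c * iterated_partial js f x) (at x)
      = (\<lambda>h. c * frechet_derivative (iterated_partial js f) (at x) h)" for x
    using assms by (intro frechet_derivative_at[symmetric] has_derivative_mult_right)
      (simp_all add: frechet_derivative_works[symmetric] schwartz_iterated_differentiable)
  then show ?case by (simp add: Cons)
qed simp

lemma schwartz_add:
  assumes "f \<in> schwartz_space" "g \<in> schwartz_space"
  shows "(\<lambda>x. f x + g x) \<in> schwartz_space"
  unfolding schwartz_space_def
proof (intro CollectI allI conjI)
  fix js and m :: nat
  show "iterated_partial js (\<lambda>x. f x + g x) differentiable_on UNIV"
    using assms by (auto simp: iterated_partial_add schwartz_space_def)
  have "bounded (range (\<lambda>x. norm x ^ m *\<^sub>R iterated_partial js f x))" "bounded (range (\<lambda>x. norm x ^ m *\<^sub>R iterated_partial js g x))"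
    using assms by (auto simp: schwartz_space_def)
  then show "bounded (range (\<lambda>x. norm x ^ m *\<^sub>R iterated_partial js (\<lambda>x. f x + g x) x))"
    using bounded_plus_comp[of "\<lambda>x. norm x ^ m *\<^sub>R iterated_partial js f x" UNIV "\<lambda>x. norm x ^ m *\<^sub>R iterated_partial js g x"]
    by (simp add: iterated_partial_add assms scaleR_add_right)
qed

lemma schwartz_scale:
  assumes "f \<in> schwartz_space"
  shows "(\<lambda>x. c * f x) \<in> schwartz_space"
  unfolding schwartz_space_def
proof (intro CollectI allI conjI)
  fix js and m :: nat
  show "iterated_partial js (\<lambda>x. c * f x) differentiable_on UNIV"
    using assms by (auto simp: iterated_partial_scale schwartz_space_def intro!: differentiable_on_mult)
  have "bounded (range (\<lambda>x. norm x ^ m *\<^sub>R iterated_partial js f x))"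
    using assms by (auto simp: schwartz_space_def)
  then obtain B where "\<And>x. norm (norm x ^ m *\<^sub>R iterated_partial js f x) \<le> B" by (auto simp: bounded_iff)
  then have "norm (norm x ^ m *\<^sub>R iterated_partial js (\<lambda>x. c * f x) x) \<le> norm c * B" for x
    using mult_left_mono[of _ B "norm c"] by (simp add: iterated_partial_scale assms norm_mult mult.left_commute)
  then show "bounded (range (\<lambda>x. norm x ^ m *\<^sub>R iterated_partial js (\<lambda>x. c * f x) x))"
    by (auto simp: bounded_iff)
qed

text \<open>
  A partial derivative of a product of functions of the single coordinates differentiates one
  factor. So if \<open>F i\<close> lists the successive derivatives of a function of one variable, the
  iterated partial derivative along \<open>js\<close> only shifts each index by the multiplicity of \<open>i\<close> in \<open>js\<close>.
\<close>

lemma iterated_partial_prod: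
  fixes F :: "'n::finite \<Rightarrow> nat \<Rightarrow> real \<Rightarrow> complex"
  assumes "\<And>i k u. (F i k has_vector_derivative F i (Suc k) u) (at u)"
  shows "iterated_partial js (\<lambda>x. \<Prod>i\<in>UNIV. F i 0 (x $ i)) = (\<lambda>x. \<Prod>i\<in>UNIV. F i (count_list js i) (x $ i))"
    and "((\<lambda>x. \<Prod>i\<in>UNIV. F i (m i) (x $ i)) has_derivative
      (\<lambda>h. \<Sum>i\<in>UNIV. (h $ i *\<^sub>R F i (Suc (m i)) (x $ i)) * (\<Prod>j\<in>UNIV - {i}. F j (m j) (x $ j)))) (at x)"
proof -
  show D: "((\<lambda>x. \<Prod>i\<in>UNIV. F i (m i) (x $ i)) has_derivative
      (\<lambda>h. \<Sum>i\<in>UNIV. (h $ i *\<^sub>R F i (Suc (m i)) (x $ i)) * (\<Prod>j\<in>UNIV - {i}. F j (m j) (x $ j)))) (at x)" for m x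
  proof (intro has_derivative_prod)
    fix i
    have "(F i (m i) has_derivative (\<lambda>h. h *\<^sub>R F i (Suc (m i)) (x $ i))) (at (x $ i))"
      using assms[of i "m i" "x $ i"] by (simp add: has_vector_derivative_def)
    moreover have "((\<lambda>x. x $ i) has_derivative (\<lambda>h. h $ i)) (at x)"
      by (intro bounded_linear_imp_has_derivative bounded_linear_vec_nth)
    ultimately show "((\<lambda>x. F i (m i) (x $ i)) has_derivative (\<lambda>h. h $ i *\<^sub>R F i (Suc (m i)) (x $ i))) (at x)"
      using has_derivative_compose[of "\<lambda>x. x $ i"] by blast
  qed
  show "iterated_partial js (\<lambda>x. \<Prod>i\<in>UNIV. F i 0 (x $ i)) = (\<lambda>x. \<Prod>i\<in>UNIV. F i (count_list js i) (x $ i))"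
  proof (induction js)
    case (Cons j js)
    have "frechet_derivative (\<lambda>x. \<Prod>i\<in>UNIV. F i (count_list js i) (x $ i)) (at x) (axis j 1)
      = (\<Prod>i\<in>UNIV. F i (count_list (j # js) i) (x $ i))" for x
    proof -
      have "frechet_derivative (\<lambda>x. \<Prod>i\<in>UNIV. F i (count_list js i) (x $ i)) (at x) (axis j 1)
        = (\<Sum>i\<in>UNIV. (axis j (1::real) $ i *\<^sub>R F i (Suc (count_list js i)) (x $ i)) * (\<Prod>k\<in>UNIV - {i}. F k (count_list js k) (x $ k)))"
        by (subst frechet_derivative_at[OF D, symmetric]) simp
      also have "\<dots> = (\<Sum>i\<in>UNIV. if i = j then F j (Suc (count_list js j)) (x $ j) * (\<Prod>k\<in>UNIV - {j}. F k (count_list js k) (x $ k)) else 0)"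
        by (intro sum.cong) (auto simp: axis_def)
      also have "\<dots> = F j (Suc (count_list js j)) (x $ j) * (\<Prod>k\<in>UNIV - {j}. F k (count_list (j # js) k) (x $ k))"
        by (simp add: sum.delta)
      also have "\<dots> = (\<Prod>i\<in>UNIV. F i (count_list (j # js) i) (x $ i))"
        by (subst prod.remove[of UNIV j]) auto
      finally show ?thesis .
    qed
    then show ?case by (simp only: iterated_partial.simps Cons)
  qed simp
qed

lemma norm_le_prod_cart:
  fixes x :: "real^'n::finite"
  shows "norm x \<le> (\<Prod>i\<in>UNIV. 1 + \<bar>x $ i\<bar>)"
proof -
  have "(\<Sum>i\<in>I. \<bar>x $ i\<bar>) \<le> (\<Prod>i\<in>I. 1 + \<bar>x $ i\<bar>) - 1" if "finite I" for I
    using that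
  proof (induction I)
    case (insert i I)
    have "1 \<le> (\<Prod>i\<in>I. 1 + \<bar>x $ i\<bar>)" by (intro prod_ge_1) auto
    then have "\<bar>x $ i\<bar> \<le> \<bar>x $ i\<bar> * (\<Prod>i\<in>I. 1 + \<bar>x $ i\<bar>)" by (simp add: mult_le_cancel_left1)
    then show ?case using insert by (simp add: algebra_simps)
  qed simp
  from this[of UNIV] show ?thesis using norm_le_l1_cart[of x] by simp
qed

text \<open>
  Rapid decay in \<open>\<real>\<^sup>n\<close> follows coordinatewise because \<open>norm x \<le> (\<Prod>i. 1 + \<bar>x\<^sub>i\<bar>)\<close>.
\<close>

lemma schwartz_prod:
  fixes F :: "'n::finite \<Rightarrow> nat \<Rightarrow> real \<Rightarrow> complex"
  assumes D: "\<And>i k u. (F i k has_vector_derivative F i (Suc k) u) (at u)"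
    and B: "\<And>i k m. \<exists>B. \<forall>u. (1 + \<bar>u\<bar>) ^ m * norm (F i k u) \<le> B"
  shows "(\<lambda>x. \<Prod>i\<in>UNIV. F i 0 (x $ i)) \<in> schwartz_space"
  unfolding schwartz_space_def
proof (intro CollectI allI conjI)
  fix js and m :: nat
  show "iterated_partial js (\<lambda>x. \<Prod>i\<in>UNIV. F i 0 (x $ i)) differentiable_on UNIV"
    unfolding iterated_partial_prod(1)[of F, OF D]
    using iterated_partial_prod(2)[of F, OF D] by (auto simp: differentiable_on_def differentiable_def)
  obtain B where B: "\<And>i u. (1 + \<bar>u\<bar>) ^ m * norm (F i (count_list js i) u) \<le> B i"
  proof -
    have "\<forall>i. \<exists>B. \<forall>u. (1 + \<bar>u\<bar>) ^ m * norm (F i (count_list js i) u) \<le> B" using B by blast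
    then show ?thesis using that by metis
  qed
  have "norm (norm x ^ m *\<^sub>R iterated_partial js (\<lambda>x. \<Prod>i\<in>UNIV. F i 0 (x $ i)) x) \<le> (\<Prod>i\<in>UNIV. B i)" for x :: "real^'n"
  proof -
    have "norm (norm x ^ m *\<^sub>R iterated_partial js (\<lambda>x. \<Prod>i\<in>UNIV. F i 0 (x $ i)) x)
      = norm x ^ m * (\<Prod>i\<in>UNIV. norm (F i (count_list js i) (x $ i)))"
      by (simp add: iterated_partial_prod(1)[of F, OF D] prod_norm)
    also have "\<dots> \<le> (\<Prod>i\<in>UNIV. 1 + \<bar>x $ i\<bar>) ^ m * (\<Prod>i\<in>UNIV. norm (F i (count_list js i) (x $ i)))"
      by (intro mult_right_mono power_mono norm_le_prod_cart prod_nonneg) auto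
    also have "\<dots> = (\<Prod>i\<in>UNIV. (1 + \<bar>x $ i\<bar>) ^ m * norm (F i (count_list js i) (x $ i)))"
      by (simp add: prod.distrib prod_power_distrib)
    also have "\<dots> \<le> (\<Prod>i\<in>UNIV. B i)"
      by (intro prod_mono) (auto simp: B)
    finally show ?thesis .
  qed
  then show "bounded (range (\<lambda>x. norm x ^ m *\<^sub>R iterated_partial js (\<lambda>x. \<Prod>i\<in>UNIV. F i 0 (x $ i)) x))"
    by (auto simp: bounded_iff)
qed

text \<open>
  The \<open>k\<close>-th derivative of \<open>u \<mapsto> exp (- q u)\<close> is the polynomial \<open>exp_poly_factor q k\<close> times
  \<open>exp (- q u)\<close>; with \<open>q u = u\<^sup>2\<close> these are the Hermite polynomials up to sign.
\<close>

primrec exp_poly_factor :: "real poly \<Rightarrow> nat \<Rightarrow> real poly" where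
  "exp_poly_factor q 0 = 1"
| "exp_poly_factor q (Suc k) = pderiv (exp_poly_factor q k) - exp_poly_factor q k * pderiv q"

lemma exp_poly_derivative:
  "((\<lambda>u. complex_of_real (poly (exp_poly_factor q k) u * exp (- poly q u))) has_vector_derivative
     complex_of_real (poly (exp_poly_factor q (Suc k)) u * exp (- poly q u))) (at u)"
  by (rule has_vector_derivative_of_real)
     (auto intro!: derivative_eq_intros simp: has_real_derivative_iff_has_vector_derivative[symmetric] algebra_simps)

lemma poly_growth:
  fixes P :: "real poly"
  shows "\<exists>A N. \<forall>u. \<bar>poly P u\<bar> \<le> A * (1 + \<bar>u\<bar>) ^ N"
proof (induction P)
  case 0
  show ?case by (intro exI[of _ 0]) simp
next
  case (pCons a P)
  then obtain A N where AN: "\<And>u. \<bar>poly P u\<bar> \<le> A * (1 + \<bar>u\<bar>) ^ N" by blast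
  have "\<bar>poly (pCons a P) u\<bar> \<le> (\<bar>a\<bar> + A) * (1 + \<bar>u\<bar>) ^ Suc N" for u
  proof -
    have "\<bar>poly (pCons a P) u\<bar> \<le> \<bar>a\<bar> * 1 + \<bar>u\<bar> * (A * (1 + \<bar>u\<bar>) ^ N)"
      using AN[of u] by (auto simp: abs_mult intro!: order_trans[OF abs_triangle_ineq] mult_left_mono)
    also have "\<dots> \<le> \<bar>a\<bar> * (1 + \<bar>u\<bar>) ^ Suc N + (1 + \<bar>u\<bar>) * (A * (1 + \<bar>u\<bar>) ^ N)"
      using order_trans[OF abs_ge_zero AN[of u]]
      by (intro add_mono mult_left_mono mult_right_mono one_le_power) auto
    finally show ?thesis by (simp add: algebra_simps)
  qed
  then show ?case by blast
qed

lemma power_le_fact_exp: "0 \<le> (x::real) \<Longrightarrow> x ^ n \<le> fact n * exp x"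
  using sum_le_suminf[OF summable_exp_generic[of x], of "{n}"]
  by (simp add: exp_def scaleR_conv_of_real field_simps)

text \<open>
  Linear growth of \<open>q\<close> in both directions suffices: \<open>exp (- \<delta> * \<bar>u\<bar>)\<close> beats every polynomial.
\<close>

lemma exp_poly_decay:
  fixes P q :: "real poly"
  assumes "0 < \<delta>" and q: "\<And>u. \<delta> * \<bar>u\<bar> - D \<le> poly q u"
  shows "\<exists>B. \<forall>u. (1 + \<bar>u\<bar>) ^ m * norm (complex_of_real (poly P u * exp (- poly q u))) \<le> B"
proof -
  obtain A N where AN: "\<And>u. \<bar>poly P u\<bar> \<le> A * (1 + \<bar>u\<bar>) ^ N" using poly_growth by blast
  have A: "0 \<le> A" using order_trans[OF abs_ge_zero AN[of 0]] by simp
  let ?n = "m + N"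
  have "(1 + \<bar>u\<bar>) ^ m * norm (complex_of_real (poly P u * exp (- poly q u))) \<le> A * fact ?n / \<delta> ^ ?n * exp (\<delta> + D)" for u
  proof -
    have "(\<delta> * (1 + \<bar>u\<bar>)) ^ ?n \<le> fact ?n * exp (\<delta> * (1 + \<bar>u\<bar>))"
      using assms(1) by (intro power_le_fact_exp) auto
    then have pw: "(1 + \<bar>u\<bar>) ^ ?n \<le> fact ?n / \<delta> ^ ?n * exp (\<delta> * (1 + \<bar>u\<bar>))"
      using assms(1) unfolding power_mult_distrib by (simp add: pos_le_divide_eq mult.commute)
    have "(1 + \<bar>u\<bar>) ^ m * norm (complex_of_real (poly P u * exp (- poly q u)))
        = (1 + \<bar>u\<bar>) ^ m * \<bar>poly P u\<bar> * exp (- poly q u)"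
      by (simp add: norm_mult del: of_real_mult)  (simp add: abs_mult)
    also have "\<dots> \<le> (1 + \<bar>u\<bar>) ^ m * (A * (1 + \<bar>u\<bar>) ^ N) * exp (- (\<delta> * \<bar>u\<bar> - D))"
      using q[of u] A by (intro mult_mono AN) auto
    also have "\<dots> = A * (1 + \<bar>u\<bar>) ^ ?n * exp (- (\<delta> * \<bar>u\<bar> - D))" by (simp add: power_add)
    also have "\<dots> \<le> A * (fact ?n / \<delta> ^ ?n * exp (\<delta> * (1 + \<bar>u\<bar>))) * exp (- (\<delta> * \<bar>u\<bar> - D))"
      using A pw by (intro mult_right_mono mult_left_mono) auto
    also have "\<dots> = A * fact ?n / \<delta> ^ ?n * exp (\<delta> + D)"
      by (simp add: mult_exp_exp algebra_simps)
    finally show ?thesis .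
  qed
  then show ?thesis by blast
qed

text \<open>
  One family serves two purposes. For \<open>m = 1\<close> it contains the Gaussians; for \<open>m \<rightarrow> \<infinity>\<close> it tends to
  the indicator of the box with centre \<open>c\<close> and half side lengths \<open>w\<close>, since \<open>v ^ (2 * m)\<close> tends to
  0 or to \<open>\<infinity>\<close> according to whether \<open>\<bar>v\<bar> < 1\<close> or \<open>\<bar>v\<bar> > 1\<close>. For positive \<open>m\<close> and \<open>w\<close> these
  are Schwartz functions.
\<close>

definition flat_bump :: "nat \<Rightarrow> real^'n::finite \<Rightarrow> real^'n \<Rightarrow> real^'n \<Rightarrow> complex" where
  "flat_bump m c w x = (\<Prod>i\<in>UNIV. complex_of_real (exp (- (((x $ i - c $ i) / w $ i) ^ (2 * m)))))"

lemma flat_bump_schwartz: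
  assumes m: "0 < m" and w: "\<And>i. 0 < w $ i"
  shows "flat_bump m c w \<in> schwartz_space"
proof -
  define q where "q i = [:- (c $ i) / w $ i, 1 / w $ i:] ^ (2 * m)" for i
  have q: "poly (q i) u = ((u - c $ i) / w $ i) ^ (2 * m)" for i u
    by (simp add: q_def poly_power diff_divide_distrib)
  have ge: "1 / w $ i * \<bar>u\<bar> - (\<bar>c $ i\<bar> / w $ i + 1) \<le> poly (q i) u" for i u
  proof -
    define v where "v = (u - c $ i) / w $ i"
    have "\<bar>v\<bar> - 1 \<le> v ^ (2 * m)"
    proof (cases "\<bar>v\<bar> \<le> 1")
      case False
      then have "\<bar>v\<bar> ^ 1 \<le> \<bar>v\<bar> ^ (2 * m)" using m by (intro power_increasing) auto
      then show ?thesis by (simp add: power_even_abs)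
    next
      case True
      have "0 \<le> v ^ (2 * m)" by (simp add: power_mult)
      with True show ?thesis by linarith
    qed
    moreover have "(\<bar>u\<bar> - \<bar>c $ i\<bar>) / w $ i \<le> \<bar>v\<bar>"
      using w[of i] by (simp add: v_def divide_right_mono abs_triangle_ineq2)
    ultimately show ?thesis by (simp add: q v_def diff_divide_distrib)
  qed
  have "(\<lambda>x. \<Prod>i\<in>UNIV. complex_of_real (poly (exp_poly_factor (q i) 0) (x $ i) * exp (- poly (q i) (x $ i)))) \<in> schwartz_space"
    by (rule schwartz_prod[where F = "\<lambda>i k u. complex_of_real (poly (exp_poly_factor (q i) k) u * exp (- poly (q i) u))"])
       (rule exp_poly_derivative, rule exp_poly_decay[OF _ ge], use w in auto)
  then show ?thesis by (simp add: q flat_bump_def[abs_def])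
qed

section \<open>Product integrals and integrability of Schwartz functions\<close>

text \<open>
  The measure \<open>lborel\<close> is a product over \<open>Basis\<close>, while coordinates of vectors are indexed by the
  type \<open>'n\<close>; \<open>axis i 1\<close> identifies the two index sets.
\<close>

lemma cart_prod_Basis:
  fixes x :: "real^'n::finite"
  shows "(\<Prod>b\<in>Basis. g (SOME i. b = axis i (1::real)) (x \<bullet> b)) = (\<Prod>i\<in>UNIV. g i (x $ i))"
proof -
  have B: "(Basis :: (real^'n) set) = (\<lambda>i. axis i 1) ` UNIV" by (auto simp: Basis_vec_def)
  have inj: "inj (\<lambda>i::'n. axis i (1::real))" by (auto simp: inj_on_def axis_eq_axis)
  have "(SOME j. axis i (1::real) = axis j 1) = i" for i :: 'n by (auto simp: axis_eq_axis)
  then show ?thesis unfolding B by (simp add: prod.reindex[OF inj] inner_axis)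
qed

lemma
  fixes f :: "'n::finite \<Rightarrow> real \<Rightarrow> 'b::{real_normed_field,banach,second_countable_topology}"
  assumes "\<And>i. integrable lborel (f i)"
  shows integrable_prod_cart: "integrable lborel (\<lambda>x::real^'n. \<Prod>i\<in>UNIV. f i (x $ i))"
    and integral_prod_cart: "(LINT x|lborel. (\<Prod>i\<in>UNIV. f i ((x::real^'n) $ i))) = (\<Prod>i\<in>UNIV. LINT u|lborel. f i u)"
proof -
  interpret P: product_sigma_finite "\<lambda>b::real^'n. lborel :: real measure" ..
  let ?h = "\<lambda>b::real^'n. f (SOME i. b = axis i (1::real))"
  have [measurable]: "f i \<in> borel_measurable borel" for i
    using borel_measurable_integrable[OF assms[of i]] by simp
  have eq: "(\<Prod>i\<in>UNIV. f i (x $ i)) = (\<Prod>b\<in>Basis. ?h b (x \<bullet> b))" for x :: "real^'n"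
    by (rule cart_prod_Basis[symmetric])
  have coord: "(\<Sum>b\<in>Basis. z b *\<^sub>R b) \<bullet> b = z b" if "b \<in> Basis" for z and b :: "real^'n"
    using that by (rule inner_sum_left_Basis)
  have e2: "(\<Prod>b\<in>Basis. ?h b ((\<Sum>b\<in>Basis. z b *\<^sub>R b) \<bullet> b)) = (\<Prod>b\<in>Basis. ?h b (z b))" for z :: "real^'n \<Rightarrow> real"
    by (intro prod.cong) (simp_all add: coord)
  show "integrable lborel (\<lambda>x::real^'n. \<Prod>i\<in>UNIV. f i (x $ i))"
    unfolding eq using P.product_integrable_prod[OF finite_Basis, of ?h] assms
    by (subst lborel_eq) (simp add: integrable_distr_eq e2)
  have "(LINT x|lborel. (\<Prod>i\<in>UNIV. f i ((x::real^'n) $ i))) = (\<Prod>b\<in>(Basis::(real^'n) set). LINT u|lborel. ?h b u)"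
    unfolding eq using P.product_integral_prod[OF finite_Basis, of ?h] assms
    by (subst lborel_eq) (simp add: integral_distr e2)
  also have "\<dots> = (\<Prod>i\<in>UNIV. LINT u|lborel. f i u)"
    using cart_prod_Basis[of "\<lambda>i _. LINT u|lborel. f i u"] by simp
  finally show "(LINT x|lborel. (\<Prod>i\<in>UNIV. f i ((x::real^'n) $ i))) = (\<Prod>i\<in>UNIV. LINT u|lborel. f i u)" .
qed

lemma integrable_inverse_square_affine:
  assumes "w \<noteq> (0::real)"
  shows "integrable lborel (\<lambda>u. 1 / (1 + ((u - c) / w)\<^sup>2))"
proof -
  have "integrable lborel (\<lambda>u::real. 1 / (1 + u\<^sup>2))"
    using integrable_inverse_1_plus_square by (simp add: set_integrable_def inverse_eq_divide)
  from lborel_integrable_real_affine[OF this, of "1/w" "-c/w"] assms show ?thesis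
    by (simp add: diff_divide_distrib)
qed

lemma schwartz_continuous: "f \<in> schwartz_space \<Longrightarrow> continuous_on UNIV f"
  using differentiable_imp_continuous_on by (auto simp: schwartz_space_def dest!: spec[of _ "[]"])

lemma schwartz_borel: "f \<in> schwartz_space \<Longrightarrow> f \<in> borel_measurable borel"
  by (intro borel_measurable_continuous_onI schwartz_continuous)

lemma schwartz_decay:
  assumes "f \<in> schwartz_space"
  shows "\<exists>B. \<forall>x. (1 + (norm x)\<^sup>2) ^ N * norm (f x) \<le> B"
proof -
  have "\<exists>B. \<forall>x. norm x ^ m * norm (f x) \<le> B" for m
  proof -
    have "bounded (range (\<lambda>x. norm x ^ m *\<^sub>R iterated_partial [] f x))" using assms unfolding schwartz_space_def by blast
    then show ?thesis by (simp add: bounded_iff)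
  qed
  then obtain B where B: "\<And>m x. norm x ^ m * norm (f x) \<le> B m" by metis
  have "(1 + (norm x)\<^sup>2) ^ N * norm (f x) \<le> (\<Sum>k\<le>N. (N choose k) * B (2 * k))" for x
  proof -
    have "(1 + (norm x)\<^sup>2) ^ N * norm (f x) = (\<Sum>k\<le>N. (N choose k) * (norm x ^ (2 * k) * norm (f x)))"
      by (subst add.commute, subst binomial_ring) (simp add: sum_distrib_right power_mult mult.assoc)
    also have "\<dots> \<le> (\<Sum>k\<le>N. (N choose k) * B (2 * k))"
      by (intro sum_mono mult_left_mono B) auto
    finally show ?thesis .
  qed
  then show ?thesis by blast
qed

lemma integrable_lebesgue_of_lborel: "integrable lborel f \<Longrightarrow> integrable lebesgue f"
  for f :: "'a::euclidean_space \<Rightarrow> 'b::{banach,second_countable_topology}"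
  by (simp add: integrable_completion borel_measurable_integrable)

text \<open>
  Decay of order \<open>(1 + (norm x)\<^sup>2) ^ n\<close> dominates \<open>\<Prod>i. 1 + (x\<^sub>i)\<^sup>2\<close>, whose reciprocal is integrable
  as a product of functions of one variable.
\<close>

lemma schwartz_Lp:
  fixes f :: "real^'n::finite \<Rightarrow> complex"
  assumes f: "f \<in> schwartz_space" and p: "1 \<le> p"
  shows "f \<in> Lp_space p"
proof -
  note [measurable] = schwartz_borel[OF f]
  obtain B where B: "\<And>x. (1 + (norm x)\<^sup>2) ^ CARD('n) * norm (f x) \<le> B" using schwartz_decay[OF f] by blast
  have B0: "0 \<le> B" using order_trans[OF _ B[of 0]] by simp
  let ?D = "\<lambda>x::real^'n. \<Prod>i\<in>UNIV. 1 / (1 + ((x $ i - 0) / 1)\<^sup>2)"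
  have int: "integrable lborel ?D" by (intro integrable_prod_cart integrable_inverse_square_affine) simp
  have p2: "0 < 1 + t\<^sup>2" for t :: real by (simp add: add_pos_nonneg)
  \<comment> \<open>As \<open>0 \<le> ?D \<le> 1\<close>, the \<open>p\<close>-th power of \<open>?D\<close> is again dominated by \<open>?D\<close>.\<close>
  have D01: "0 \<le> ?D x \<and> ?D x \<le> 1" for x
    using p2 by (intro conjI prod_nonneg prod_le_1 ballI) (simp_all add: less_imp_le)
  have fD: "norm (f x) \<le> B * ?D x" for x
  proof -
    have "(\<Prod>i\<in>UNIV. 1 + (x $ i)\<^sup>2) \<le> (\<Prod>i\<in>(UNIV::'n set). 1 + (norm x)\<^sup>2)"
      using component_le_norm_cart[of x] by (intro prod_mono) (auto intro!: power2_le_iff_abs_le[THEN iffD2])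
    then have "(\<Prod>i\<in>UNIV. 1 + (x $ i)\<^sup>2) * norm (f x) \<le> (1 + (norm x)\<^sup>2) ^ CARD('n) * norm (f x)"
      by (intro mult_right_mono) auto
    also have "\<dots> \<le> B" by (rule B)
    finally have "(\<Prod>i\<in>UNIV. 1 + (x $ i)\<^sup>2) * norm (f x) \<le> B" .
    moreover have "0 < (\<Prod>i\<in>UNIV. 1 + (x $ i)\<^sup>2)" by (intro prod_pos p2 ballI)
    ultimately show ?thesis by (simp add: prod_dividef field_simps)
  qed
  have "integrable lborel (\<lambda>x. norm (f x) powr p)"
  proof (rule Bochner_Integration.integrable_bound)
    show "integrable lborel (\<lambda>x. B powr p * ?D x)" using int by simp
    show "AE x in lborel. norm (norm (f x) powr p) \<le> norm (B powr p * ?D x)"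
    proof (intro AE_I2)
      fix x
      have "norm (f x) powr p \<le> (B * ?D x) powr p" using fD p by (intro powr_mono2) auto
      also have "\<dots> = B powr p * ?D x powr p" using D01[of x] B0 by (intro powr_mult)
      also have "\<dots> \<le> B powr p * ?D x powr 1"
        using D01[of x] p by (intro mult_left_mono powr_mono') simp_all
      finally show "norm (norm (f x) powr p) \<le> norm (B powr p * ?D x)" using D01[of x] by simp
    qed
  qed measurable
  from integrable_lebesgue_of_lborel[OF this] show ?thesis
    using measurable_completion[of f lborel borel] by (simp add: Lp_space_def)
qed

section \<open>Density of the Schwartz functions\<close>

definition Lp_closure :: "real \<Rightarrow> ('a::euclidean_space \<Rightarrow> complex) set \<Rightarrow> ('a \<Rightarrow> complex) set" where
  "Lp_closure p S = {f \<in> Lp_space p. \<forall>\<epsilon>>0. \<exists>g\<in>S. Lp_norm p (\<lambda>x. f x - g x) < \<epsilon>}"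

lemma Lp_closure_add:
  assumes p: "1 \<le> p" and S: "S \<subseteq> Lp_space p" "\<And>f g. f \<in> S \<Longrightarrow> g \<in> S \<Longrightarrow> (\<lambda>x. f x + g x) \<in> S"
    and f: "f \<in> Lp_closure p S" and g: "g \<in> Lp_closure p S"
  shows "(\<lambda>x. f x + g x) \<in> Lp_closure p S"
proof -
  have "\<exists>h\<in>S. Lp_norm p (\<lambda>x. f x + g x - h x) < e" if "0 < e" for e
  proof -
    have e2: "0 < e/2" using that by simp
    obtain a where a: "a \<in> S" "Lp_norm p (\<lambda>x. f x - a x) < e/2" using f e2 unfolding Lp_closure_def by blast
    obtain b where b: "b \<in> S" "Lp_norm p (\<lambda>x. g x - b x) < e/2" using g e2 unfolding Lp_closure_def by blast
    have "Lp_norm p (\<lambda>x. (f x - a x) + (g x - b x)) \<le> Lp_norm p (\<lambda>x. f x - a x) + Lp_norm p (\<lambda>x. g x - b x)"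
      using f g a b S(1) by (intro Lp_space_triangle Lp_space_diff p) (auto simp: Lp_closure_def)
    also have "\<dots> < e" using a b by simp
    finally show ?thesis using S(2)[OF a(1) b(1)] by (intro bexI[of _ "\<lambda>x. a x + b x"]) (simp_all add: algebra_simps)
  qed
  then show ?thesis using f g Lp_space_triangle[OF p] by (auto simp: Lp_closure_def)
qed

lemma Lp_closure_scale:
  assumes p: "1 \<le> p" and S: "S \<subseteq> Lp_space p" "\<And>c f. f \<in> S \<Longrightarrow> (\<lambda>x. c * f x) \<in> S"
    and f: "f \<in> Lp_closure p S"
  shows "(\<lambda>x. c * f x) \<in> Lp_closure p S"
proof -
  have "\<exists>h\<in>S. Lp_norm p (\<lambda>x. c * f x - h x) < e" if "0 < e" for e
  proof -
    have pos: "0 < norm c + 1" by (simp add: add_nonneg_pos)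
    then have "0 < e / (norm c + 1)" using that by simp
    with f obtain a where a: "a \<in> S" "Lp_norm p (\<lambda>x. f x - a x) < e / (norm c + 1)"
      unfolding Lp_closure_def by blast
    have "Lp_norm p (\<lambda>x. c * (f x - a x)) \<le> norm c * (e / (norm c + 1))"
      using a p by (subst Lp_norm_scale) (auto intro!: mult_left_mono simp del: times_divide_eq_right)
    also have "\<dots> < e" using that pos by (simp add: field_simps)
    finally show ?thesis using S(2)[OF a(1), of c] by (intro bexI[of _ "\<lambda>x. c * a x"]) (simp_all add: algebra_simps)
  qed
  then show ?thesis using f Lp_space_scale by (auto simp: Lp_closure_def)
qed

lemma Lp_closure_limit:
  assumes p: "1 \<le> p" and S: "S \<subseteq> Lp_space p" and f: "f \<in> Lp_space p"
    and v: "\<And>n. v n \<in> Lp_closure p S" and lim: "(\<lambda>n. Lp_norm p (\<lambda>x. v n x - f x)) \<longlonglongrightarrow> 0"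
  shows "f \<in> Lp_closure p S"
proof -
  have "\<exists>h\<in>S. Lp_norm p (\<lambda>x. f x - h x) < e" if "0 < e" for e :: real
  proof -
    have e2: "0 < e/2" using that by simp
    obtain n where n: "Lp_norm p (\<lambda>x. v n x - f x) < e/2"
      using order_tendstoD(2)[OF lim e2] by (auto simp: eventually_sequentially)
    obtain a where a: "a \<in> S" "Lp_norm p (\<lambda>x. v n x - a x) < e/2"
      using v[of n] e2 unfolding Lp_closure_def by blast
    have "Lp_norm p (\<lambda>x. f x - a x) \<le> Lp_norm p (\<lambda>x. f x - v n x) + Lp_norm p (\<lambda>x. v n x - a x)"
      using v[of n] a S f by (intro Lp_norm_triangle_diff p) (auto simp: Lp_closure_def)
    also have "\<dots> < e" using n a by (simp add: Lp_norm_minus_commute[of p f])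
    finally show ?thesis using a by blast
  qed
  then show ?thesis using f by (auto simp: Lp_closure_def)
qed

lemma Lp_closure_subset:
  assumes "S \<subseteq> Lp_space p" "f \<in> S"
  shows "f \<in> Lp_closure p S"
  using assms by (auto simp: Lp_closure_def Lp_norm_zero intro!: bexI[of _ f])

abbreviation schwartz_closure :: "real \<Rightarrow> (real^'n::finite \<Rightarrow> complex) set" where
  "schwartz_closure p \<equiv> Lp_closure p schwartz_space"

lemma indicator_Lp:
  assumes "A \<in> sets lebesgue" "emeasure lebesgue A < \<infinity>" "0 < p"
  shows "(\<lambda>x. indicator A x :: complex) \<in> Lp_space p"
proof -
  have "norm (indicator A x :: complex) powr p = indicator A x" for x
    using assms(3) by (auto simp: indicator_def)
  moreover have "integrable lebesgue (indicator A :: 'a \<Rightarrow> real)"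
    using assms by (intro integrable_real_indicator) auto
  ultimately show ?thesis using assms(1) by (simp add: Lp_space_def)
qed

text \<open>
  A bound independent of \<open>m\<close>: it provides the dominating function when \<open>m\<close> tends to infinity.
\<close>

lemma exp_minus_power_le:
  fixes v :: real
  assumes "0 < m"
  shows "exp (- (v ^ (2 * m))) \<le> 2 * (1 / (1 + v\<^sup>2) :: real)"
proof -
  have v0: "0 \<le> v ^ (2 * m)" by (simp add: power_mult)
  have "(1 + v\<^sup>2) / 2 \<le> 1 + v ^ (2 * m)"
  proof (cases "\<bar>v\<bar> \<le> 1")
    case True
    then have "v\<^sup>2 \<le> 1" by (simp add: abs_square_le_1)
    then have "(1 + v\<^sup>2) / 2 \<le> 1" by simp
    with v0 show ?thesis by linarith
  next
    case False
    then have "\<bar>v\<bar> ^ 2 \<le> \<bar>v\<bar> ^ (2 * m)" using assms by (intro power_increasing) auto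
    moreover have "\<bar>v\<bar> ^ (2 * m) = v ^ (2 * m)" by (simp add: power_even_abs)
    moreover have "(1 + z) / 2 \<le> 1 + y" if "z \<le> y" "0 \<le> y" for z y :: real using that by simp
    ultimately show ?thesis using v0 by (metis power2_abs)
  qed
  also have "\<dots> \<le> exp (v ^ (2 * m))" by (rule exp_ge_add_one_self)
  finally have "exp (- (v ^ (2 * m))) \<le> inverse ((1 + v\<^sup>2) / 2)"
    unfolding exp_minus by (intro le_imp_inverse_le) (auto intro: add_pos_nonneg)
  then show ?thesis by (simp add: inverse_eq_divide)
qed

text \<open>
  The functions \<open>flat_bump (Suc m) c w\<close> converge to the indicator off the boundary of the box and
  are dominated by the integrable product \<open>D\<close>.
\<close>

lemma box_in_schwartz_closure:
  fixes a b :: "real^'n::finite"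
  assumes p: "1 \<le> p"
  shows "(\<lambda>x. indicator (box a b) x :: complex) \<in> schwartz_closure p"
proof (cases "box a b = {}")
  case True
  have "(\<lambda>x. 0 * flat_bump 1 0 1 x) \<in> (schwartz_space :: (real^'n \<Rightarrow> complex) set)"
    by (intro schwartz_scale flat_bump_schwartz) auto
  then show ?thesis using True schwartz_Lp[OF _ p]
    by (intro Lp_closure_subset) auto
next
  case False
  have p0: "0 < p" using p by simp
  have ab: "a $ i < b $ i" for i
    using False by (auto simp: box_ne_empty Basis_vec_def inner_axis axis_eq_axis)
  define c where "c = (1/2) *\<^sub>R (a + b)"
  define w where "w = (1/2) *\<^sub>R (b - a)"
  have w: "0 < w $ i" for i using ab[of i] by (simp add: w_def)
  let ?u = "\<lambda>i x. (x $ i - c $ i) / w $ i"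
  define D where "D x = (\<Prod>i\<in>UNIV. 2 * (1 / (1 + (?u i x)\<^sup>2)))" for x
  have p2: "0 < 1 + t\<^sup>2" for t :: real by (simp add: add_pos_nonneg)
  have Dint: "integrable lborel D"
    unfolding D_def using w by (intro integrable_prod_cart[where f="\<lambda>i v. 2 * (1 / (1 + ((v - c $ i) / w $ i)\<^sup>2))"] integrable_mult_right integrable_inverse_square_affine) (auto simp: less_imp_neq[symmetric])
  have D0: "0 \<le> D x" for x unfolding D_def using p2 by (intro prod_nonneg) (auto simp: less_imp_le)
  have D2: "D x \<le> 2 ^ CARD('n)" for x
  proof -
    have "D x \<le> (\<Prod>i\<in>(UNIV::'n set). 2)"
      unfolding D_def using p2 by (intro prod_mono) (auto simp: less_imp_le divide_le_eq)
    then show ?thesis by simp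
  qed
  have DL: "(\<lambda>x. complex_of_real (D x)) \<in> Lp_space p"
  proof -
    have [measurable]: "D \<in> borel_measurable lborel" using Dint by (rule borel_measurable_integrable)
    have "integrable lborel (\<lambda>x. norm (complex_of_real (D x)) powr p)"
    proof (rule Bochner_Integration.integrable_bound)
      show "integrable lborel (\<lambda>x. (2 ^ CARD('n)) powr (p - 1) * D x)" using Dint by simp
      have "norm (complex_of_real (D x)) powr p \<le> (2 ^ CARD('n)) powr (p - 1) * D x" for x
      proof (cases "D x = 0")
        case False
        then have "D x powr p = D x powr (p - 1) * D x"
          using D0[of x] powr_add[of "D x" "p - 1" 1] by simp
        also have "\<dots> \<le> (2 ^ CARD('n)) powr (p - 1) * D x"
          using D0 D2 p by (intro mult_right_mono powr_mono2) auto
        finally show ?thesis using D0[of x] by simp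
      qed (use p0 in simp)
      then show "AE x in lborel. norm (norm (complex_of_real (D x)) powr p) \<le> norm ((2 ^ CARD('n)) powr (p - 1) * D x)"
        using D0 by auto
    qed measurable
    from integrable_lebesgue_of_lborel[OF this] show ?thesis
      using measurable_completion[of "\<lambda>x. complex_of_real (D x)" lborel borel] by (simp add: Lp_space_def)
  qed
  have in_box: "x \<in> box a b \<longleftrightarrow> (\<forall>i. \<bar>?u i x\<bar> < 1)" for x
  proof -
    have "\<bar>?u i x\<bar> < 1 \<longleftrightarrow> a $ i < x $ i \<and> x $ i < b $ i" for i
      using w[of i] ab[of i] by (auto simp: abs_less_iff c_def w_def field_simps)
    then show ?thesis by (auto simp: mem_box_cart)
  qed
  have out_cbox: "\<exists>i. 1 < \<bar>?u i x\<bar>" if out: "x \<notin> cbox a b" for x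
  proof -
    obtain i where "x $ i < a $ i \<or> b $ i < x $ i" using out unfolding mem_box_cart by (meson not_le)
    then have "w $ i < \<bar>x $ i - c $ i\<bar>"
      using ab[of i] by (auto simp: c_def w_def abs_if field_simps)
    then have "1 < \<bar>?u i x\<bar>" using w[of i] by simp
    then show ?thesis by blast
  qed
  have bump: "flat_bump (Suc m) c w \<in> schwartz_space" for m by (intro flat_bump_schwartz w) simp
  have norm_bump: "norm (flat_bump (Suc m) c w x) \<le> norm (complex_of_real (D x))" for m x
  proof -
    have "norm (flat_bump (Suc m) c w x) = (\<Prod>i\<in>UNIV. exp (- (?u i x ^ (2 * Suc m))))"
      by (simp only: flat_bump_def prod_norm[symmetric] norm_of_real abs_exp_cancel)
    also have "\<dots> \<le> D x" unfolding D_def by (intro prod_mono conjI exp_ge_zero exp_minus_power_le) simp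
    finally show ?thesis using D0[of x] by simp
  qed
  have "AE x in lebesgue. x \<notin> cbox a b - box a b"
    by (intro AE_completion AE_not_in null_sets_cbox_Diff_box)
  then have lim: "AE x in lebesgue. (\<lambda>m. flat_bump (Suc m) c w x) \<longlonglongrightarrow> indicator (box a b) x"
  proof eventually_elim
    case (elim x)
    show ?case
    proof (cases "x \<in> box a b")
      case True
      have "(\<lambda>m. ?u i x ^ (2 * Suc m)) \<longlonglongrightarrow> 0" for i
      proof -
        have "\<bar>(?u i x)\<^sup>2\<bar> < 1" using True in_box[of x] by (simp add: abs_square_less_1)
        then have "(\<lambda>m. ((?u i x)\<^sup>2) ^ m) \<longlonglongrightarrow> 0" by (intro LIMSEQ_power_zero) simp
        from LIMSEQ_Suc[OF this] show ?thesis by (simp only: power_mult)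
      qed
      then have "(\<lambda>m. flat_bump (Suc m) c w x) \<longlonglongrightarrow> (\<Prod>i\<in>(UNIV::'n set). complex_of_real (exp (- 0)))"
        unfolding flat_bump_def by (intro tendsto_prod tendsto_of_real tendsto_exp tendsto_minus)
      then show ?thesis using True by simp
    next
      case False
      with elim have "x \<notin> cbox a b" by auto
      then obtain i where i: "1 < \<bar>?u i x\<bar>" using out_cbox by blast
      have "norm (flat_bump (Suc m) c w x) \<le> inverse ((?u i x)\<^sup>2) ^ Suc m" for m
      proof -
        have "1 < (?u i x)\<^sup>2" using i by (simp add: abs_square_le_1 flip: not_le)
        then have pos: "0 < (?u i x)\<^sup>2" by linarith
        have "norm (flat_bump (Suc m) c w x) = (\<Prod>i\<in>UNIV. exp (- (?u i x ^ (2 * Suc m))))"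
          by (simp only: flat_bump_def prod_norm[symmetric] norm_of_real abs_exp_cancel)
        also have "\<dots> = exp (- (?u i x ^ (2 * Suc m))) * (\<Prod>i\<in>UNIV - {i}. exp (- (?u i x ^ (2 * Suc m))))"
          by (rule prod.remove) auto
        also have "\<dots> \<le> exp (- (?u i x ^ (2 * Suc m))) * 1"
        proof (intro mult_left_mono prod_le_1 conjI)
          have "0 \<le> ((?u k x)\<^sup>2) ^ Suc m" for k by (rule zero_le_power) simp
          then show "exp (- (?u k x ^ (2 * Suc m))) \<le> 1" for k by (simp only: power_mult exp_le_one_iff) simp
        qed auto
        also have "\<dots> = inverse (exp (((?u i x)\<^sup>2) ^ Suc m))" by (simp only: exp_minus power_mult mult_1_right)
        also have "\<dots> \<le> inverse (((?u i x)\<^sup>2) ^ Suc m)"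
          using pos exp_ge_add_one_self[of "((?u i x)\<^sup>2) ^ Suc m"] by (intro le_imp_inverse_le zero_less_power[OF pos]) linarith
        finally show ?thesis by (simp only: power_inverse)
      qed
      moreover have "(\<lambda>m. inverse ((?u i x)\<^sup>2) ^ Suc m) \<longlonglongrightarrow> 0"
      proof -
        have "1 < (?u i x)\<^sup>2" using i by (simp add: abs_square_le_1 flip: not_le)
        then have "norm (inverse ((?u i x)\<^sup>2)) < 1" by (simp add: inverse_less_1_iff del: power_divide)
        from LIMSEQ_Suc[OF LIMSEQ_power_zero[OF this]] show ?thesis .
      qed
      ultimately have "(\<lambda>m. flat_bump (Suc m) c w x) \<longlonglongrightarrow> 0"
        by (rule Lim_null_comparison[OF always_eventually[OF allI]])
      then show ?thesis using False by simp
    qed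
  qed
  have "(\<lambda>m. Lp_norm p (\<lambda>x. flat_bump (Suc m) c w x - indicator (box a b) x)) \<longlonglongrightarrow> 0"
    using norm_bump
    by (intro Lp_dominated_convergence[OF p0 _ _ lim DL] Lp_space_measurable[OF schwartz_Lp[OF bump p]]
          borel_measurable_indicator AE_I2) simp_all
  moreover have S: "(schwartz_space :: (real^'n \<Rightarrow> complex) set) \<subseteq> Lp_space p" using schwartz_Lp[OF _ p] by blast
  moreover have "(\<lambda>x. indicator (box a b) x :: complex) \<in> Lp_space p"
    by (intro indicator_Lp p0) (simp_all add: emeasure_lborel_box_eq)
  ultimately show ?thesis
    by (intro Lp_closure_limit[OF p S _ Lp_closure_subset[OF S bump]])
qed

text \<open>
  Boxes generate the Borel sets and are closed under intersection, and the sets \<open>A\<close> for which the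
  statement holds form a Dynkin system. Cutting down to a box \<open>K\<close> keeps all measures finite, so
  that complements and countable unions stay in \<open>L\<^sup>p\<close>.
\<close>

lemma borel_in_schwartz_closure:
  fixes A K :: "(real^'n::finite) set"
  assumes p: "1 \<le> p" and A: "A \<in> sets borel" and K: "K = box k l"
  shows "(\<lambda>x. indicator (A \<inter> K) x :: complex) \<in> schwartz_closure p"
proof -
  have p0: "0 < p" using p by simp
  have S: "(schwartz_space :: (real^'n \<Rightarrow> complex) set) \<subseteq> Lp_space p" using schwartz_Lp[OF _ p] by blast
  have KL: "(\<lambda>x. indicator K x :: complex) \<in> Lp_space p"
    unfolding K by (intro indicator_Lp p0) (auto simp: emeasure_lborel_box_eq)
  have AK: "(\<lambda>x. indicator (A \<inter> K) x :: complex) \<in> Lp_space p" if "A \<in> sets borel" for A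
  proof (rule Lp_space_dominated(1)[OF KL p0])
    have "A \<inter> K \<in> sets lebesgue" using that by (auto simp: K)
    then show "(\<lambda>x. indicator (A \<inter> K) x :: complex) \<in> borel_measurable lebesgue" by simp
  qed (auto simp: indicator_def)
  have stable: "Int_stable (range (\<lambda>(a, b). box a b :: (real^'n) set))"
    by (auto simp: Int_stable_def box_Int_box)
  have Pow_UNIV_subset: "range (\<lambda>(a, b). box a b :: (real^'n) set) \<subseteq> Pow UNIV" by simp
  have "A \<in> sigma_sets UNIV (range (\<lambda>(a, b). box a b :: (real^'n) set))"
    using A by (simp add: borel_eq_box)
  from stable Pow_UNIV_subset this show ?thesis
  proof (induction rule: sigma_sets_induct_disjoint)
    case (basic A)
    then show ?case by (auto simp: K box_Int_box intro: box_in_schwartz_closure[OF p])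
  next
    case empty
    show ?case using box_in_schwartz_closure[OF p, of 0 0] by simp
  next
    case (compl A)
    have "(\<lambda>x. indicator K x + (-1) * indicator (A \<inter> K) x :: complex) \<in> schwartz_closure p"
      unfolding K using compl(2)[unfolded K]
      by (intro Lp_closure_add Lp_closure_scale p S schwartz_add schwartz_scale box_in_schwartz_closure)
    also have "(\<lambda>x. indicator K x + (-1) * indicator (A \<inter> K) x :: complex) = (\<lambda>x. indicator ((UNIV - A) \<inter> K) x)"
      by (auto simp: indicator_def)
    finally show ?case .
  next
    case (union A)
    have AM: "A i \<in> sets borel" for i using union(2) by (auto simp: borel_eq_box)
    have cl: "(\<lambda>x. \<Sum>i<n. indicator (A i \<inter> K) x :: complex) \<in> schwartz_closure p" for n
    proof (induction n)
      case 0
      show ?case using box_in_schwartz_closure[OF p, of 0 0] by simp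
    next
      case (Suc n)
      show ?case unfolding sum.lessThan_Suc
        by (intro Lp_closure_add p S schwartz_add Suc union)
    qed
    have disj: "disjoint_family (\<lambda>i. A i \<inter> K)" using union(1) by (auto simp: disjoint_family_on_def)
    have eq: "(\<Sum>i<n. indicator (A i \<inter> K) x :: complex) = indicator (\<Union>i<n. A i \<inter> K) x" for n x
      using disj by (intro indicator_UN_disjoint[symmetric]) (auto simp: disjoint_family_on_def)
    have "(\<lambda>n. Lp_norm p (\<lambda>x. (\<Sum>i<n. indicator (A i \<inter> K) x) - indicator ((\<Union>i. A i) \<inter> K) x)) \<longlonglongrightarrow> 0"
    proof (rule Lp_dominated_convergence[OF p0 _ _ _ KL])
      show "(\<lambda>x. \<Sum>i<n. indicator (A i \<inter> K) x :: complex) \<in> borel_measurable lebesgue" for n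
        using cl[of n] by (intro Lp_space_measurable[of _ p]) (auto simp: Lp_closure_def)
      show "(\<lambda>x. indicator ((\<Union>i. A i) \<inter> K) x :: complex) \<in> borel_measurable lebesgue"
        using AK[of "\<Union>i. A i"] AM by (intro Lp_space_measurable[of _ p]) auto
      show "AE x in lebesgue. norm (\<Sum>i<n. indicator (A i \<inter> K) x :: complex) \<le> norm (indicator K x :: complex)" for n
        unfolding eq by (intro AE_I2) (auto simp: indicator_def)
      show "AE x in lebesgue. (\<lambda>n. \<Sum>i<n. indicator (A i \<inter> K) x :: complex) \<longlonglongrightarrow> indicator ((\<Union>i. A i) \<inter> K) x"
        unfolding eq using LIMSEQ_indicator_UN[of "\<lambda>i. A i \<inter> K"] by (intro AE_I2) (simp add: Int_commute)
    qed
    then show ?case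
      using AM by (intro Lp_closure_limit[OF p S AK cl]) auto
  qed
qed

text \<open>
  Simple functions cut down to growing boxes \<open>K n\<close> converge to \<open>f\<close> and are dominated by \<open>2 * \<bar>f\<bar>\<close>.
\<close>

lemma schwartz_dense:
  fixes f :: "real^'n::finite \<Rightarrow> complex"
  assumes p: "1 \<le> p" and f: "f \<in> Lp_space p"
  shows "f \<in> schwartz_closure p"
proof -
  have p0: "0 < p" using p by simp
  have S: "(schwartz_space :: (real^'n \<Rightarrow> complex) set) \<subseteq> Lp_space p" using schwartz_Lp[OF _ p] by blast
  obtain g where g[measurable]: "g \<in> borel_measurable borel" and fg: "AE x in lebesgue. f x = g x"
    using borel_representative[OF Lp_space_measurable[OF f]] by blast
  obtain F where F: "\<And>i. simple_function borel (F i)" "\<And>x. (\<lambda>i. F i x) \<longlonglongrightarrow> g x" "\<And>i x. norm (F i x) \<le> 2 * norm (g x)"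
    using borel_measurable_implies_sequence_metric[OF g, of 0] by auto
  define K :: "nat \<Rightarrow> (real^'n) set" where "K n = box (\<chi> i. - real n) (\<chi> i. real n)" for n
  define v where "v n x = (\<Sum>y\<in>range (F n). y * indicator (F n -` {y} \<inter> K n) x)" for n x
  have v: "v n x = (if x \<in> K n then F n x else 0)" for n x
  proof -
    have "finite (range (F n))" using simple_functionD(1)[OF F(1)[of n]] by simp
    moreover have "v n x = (\<Sum>y\<in>range (F n). if F n x = y then (if x \<in> K n then y else 0) else 0)"
      unfolding v_def by (intro sum.cong) (auto simp: indicator_def)
    ultimately show ?thesis by (simp add: sum.delta')
  qed
  have "(\<lambda>x. \<Sum>y\<in>Y. y * indicator (F n -` {y} \<inter> K n) x) \<in> schwartz_closure p" if "finite Y" for Y n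
    using that
  proof induction
    case empty
    then show ?case using box_in_schwartz_closure[OF p, of 0 0] by simp
  next
    case (insert y Y)
    have "F n -` {y} \<in> sets borel" using simple_functionD(2)[OF F(1)[of n], of "{y}"] by simp
    then have "(\<lambda>x. y * indicator (F n -` {y} \<inter> K n) x + (\<Sum>y\<in>Y. y * indicator (F n -` {y} \<inter> K n) x)) \<in> schwartz_closure p"
      by (intro Lp_closure_add Lp_closure_scale p S schwartz_add schwartz_scale borel_in_schwartz_closure[OF p _ K_def] insert) auto
    then show ?case by (simp only: sum.insert[OF insert(1,2)])
  qed
  then have vcl: "v n \<in> schwartz_closure p" for n
    unfolding v_def[abs_def] using simple_functionD(1)[OF F(1)[of n]] by simp
  have "(\<lambda>n. Lp_norm p (\<lambda>x. v n x - f x)) \<longlonglongrightarrow> 0"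
  proof (rule Lp_dominated_convergence[OF p0 _ Lp_space_measurable[OF f] _ Lp_space_scale[OF f, of 2]])
    show "v n \<in> borel_measurable lebesgue" for n
      using vcl[of n] by (intro Lp_space_measurable[of _ p]) (auto simp: Lp_closure_def)
    show "AE x in lebesgue. norm (v n x) \<le> norm (2 * f x)" for n
      using fg by eventually_elim (use F(3) in \<open>auto simp: v norm_mult\<close>)
    show "AE x in lebesgue. (\<lambda>n. v n x) \<longlonglongrightarrow> f x"
      using fg
    proof eventually_elim
      case (elim x)
      obtain N where N: "norm x < real N" using reals_Archimedean2 by blast
      have "\<forall>\<^sub>F n in sequentially. F n x = v n x"
      proof (rule eventually_sequentiallyI[of N])
        fix n assume "N \<le> n"
        then have "\<bar>x $ i\<bar> < real n" for i using component_le_norm_cart[of x i] N by linarith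
        then have "x \<in> K n" by (auto simp: K_def mem_box_cart abs_less_iff minus_less_iff)
        then show "F n x = v n x" by (simp add: v)
      qed
      then show ?case using F(2)[of x] elim by (auto intro: Lim_transform_eventually)
    qed
  qed
  then show ?thesis by (intro Lp_closure_limit[OF p S f vcl])
qed

section \<open>The Fourier transform of integrable functions\<close>

definition character :: "'a::euclidean_space \<Rightarrow> 'a \<Rightarrow> complex" where
  "character x \<xi> = exp (- 2 * of_real pi * \<i> * of_real (x \<bullet> \<xi>))"

lemma character_eq: "character x \<xi> = cis (- 2 * pi * (x \<bullet> \<xi>))"
  by (simp add: character_def cis_conv_exp mult_ac)

lemma norm_character [simp]: "norm (character x \<xi>) = 1"
  by (simp add: character_eq)

lemma character_commute: "character x \<xi> = character \<xi> x"
  by (simp add: character_eq inner_commute)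

lemma character_diff: "character \<xi> x * cnj (character \<xi> y) = character \<xi> (x - y)"
  by (simp add: character_eq cis_cnj cis_mult inner_diff_right algebra_simps)

lemma borel_measurable_character [measurable]:
  assumes [measurable]: "f \<in> borel_measurable M" "g \<in> borel_measurable M"
  shows "(\<lambda>x. character (f x) (g x)) \<in> borel_measurable M"
  unfolding character_def by measurable

lemma continuous_character: "continuous_on UNIV (character x)"
  unfolding character_def by (intro continuous_intros)

lemma fourier_character: "fourier f \<xi> = (LINT x|lebesgue. character x \<xi> * f x)"
  by (simp add: fourier_def character_def)

lemma integrable_character:
  assumes f: "integrable M f" and M: "(\<lambda>x. x) \<in> borel_measurable M"
  shows "integrable M (\<lambda>x. character x \<xi> * f x)"
proof (rule Bochner_Integration.integrable_bound[OF f])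
  have "(\<lambda>x. character x \<xi>) \<in> borel_measurable M" using M by measurable
  then show "(\<lambda>x. character x \<xi> * f x) \<in> borel_measurable M"
    using f by (intro borel_measurable_times) auto
qed (simp add: norm_mult)

lemma integrable_character_lebesgue:
  "integrable lebesgue f \<Longrightarrow> integrable lebesgue (\<lambda>x. character x \<xi> * f x)"
  by (rule integrable_character) (auto intro: measurable_completion)

lemma integrable_character_lborel:
  "integrable lborel f \<Longrightarrow> integrable lborel (\<lambda>x. character x \<xi> * f x)"
  by (rule integrable_character) auto

lemma fourier_add:
  assumes "integrable lebesgue f" "integrable lebesgue g"
  shows "fourier (\<lambda>x. f x + g x) \<xi> = fourier f \<xi> + fourier g \<xi>"
  using assms by (simp add: fourier_character integrable_character_lebesgue distrib_left)

lemma fourier_scale: "fourier (\<lambda>x. c * f x) \<xi> = c * fourier f \<xi>"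
  by (simp add: fourier_character mult.left_commute[of _ c])

lemma norm_fourier_le: "norm (fourier f \<xi>) \<le> (LINT x|lebesgue. norm (f x))"
  unfolding fourier_character
  using integral_norm_bound[of lebesgue "\<lambda>x. character x \<xi> * f x"] by (simp add: norm_mult)

lemma fourier_cong_AE:
  fixes f g :: "real^'n::finite \<Rightarrow> complex"
  assumes f: "f \<in> borel_measurable lebesgue" and g: "g \<in> borel_measurable lebesgue" and ae: "AE x in lebesgue. f x = g x"
  shows "fourier f = fourier g"
proof
  fix \<xi> :: "real^'n"
  have c: "(\<lambda>x. character x \<xi>) \<in> borel_measurable lebesgue" by (rule measurable_completion) simp
  show "fourier f \<xi> = fourier g \<xi>"
    unfolding fourier_character using ae c f g
    by (intro integral_cong_AE borel_measurable_times) auto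
qed

lemma fourier_lborel:
  assumes [measurable]: "f \<in> borel_measurable borel"
  shows "fourier f \<xi> = (LINT x|lborel. character x \<xi> * f x)"
  unfolding fourier_character by (intro integral_completion) measurable

lemma fourier_continuous:
  fixes f :: "real^'n::finite \<Rightarrow> complex"
  assumes f: "integrable lebesgue f"
  shows "continuous_on UNIV (fourier f)"
proof (subst continuous_on_sequentially, intro ballI allI impI, elim conjE)
  fix X :: "nat \<Rightarrow> real^'n" and \<xi>
  assume X: "X \<longlonglongrightarrow> \<xi>"
  show "(fourier f \<circ> X) \<longlonglongrightarrow> fourier f \<xi>"
    unfolding o_def fourier_character
  proof (rule integral_dominated_convergence[where w = "\<lambda>x. norm (f x)"])
    show "AE x in lebesgue. (\<lambda>n. character x (X n) * f x) \<longlonglongrightarrow> character x \<xi> * f x"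
      using continuous_on_tendsto_compose[OF continuous_character X]
      by (intro AE_I2 tendsto_mult tendsto_const) auto
  qed (use f in \<open>auto simp: norm_mult intro: borel_measurable_integrable integrable_character_lebesgue\<close>)
qed

lemma fourier_borel:
  fixes f :: "real^'n::finite \<Rightarrow> complex"
  assumes f: "integrable lebesgue f"
  shows "fourier f \<in> borel_measurable borel"
  by (intro borel_measurable_continuous_onI fourier_continuous f)

text \<open>
  Fubini's theorem for \<open>f x * character \<xi> x * g \<xi>\<close>; the transform moves from one factor to the
  other.
\<close>

lemma fourier_multiplication:
  fixes f g :: "real^'n::finite \<Rightarrow> complex"
  assumes f: "integrable lborel f" and g: "integrable lborel g"
  shows "(LINT x|lborel. f x * fourier g x) = (LINT \<xi>|lborel. fourier f \<xi> * g \<xi>)"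
proof -
  have [measurable]: "f \<in> borel_measurable borel" "g \<in> borel_measurable borel"
    using f g borel_measurable_integrable by auto
  have int: "integrable (lborel \<Otimes>\<^sub>M lborel) (\<lambda>(x, \<xi>). f x * (character \<xi> x * g \<xi>))"
  proof (rule lborel_pair.Fubini_integrable)
    have "integrable lborel (\<lambda>x. norm (f x) * (LINT \<xi>|lborel. norm (g \<xi>)))"
      using f by (intro integrable_mult_left integrable_norm)
    then show "integrable lborel (\<lambda>x. LINT \<xi>|lborel. norm (case (x, \<xi>) of (x, \<xi>) \<Rightarrow> f x * (character \<xi> x * g \<xi>)))"
      by (simp add: norm_mult)
    show "AE x in lborel. integrable lborel (\<lambda>\<xi>. case (x, \<xi>) of (x, \<xi>) \<Rightarrow> f x * (character \<xi> x * g \<xi>))"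
      by (simp add: integrable_character_lborel g)
  qed measurable
  have "(LINT x|lborel. f x * fourier g x) = (LINT x|lborel. LINT \<xi>|lborel. f x * (character \<xi> x * g \<xi>))"
    by (simp add: fourier_lborel)
  also have "\<dots> = (LINT \<xi>|lborel. LINT x|lborel. f x * (character \<xi> x * g \<xi>))"
    using lborel_pair.Fubini_integral[OF int] by simp
  also have "\<dots> = (LINT \<xi>|lborel. LINT x|lborel. (character x \<xi> * f x) * g \<xi>)"
    by (simp add: character_commute[of _ "_ :: real^'n"] mult_ac)
  also have "\<dots> = (LINT \<xi>|lborel. fourier f \<xi> * g \<xi>)"
    by (simp add: fourier_lborel)
  finally show ?thesis .
qed

section \<open>Gaussians\<close>

definition gaussian :: "real \<Rightarrow> 'a::real_inner \<Rightarrow> real" where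
  "gaussian t x = exp (- (pi * t * (norm x)\<^sup>2))"

lemma gaussian_pos: "0 < gaussian t x" by (simp add: gaussian_def)

lemma borel_measurable_gaussian[measurable]:
  assumes [measurable]: "f \<in> borel_measurable M"
  shows "(\<lambda>x. gaussian t (f x :: 'a::euclidean_space)) \<in> borel_measurable M"
  unfolding gaussian_def by measurable

text \<open>
  The substitution \<open>x = sqrt (2 * pi * t) * u\<close> turns the integral into the characteristic function of
  the standard normal distribution.
\<close>

lemma gaussian_fourier_real:
  assumes "0 < t"
  shows "integrable lborel (\<lambda>u. exp (- 2 * of_real pi * \<i> * of_real (u * v)) * complex_of_real (exp (- (pi * t * u\<^sup>2))))"
    and "(LINT u|lborel. exp (- 2 * of_real pi * \<i> * of_real (u * v)) * complex_of_real (exp (- (pi * t * u\<^sup>2))))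
      = complex_of_real (1 / sqrt t * exp (- (pi * v\<^sup>2 / t)))"
proof -
  let ?F = "\<lambda>u. exp (- 2 * of_real pi * \<i> * of_real (u * v)) * complex_of_real (exp (- (pi * t * u\<^sup>2)))"
  \<comment> \<open>The frequency \<open>s\<close> is chosen such that \<open>s * (c * u) = - 2 * pi * (u * v)\<close>.\<close>
  define c where "c = sqrt (2 * pi * t)"
  define s where "s = - 2 * pi * v / c"
  have c: "0 < c" "c\<^sup>2 = 2 * pi * t" using assms by (simp_all add: c_def)
  have "c = sqrt (2 * pi) * sqrt t" using assms by (simp add: c_def real_sqrt_mult)
  then have c_div: "c / sqrt (2 * pi) = sqrt t" by simp
  let ?h = "\<lambda>x. std_normal_density x *\<^sub>R iexp (s * x)"
  have int_h: "integrable lborel ?h"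
    by (rule Bochner_Integration.integrable_bound[where f=std_normal_density])
      (auto intro: integrable_normal_density simp: normal_density_nonneg)
  have h: "c *\<^sub>R ?h (0 + c * u) = sqrt t *\<^sub>R ?F u" for u
  proof -
    have 1: "s * (0 + c * u) = - 2 * pi * (u * v)" using c by (simp add: s_def)
    have 2: "std_normal_density (0 + c * u) = 1 / sqrt (2 * pi) * exp (- (pi * t * u\<^sup>2))"
      using c by (simp add: normal_density_def power_mult_distrib)
    have 3: "exp (- 2 * of_real pi * \<i> * of_real (u * v)) = iexp (- 2 * pi * (u * v))"
      by (simp add: mult_ac)
    have "c *\<^sub>R ((1 / sqrt (2 * pi) * exp (- (pi * t * u\<^sup>2))) *\<^sub>R z) = (c / sqrt (2 * pi)) *\<^sub>R (z * complex_of_real (exp (- (pi * t * u\<^sup>2))))" for z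
      by (simp add: scaleR_conv_of_real)
    then show ?thesis unfolding 1 2 3 c_div .
  qed
  have "integrable lborel (\<lambda>u. (1 / sqrt t) *\<^sub>R (c *\<^sub>R ?h (0 + c * u)))"
    using lborel_integrable_real_affine[OF int_h, of c 0] c by (intro integrable_scaleR_right) auto
  then show "integrable lborel (\<lambda>u. ?F u)"
    unfolding h using assms by simp
  have "complex_of_real (exp (- (s\<^sup>2) / 2)) = char std_normal_distribution s"
    by (simp add: char_std_normal_distribution)
  also have "\<dots> = (LINT x|lborel. ?h x)"
    unfolding char_def by (subst integral_density) (auto simp: normal_density_nonneg)
  also have "\<dots> = c *\<^sub>R (LINT u|lborel. ?h (0 + c * u))"
    using c by (subst lborel_integral_real_affine[of c _ 0]) auto
  also have "\<dots> = (LINT u|lborel. c *\<^sub>R ?h (0 + c * u))" by (rule integral_scaleR_right[symmetric])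
  also have "\<dots> = sqrt t *\<^sub>R (LINT u|lborel. ?F u)"
    unfolding h by (rule integral_scaleR_right)
  finally have "(LINT u|lborel. ?F u)
     = (1 / sqrt t) *\<^sub>R complex_of_real (exp (- (s\<^sup>2) / 2))" using assms by simp
  also have "- (s\<^sup>2) / 2 = - (pi * v\<^sup>2 / t)"
    using assms c by (simp add: s_def power_divide power_mult_distrib power2_eq_square)
  finally show "(LINT u|lborel. ?F u)
      = complex_of_real (1 / sqrt t * exp (- (pi * v\<^sup>2 / t)))" by (simp add: scaleR_conv_of_real)
qed

text \<open>
  The Fourier transform of \<open>gaussian t\<close>: a probability density that concentrates at 0 as \<open>t\<close>
  decreases to 0.
\<close>

definition heat_kernel :: "real \<Rightarrow> real^'n::finite \<Rightarrow> real" where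
  "heat_kernel t x = (1 / sqrt t) ^ CARD('n) * gaussian (1 / t) x"

lemma heat_kernel_pos: "0 < t \<Longrightarrow> 0 < heat_kernel t x"
  by (simp add: heat_kernel_def gaussian_pos)

lemma borel_measurable_heat_kernel[measurable]:
  assumes [measurable]: "f \<in> borel_measurable M"
  shows "(\<lambda>x. heat_kernel t (f x)) \<in> borel_measurable M"
  unfolding heat_kernel_def by measurable

lemma norm_square_cart: "(norm x)\<^sup>2 = (\<Sum>i\<in>UNIV. (x $ i)\<^sup>2)" for x :: "real^'n::finite"
  unfolding power2_norm_eq_inner inner_vec_def by (simp add: power2_eq_square)

lemma
  fixes \<xi> :: "real^'n::finite"
  assumes t: "0 < t"
  shows integrable_gaussian: "integrable lborel (\<lambda>x::real^'n. complex_of_real (gaussian t x))"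
    and fourier_gaussian: "fourier (\<lambda>x. complex_of_real (gaussian t x)) \<xi> = complex_of_real (heat_kernel t \<xi>)"
proof -
  let ?f = "\<lambda>v u. exp (- 2 * of_real pi * \<i> * of_real (u * v)) * complex_of_real (exp (- (pi * t * u\<^sup>2)))"
  have prod: "character x \<xi> * complex_of_real (gaussian t x) = (\<Prod>i\<in>UNIV. ?f (\<xi> $ i) (x $ i))" for x \<xi> :: "real^'n"
  proof -
    have "(\<Prod>i\<in>UNIV. exp (- 2 * of_real pi * \<i> * of_real (x $ i * \<xi> $ i))) = character x \<xi>"
      by (simp add: exp_sum[symmetric] character_def inner_vec_def sum_distrib_left sum_negf)
    moreover have "(\<Prod>i\<in>UNIV. complex_of_real (exp (- (pi * t * (x $ i)\<^sup>2)))) = complex_of_real (gaussian t x)"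
      unfolding of_real_prod[symmetric] by (simp add: exp_sum[symmetric] gaussian_def norm_square_cart sum_distrib_left sum_negf)
    ultimately show ?thesis by (simp only: prod.distrib)
  qed
  show "integrable lborel (\<lambda>x::real^'n. complex_of_real (gaussian t x))"
    using integrable_prod_cart[of "\<lambda>i. ?f 0"] gaussian_fourier_real(1)[OF t, of 0] prod[of _ 0]
    by (simp add: character_def)
  have "fourier (\<lambda>x. complex_of_real (gaussian t x)) \<xi> = (LINT x|lborel. (\<Prod>i\<in>UNIV. ?f (\<xi> $ i) ((x::real^'n) $ i)))"
    by (subst fourier_lborel) (simp_all only: prod, measurable)
  also have "\<dots> = (\<Prod>i\<in>UNIV. (LINT u|lborel. ?f (\<xi> $ i) u))"
    by (intro integral_prod_cart gaussian_fourier_real t)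
  also have "\<dots> = (\<Prod>i\<in>UNIV. complex_of_real (1 / sqrt t * exp (- (pi * (\<xi> $ i)\<^sup>2 / t))))"
    by (simp only: gaussian_fourier_real(2)[OF t])
  also have "\<dots> = complex_of_real (heat_kernel t \<xi>)"
    unfolding of_real_prod[symmetric] prod.distrib
    by (simp add: heat_kernel_def gaussian_def exp_sum[symmetric] norm_square_cart sum_distrib_left sum_negf sum_divide_distrib)
  finally show "fourier (\<lambda>x. complex_of_real (gaussian t x)) \<xi> = complex_of_real (heat_kernel t \<xi>)" .
qed

lemma heat_kernel_minus: "heat_kernel t (x - y) = heat_kernel t (y - x)"
  by (simp add: heat_kernel_def gaussian_def norm_minus_commute)

lemma
  fixes \<eta> :: "real^'n::finite"
  assumes t: "0 < t"
  shows integrable_modulated_gaussian: "integrable lborel (\<lambda>\<xi>. cnj (character \<xi> \<eta>) * complex_of_real (gaussian t \<xi>))"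
    and fourier_modulated_gaussian: "fourier (\<lambda>\<xi>. cnj (character \<xi> \<eta>) * complex_of_real (gaussian t \<xi>)) x
      = complex_of_real (heat_kernel t (x - \<eta>))"
proof -
  show "integrable lborel (\<lambda>\<xi>. cnj (character \<xi> \<eta>) * complex_of_real (gaussian t \<xi>))"
    by (rule Bochner_Integration.integrable_bound[OF integrable_gaussian[OF t]]) (auto simp: norm_mult)
  have "fourier (\<lambda>\<xi>. cnj (character \<xi> \<eta>) * complex_of_real (gaussian t \<xi>)) x = fourier (\<lambda>\<xi>. complex_of_real (gaussian t \<xi>)) (x - \<eta>)"
    unfolding fourier_character by (simp add: character_diff[symmetric] mult.assoc)
  then show "fourier (\<lambda>\<xi>. cnj (character \<xi> \<eta>) * complex_of_real (gaussian t \<xi>)) x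
      = complex_of_real (heat_kernel t (x - \<eta>))" by (simp add: fourier_gaussian[OF t])
qed

lemma nn_integral_heat_kernel_average:
  fixes \<eta> :: "real^'n::finite"
  assumes t: "0 < t" and [measurable]: "h \<in> borel_measurable borel"
  shows "(\<integral>\<^sup>+\<xi>. h \<xi> * ennreal (heat_kernel t (\<xi> - \<eta>)) \<partial>lborel) = (\<integral>\<^sup>+z. h (\<eta> + sqrt t *\<^sub>R z) * ennreal (gaussian 1 z) \<partial>lborel)"
proof -
  have scale: "ennreal (sqrt t ^ CARD('n)) * ennreal (heat_kernel t (sqrt t *\<^sub>R z)) = ennreal (gaussian 1 z)" for z :: "real^'n"
    using t by (simp add: heat_kernel_def gaussian_def power_mult_distrib power_divide ennreal_mult'[symmetric])
  have "(\<integral>\<^sup>+\<xi>. h \<xi> * ennreal (heat_kernel t (\<xi> - \<eta>)) \<partial>lborel)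
     = (\<integral>\<^sup>+z. ennreal (sqrt t ^ CARD('n)) * (h (\<eta> + sqrt t *\<^sub>R z) * ennreal (heat_kernel t (sqrt t *\<^sub>R z))) \<partial>lborel)"
    using t by (subst lborel_affine[of "sqrt t" \<eta>]) (simp_all add: nn_integral_density nn_integral_distr)
  also have "\<dots> = (\<integral>\<^sup>+z. h (\<eta> + sqrt t *\<^sub>R z) * (ennreal (sqrt t ^ CARD('n)) * ennreal (heat_kernel t (sqrt t *\<^sub>R z))) \<partial>lborel)"
    by (simp only: mult.left_commute)
  finally show ?thesis by (simp only: scale)
qed

lemma nn_integral_gaussian: "(\<integral>\<^sup>+z. ennreal (gaussian 1 z) \<partial>(lborel :: (real^'n::finite) measure)) = 1"
proof -
  have i: "integrable lborel (\<lambda>z::real^'n. complex_of_real (gaussian 1 z))" by (rule integrable_gaussian) simp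
  have "complex_of_real (LINT z|lborel. gaussian 1 (z :: real^'n)) = fourier (\<lambda>z. complex_of_real (gaussian 1 z)) (0::real^'n)"
    by (subst fourier_lborel) (simp_all add: character_def)
  also have "\<dots> = 1"
    unfolding fourier_gaussian[OF zero_less_one] by (simp add: heat_kernel_def gaussian_def)
  finally have "(LINT z|lborel. gaussian 1 (z :: real^'n)) = 1" by (simp only: of_real_eq_1_iff)
  moreover have "integrable lborel (\<lambda>z::real^'n. gaussian 1 z)" using i by (simp only: complex_of_real_integrable_eq)
  ultimately show ?thesis
    using nn_integral_eq_integral[of lborel "\<lambda>z::real^'n. gaussian 1 z"] by (simp add: gaussian_pos less_imp_le)
qed

lemma nn_integral_heat_kernel:
  assumes t: "0 < t"
  shows "(\<integral>\<^sup>+\<xi>. ennreal (heat_kernel t (\<xi> - \<eta>)) \<partial>lborel) = 1"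
  using nn_integral_heat_kernel_average[OF t, of "\<lambda>_. 1" \<eta>] by (simp add: nn_integral_gaussian)

lemma nn_integral_heat_kernel':
  assumes t: "0 < t"
  shows "(\<integral>\<^sup>+\<eta>. ennreal (heat_kernel t (\<xi> - \<eta>)) \<partial>lborel) = 1"
  using nn_integral_heat_kernel[OF t, of \<xi>] by (subst heat_kernel_minus) simp

section \<open>Plancherel's inequality\<close>

lemma norm_integral_le_nn_integral:
  fixes f :: "'a \<Rightarrow> 'b::{banach,second_countable_topology}"
  shows "ennreal (norm (integral\<^sup>L M f)) \<le> (\<integral>\<^sup>+x. ennreal (norm (f x)) \<partial>M)"
  by (cases "integrable M f") (auto intro: integral_norm_bound_ennreal simp: not_integrable_integral_eq)

text \<open>
  The Gaussian weight makes the left integral finite. By two applications of the multiplication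
  formula it equals \<open>\<integral>\<integral> f x * cnj (f y) * heat_kernel t (y - x)\<close>, and the claim follows from
  \<open>\<bar>f x\<bar> * \<bar>f y\<bar> \<le> (\<bar>f x\<bar>\<^sup>2 + \<bar>f y\<bar>\<^sup>2) / 2\<close> because the heat kernel has integral 1 in either variable.
\<close>

lemma Plancherel_gaussian_bound:
  fixes f :: "real^'n::finite \<Rightarrow> complex"
  assumes f: "integrable lborel f" and t: "0 < t"
  shows "(\<integral>\<^sup>+\<xi>. ennreal ((norm (fourier f \<xi>))\<^sup>2 * gaussian t \<xi>) \<partial>lborel) \<le> (\<integral>\<^sup>+x. ennreal ((norm (f x))\<^sup>2) \<partial>lborel)"
proof -
  have [measurable]: "f \<in> borel_measurable borel" using f borel_measurable_integrable by auto
  have fl: "integrable lebesgue f" by (rule integrable_lebesgue_of_lborel[OF f])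
  note [measurable] = fourier_borel[OF fl]
  define N where "N = (LINT x|lebesgue. norm (f x))"
  have N: "norm (fourier f \<xi>) \<le> N" for \<xi> unfolding N_def by (rule norm_fourier_le)
  have N0: "0 \<le> N" unfolding N_def by simp
  define w where "w \<xi> = cnj (fourier f \<xi>) * complex_of_real (gaussian t \<xi>)" for \<xi>
  have [measurable]: "w \<in> borel_measurable borel" unfolding w_def by measurable
  have w: "integrable lborel w"
  proof (rule Bochner_Integration.integrable_bound)
    show "integrable lborel (\<lambda>\<xi>::real^'n. complex_of_real N * complex_of_real (gaussian t \<xi>))"
      by (intro integrable_mult_right integrable_gaussian t)
    show "AE \<xi> in lborel. norm (w \<xi>) \<le> norm (complex_of_real N * complex_of_real (gaussian t \<xi>))"
      using N N0 by (auto simp: w_def norm_mult gaussian_pos less_imp_le intro!: mult_right_mono)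
  qed measurable
  have fw: "ennreal (norm (fourier w x)) \<le> (\<integral>\<^sup>+y. ennreal (norm (f y) * heat_kernel t (y - x)) \<partial>lborel)" for x
  proof -
    have "fourier w x = (LINT \<xi>|lborel. cnj (fourier f \<xi> * (cnj (character \<xi> x) * complex_of_real (gaussian t \<xi>))))"
      by (subst fourier_lborel) (simp_all add: w_def mult_ac)
    also have "\<dots> = cnj (LINT \<xi>|lborel. fourier f \<xi> * (cnj (character \<xi> x) * complex_of_real (gaussian t \<xi>)))"
      by (rule Bochner_Integration.integral_cnj)
    also have "\<dots> = cnj (LINT y|lborel. f y * complex_of_real (heat_kernel t (y - x)))"
      by (subst fourier_multiplication[symmetric]) (simp_all add: f integrable_modulated_gaussian fourier_modulated_gaussian t)
    finally have "ennreal (norm (fourier w x)) \<le> (\<integral>\<^sup>+y. ennreal (norm (f y * complex_of_real (heat_kernel t (y - x)))) \<partial>lborel)"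
      by (simp only: complex_mod_cnj norm_integral_le_nn_integral)
    then show ?thesis using t by (simp add: norm_mult heat_kernel_pos less_imp_le)
  qed
  let ?q = "\<lambda>x. ennreal ((norm (f x))\<^sup>2 / 2)"
  let ?h = "\<lambda>x y. ennreal (heat_kernel t (y - x))"
  have "(\<integral>\<^sup>+\<xi>. ennreal ((norm (fourier f \<xi>))\<^sup>2 * gaussian t \<xi>) \<partial>lborel) = ennreal (norm (LINT \<xi>|lborel. fourier f \<xi> * w \<xi>))"
  proof -
    have eq: "fourier f \<xi> * w \<xi> = complex_of_real ((norm (fourier f \<xi>))\<^sup>2 * gaussian t \<xi>)" for \<xi>
      unfolding w_def of_real_mult complex_norm_square by (simp only: mult.assoc)
    have "integrable lborel (\<lambda>\<xi>. fourier f \<xi> * w \<xi>)"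
    proof (rule Bochner_Integration.integrable_bound)
      show "integrable lborel (\<lambda>\<xi>. complex_of_real N * w \<xi>)" using w by simp
      show "AE \<xi> in lborel. norm (fourier f \<xi> * w \<xi>) \<le> norm (complex_of_real N * w \<xi>)"
        using N N0 by (auto simp: norm_mult intro!: mult_right_mono)
    qed measurable
    then have i: "integrable lborel (\<lambda>\<xi>. (norm (fourier f \<xi>))\<^sup>2 * gaussian t \<xi>)"
      unfolding eq by (simp only: complex_of_real_integrable_eq)
    have nn: "0 \<le> (norm (fourier f \<xi>))\<^sup>2 * gaussian t \<xi>" for \<xi> by (simp add: gaussian_pos less_imp_le)
    have "norm (LINT \<xi>|lborel. fourier f \<xi> * w \<xi>) = (LINT \<xi>|lborel. (norm (fourier f \<xi>))\<^sup>2 * gaussian t \<xi>)"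
      unfolding eq integral_complex_of_real norm_of_real using nn by simp
    then show ?thesis using nn_integral_eq_integral[OF i] nn by simp
  qed
  also have "\<dots> = ennreal (norm (LINT x|lborel. f x * fourier w x))"
    by (simp only: fourier_multiplication[OF f w])
  also have "\<dots> \<le> (\<integral>\<^sup>+x. ennreal (norm (f x)) * ennreal (norm (fourier w x)) \<partial>lborel)"
    using norm_integral_le_nn_integral[of lborel "\<lambda>x. f x * fourier w x"] by (simp add: norm_mult ennreal_mult')
  also have "\<dots> \<le> (\<integral>\<^sup>+x. ennreal (norm (f x)) * (\<integral>\<^sup>+y. ennreal (norm (f y) * heat_kernel t (y - x)) \<partial>lborel) \<partial>lborel)"
    by (intro nn_integral_mono mult_left_mono fw) simp
  also have "\<dots> = (\<integral>\<^sup>+x. \<integral>\<^sup>+y. ennreal (norm (f x)) * ennreal (norm (f y) * heat_kernel t (y - x)) \<partial>lborel \<partial>lborel)"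
    by (intro nn_integral_cong nn_integral_cmult[symmetric]) measurable
  also have "\<dots> \<le> (\<integral>\<^sup>+x. \<integral>\<^sup>+y. ?q x * ?h x y
      + ?q y * ?h x y \<partial>lborel \<partial>lborel)"
  proof (intro nn_integral_mono)
    fix x y :: "real^'n"
    have h: "0 \<le> heat_kernel t (y - x)" using t by (simp add: heat_kernel_pos less_imp_le)
    have "norm (f x) * norm (f y) \<le> (norm (f x))\<^sup>2 / 2 + (norm (f y))\<^sup>2 / 2"
      using zero_le_power2[of "norm (f x) - norm (f y)"] by (simp add: power2_eq_square algebra_simps)
    then have "norm (f x) * (norm (f y) * heat_kernel t (y - x)) \<le> ((norm (f x))\<^sup>2 / 2 + (norm (f y))\<^sup>2 / 2) * heat_kernel t (y - x)"
      using h by (simp only: mult.assoc[symmetric] mult_right_mono)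
    then have "ennreal (norm (f x) * (norm (f y) * heat_kernel t (y - x))) \<le> ennreal (((norm (f x))\<^sup>2 / 2 + (norm (f y))\<^sup>2 / 2) * heat_kernel t (y - x))"
      by (rule ennreal_leI)
    then show "ennreal (norm (f x)) * ennreal (norm (f y) * heat_kernel t (y - x)) \<le> ?q x * ?h x y
      + ?q y * ?h x y"
      using h by (simp add: ennreal_mult'[symmetric] ennreal_plus[symmetric] distrib_right del: ennreal_plus)
  qed
  also have "\<dots> = (\<integral>\<^sup>+x. \<integral>\<^sup>+y. ?q x * ?h x y \<partial>lborel \<partial>lborel)
      + (\<integral>\<^sup>+x. \<integral>\<^sup>+y. ?q y * ?h x y \<partial>lborel \<partial>lborel)"
    by (subst nn_integral_add[symmetric], measurable, intro nn_integral_cong nn_integral_add, measurable)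
  also have "(\<integral>\<^sup>+x. \<integral>\<^sup>+y. ?q x * ?h x y \<partial>lborel \<partial>lborel)
      = (\<integral>\<^sup>+x. ?q x \<partial>lborel)"
    by (simp add: nn_integral_cmult nn_integral_heat_kernel[OF t])
  also have "(\<integral>\<^sup>+x. \<integral>\<^sup>+y. ?q y * ?h x y \<partial>lborel \<partial>lborel)
      = (\<integral>\<^sup>+y. \<integral>\<^sup>+x. ?q y * ?h x y \<partial>lborel \<partial>lborel)"
    by (rule lborel_pair.Fubini') measurable
  also have "\<dots> = (\<integral>\<^sup>+x. ?q x \<partial>lborel)"
    by (simp add: nn_integral_cmult nn_integral_heat_kernel'[OF t])
  also have "(\<integral>\<^sup>+x. ?q x \<partial>lborel) + (\<integral>\<^sup>+x. ?q x \<partial>lborel)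
     = (\<integral>\<^sup>+x. ennreal ((norm (f x))\<^sup>2) \<partial>lborel)"
    by (subst nn_integral_add[symmetric]) (simp_all add: ennreal_plus[symmetric] del: ennreal_plus)
  finally show ?thesis .
qed

lemma Plancherel_inequality:
  fixes f :: "real^'n::finite \<Rightarrow> complex"
  assumes f: "integrable lborel f"
  shows "(\<integral>\<^sup>+\<xi>. ennreal ((norm (fourier f \<xi>))\<^sup>2) \<partial>lborel) \<le> (\<integral>\<^sup>+x. ennreal ((norm (f x))\<^sup>2) \<partial>lborel)"
proof -
  note [measurable] = fourier_borel[OF integrable_lebesgue_of_lborel[OF f]]
  have "(\<integral>\<^sup>+\<xi>. ennreal ((norm (fourier f \<xi>))\<^sup>2) \<partial>lborel)
    = (\<integral>\<^sup>+\<xi>. liminf (\<lambda>k. ennreal ((norm (fourier f \<xi>))\<^sup>2 * gaussian (1 / Suc k) \<xi>)) \<partial>lborel)"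
  proof (intro nn_integral_cong)
    fix \<xi>
    have "(\<lambda>k. ennreal ((norm (fourier f \<xi>))\<^sup>2 * gaussian (1 / Suc k) \<xi>)) \<longlonglongrightarrow> ennreal ((norm (fourier f \<xi>))\<^sup>2 * exp (- (pi * 0 * (norm \<xi>)\<^sup>2)))"
      unfolding gaussian_def by (intro tendsto_ennrealI tendsto_intros LIMSEQ_Suc[OF lim_1_over_n])
    then show "ennreal ((norm (fourier f \<xi>))\<^sup>2) = liminf (\<lambda>k. ennreal ((norm (fourier f \<xi>))\<^sup>2 * gaussian (1 / Suc k) \<xi>))"
      using lim_imp_Liminf[OF sequentially_bot] by fastforce
  qed
  also have "\<dots> \<le> liminf (\<lambda>k. \<integral>\<^sup>+\<xi>. ennreal ((norm (fourier f \<xi>))\<^sup>2 * gaussian (1 / Suc k) \<xi>) \<partial>lborel)"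
    by (intro nn_integral_liminf) measurable
  also have "\<dots> \<le> liminf (\<lambda>k. \<integral>\<^sup>+x. ennreal ((norm (f x))\<^sup>2) \<partial>lborel)"
    by (intro Liminf_mono always_eventually allI Plancherel_gaussian_bound f) simp
  finally show ?thesis by (simp add: Liminf_const)
qed

section \<open>The Hausdorff--Young inequality\<close>

lemma layer_cake_power:
  assumes "0 < e" "0 \<le> c"
  shows "(\<integral>\<^sup>+u. ennreal (e * u powr (e - 1)) * indicator {0..c} u \<partial>lborel) = ennreal (c powr e)"
proof -
  have "((\<lambda>u. e * u powr (e - 1)) has_integral (e * (c powr (e - 1 + 1) / (e - 1 + 1)))) {0..c}"
    using assms by (intro has_integral_mult_right has_integral_powr_from_0) auto
  from nn_integral_has_integral_lebesgue'[OF _ this] assms show ?thesis by simp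
qed

text \<open>
  The splitting behind Marcinkiewicz interpolation. Cut \<open>f\<close> at height \<open>s = (u / 2) powr (- 1 / (p - 1))\<close>.
  This height is such that the part above \<open>s\<close> has \<open>L\<^sup>1\<close> norm at most \<open>u / 2\<close>, so its transform never
  exceeds \<open>u / 2\<close>; the transform of the part below \<open>s\<close> is then at least \<open>u / 2\<close> on the set in question,
  and Chebyshev's and Plancherel's inequalities bound the measure of that set.
\<close>

lemma fourier_distribution_bound:
  fixes f :: "real^'n::finite \<Rightarrow> complex"
  assumes p: "1 < p" and f: "integrable lborel f" and fp: "integrable lborel (\<lambda>x. norm (f x) powr p)"
    and one: "(LINT x|lborel. norm (f x) powr p) \<le> 1" and u: "0 < u"
  shows "emeasure lborel {\<xi>. u \<le> norm (fourier f \<xi>)}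
    \<le> (\<integral>\<^sup>+x. ennreal (4 / u\<^sup>2) * (ennreal ((norm (f x))\<^sup>2) * indicator {x. norm (f x) \<le> (u / 2) powr (- 1 / (p - 1))} x) \<partial>lborel)"
proof -
  have [measurable]: "f \<in> borel_measurable borel" using f borel_measurable_integrable by auto
  define s where "s = (u / 2) powr (- 1 / (p - 1))"
  have s: "0 < s" using u by (simp add: s_def)
  have s_powr: "s powr (1 - p) = u / 2"
  proof -
    have "- 1 / (p - 1) * (1 - p) = 1" using p by (simp add: field_simps)
    then show ?thesis using u unfolding s_def powr_powr by simp
  qed
  define f1 where "f1 x = (if norm (f x) \<le> s then 0 else f x)" for x
  define f2 where "f2 x = (if norm (f x) \<le> s then f x else 0)" for x
  have [measurable]: "f1 \<in> borel_measurable borel" "f2 \<in> borel_measurable borel"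
    unfolding f1_def f2_def by measurable
  have i1: "integrable lborel f1" and i2: "integrable lborel f2"
    by (rule Bochner_Integration.integrable_bound[OF f]; simp add: f1_def f2_def)+
  have split: "fourier f \<xi> = fourier f1 \<xi> + fourier f2 \<xi>" for \<xi>
  proof -
    have "f = (\<lambda>x. f1 x + f2 x)" by (auto simp: f1_def f2_def)
    then show ?thesis using fourier_add[OF integrable_lebesgue_of_lborel[OF i1] integrable_lebesgue_of_lborel[OF i2], of \<xi>] by simp
  qed
  have small: "norm (fourier f1 \<xi>) \<le> u / 2" for \<xi>
  proof -
    have le: "norm (f1 x) \<le> s powr (1 - p) * norm (f x) powr p" for x
    proof (cases "norm (f x) \<le> s")
      case False
      then have "norm (f x) = norm (f x) powr (1 - p) * norm (f x) powr p"
        using s by (simp add: powr_add[symmetric])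
      also have "\<dots> \<le> s powr (1 - p) * norm (f x) powr p"
        using False s p by (intro mult_right_mono powr_mono2') auto
      finally show ?thesis using False by (simp add: f1_def)
    qed (simp add: f1_def)
    have "norm (fourier f1 \<xi>) \<le> (LINT x|lebesgue. norm (f1 x))" by (rule norm_fourier_le)
    also have "\<dots> = (LINT x|lborel. norm (f1 x))" by (intro integral_completion) measurable
    also have "\<dots> \<le> (LINT x|lborel. s powr (1 - p) * norm (f x) powr p)"
      using fp by (intro integral_mono integrable_norm i1 le) auto
    also have "\<dots> \<le> s powr (1 - p) * 1" using mult_left_mono[OF one, of "s powr (1 - p)"] by simp
    finally show ?thesis using s_powr by simp
  qed
  have i2': "integrable lebesgue f2" by (rule integrable_lebesgue_of_lborel[OF i2])
  note [measurable] = fourier_borel[OF integrable_lebesgue_of_lborel[OF f]] fourier_borel[OF i2']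
  have "emeasure lborel {\<xi>. u \<le> norm (fourier f \<xi>)} = (\<integral>\<^sup>+\<xi>. indicator {\<xi>. u \<le> norm (fourier f \<xi>)} \<xi> \<partial>lborel)"
    by (intro nn_integral_indicator[symmetric]) measurable
  also have "\<dots> \<le> (\<integral>\<^sup>+\<xi>. ennreal (4 / u\<^sup>2) * ennreal ((norm (fourier f2 \<xi>))\<^sup>2) \<partial>lborel)"
  proof (intro nn_integral_mono)
    fix \<xi>
    show "indicator {\<xi>. u \<le> norm (fourier f \<xi>)} \<xi> \<le> ennreal (4 / u\<^sup>2) * ennreal ((norm (fourier f2 \<xi>))\<^sup>2)"
    proof (cases "u \<le> norm (fourier f \<xi>)")
      case True
      then have "u / 2 \<le> norm (fourier f2 \<xi>)"
        using split[of \<xi>] small[of \<xi>] norm_triangle_ineq[of "fourier f1 \<xi>" "fourier f2 \<xi>"] by simp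
      then have "(u / 2)\<^sup>2 \<le> (norm (fourier f2 \<xi>))\<^sup>2" using u by (intro power_mono) auto
      then have "1 \<le> 4 / u\<^sup>2 * (norm (fourier f2 \<xi>))\<^sup>2" using u by (simp add: field_simps power2_eq_square)
      then show ?thesis using True by (simp add: ennreal_mult'[symmetric])
    qed simp
  qed
  also have "\<dots> = ennreal (4 / u\<^sup>2) * (\<integral>\<^sup>+\<xi>. ennreal ((norm (fourier f2 \<xi>))\<^sup>2) \<partial>lborel)"
    by (intro nn_integral_cmult) measurable
  also have "\<dots> \<le> ennreal (4 / u\<^sup>2) * (\<integral>\<^sup>+x. ennreal ((norm (f2 x))\<^sup>2) \<partial>lborel)"
    by (intro mult_left_mono Plancherel_inequality i2) simp
  also have "\<dots> = (\<integral>\<^sup>+x. ennreal (4 / u\<^sup>2) * ennreal ((norm (f2 x))\<^sup>2) \<partial>lborel)"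
    by (intro nn_integral_cmult[symmetric]) measurable
  also have "\<dots> = (\<integral>\<^sup>+x. ennreal (4 / u\<^sup>2) * (ennreal ((norm (f x))\<^sup>2) * indicator {x. norm (f x) \<le> s} x) \<partial>lborel)"
    by (intro nn_integral_cong) (auto simp: f2_def)
  finally show ?thesis unfolding s_def .
qed

text \<open>
  Integrate the distribution bound against \<open>q * u powr (q - 1)\<close>. After interchanging the integrals,
  the one over \<open>u\<close> extends up to \<open>2 * \<bar>f x\<bar> powr (1 - p)\<close> and contributes a multiple of
  \<open>\<bar>f x\<bar> powr ((1 - p) * (q - 2))\<close>; together with the factor \<open>\<bar>f x\<bar>\<^sup>2\<close> the exponent is exactly \<open>p\<close>.
\<close>

lemma Hausdorff_Young_normalized:
  fixes f :: "real^'n::finite \<Rightarrow> complex"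
  assumes p: "1 < p" "p < 2" and q: "1 / p + 1 / q = 1"
    and f: "integrable lborel f" and fp: "integrable lborel (\<lambda>x. norm (f x) powr p)"
    and one: "(LINT x|lborel. norm (f x) powr p) \<le> 1"
  shows "(\<integral>\<^sup>+\<xi>. ennreal (norm (fourier f \<xi>) powr q) \<partial>lborel) \<le> ennreal (4 * q / (q - 2) * 2 powr (q - 2))"
proof -
  have q_eq: "q = p / (p - 1)"
  proof -
    have "1 / q = (p - 1) / p" using q p by (simp add: field_simps)
    then show ?thesis by (metis divide_divide_eq_right div_by_1 inverse_divide inverse_eq_divide mult_1)
  qed
  have q2: "2 < q" using p by (simp add: q_eq field_simps)
  have exponent: "2 + (1 - p) * (q - 2) = p" using p by (simp add: q_eq field_simps)
  have [measurable]: "f \<in> borel_measurable borel" using f borel_measurable_integrable by auto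
  note [measurable] = fourier_borel[OF integrable_lebesgue_of_lborel[OF f]]
  let ?s = "\<lambda>u. (u / 2) powr (- 1 / (p - 1))"
  let ?R = "\<lambda>u x. ennreal ((norm (f x))\<^sup>2) * indicator {x. norm (f x) \<le> ?s u} x"
  have "(\<integral>\<^sup>+\<xi>. ennreal (norm (fourier f \<xi>) powr q) \<partial>lborel)
    = (\<integral>\<^sup>+\<xi>. \<integral>\<^sup>+u. ennreal (q * u powr (q - 1)) * indicator {0..norm (fourier f \<xi>)} u \<partial>lborel \<partial>lborel)"
    using q2 by (simp add: layer_cake_power)
  also have "\<dots> = (\<integral>\<^sup>+u. \<integral>\<^sup>+\<xi>. ennreal (q * u powr (q - 1)) * indicator {0..norm (fourier f \<xi>)} u \<partial>lborel \<partial>lborel)"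
    by (rule lborel_pair.Fubini'[symmetric]) (simp add: indicator_def atLeastAtMost_iff, measurable)
  also have "\<dots> \<le> (\<integral>\<^sup>+u. \<integral>\<^sup>+x. ennreal (4 * q * u powr (q - 3)) * indicator {0<..} u * (?R u x) \<partial>lborel \<partial>lborel)"
  proof (rule nn_integral_mono)
    fix u :: real
    show "(\<integral>\<^sup>+\<xi>. ennreal (q * u powr (q - 1)) * indicator {0..norm (fourier f \<xi>)} u \<partial>lborel)
      \<le> (\<integral>\<^sup>+x. ennreal (4 * q * u powr (q - 3)) * indicator {0<..} u * (?R u x) \<partial>lborel)"
    proof (cases "0 < u")
      case True
      have "(\<integral>\<^sup>+\<xi>. ennreal (q * u powr (q - 1)) * indicator {0..norm (fourier f \<xi>)} u \<partial>lborel)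
        = (\<integral>\<^sup>+\<xi>. ennreal (q * u powr (q - 1)) * indicator {\<xi>. u \<le> norm (fourier f \<xi>)} \<xi> \<partial>lborel)"
        using True by (intro nn_integral_cong) (auto simp: indicator_def)
      also have "\<dots> = ennreal (q * u powr (q - 1)) * emeasure lborel {\<xi>. u \<le> norm (fourier f \<xi>)}"
        by (intro nn_integral_cmult_indicator) measurable
      also have "\<dots> \<le> ennreal (q * u powr (q - 1)) * (\<integral>\<^sup>+x. ennreal (4 / u\<^sup>2) * (?R u x) \<partial>lborel)"
        by (intro mult_left_mono fourier_distribution_bound[OF p(1) f fp one True]) simp
      also have "\<dots> = (\<integral>\<^sup>+x. ennreal (q * u powr (q - 1)) * (ennreal (4 / u\<^sup>2) * (?R u x)) \<partial>lborel)"
        by (intro nn_integral_cmult[symmetric]) measurable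
      also have "\<dots> = (\<integral>\<^sup>+x. ennreal (4 * q * u powr (q - 3)) * indicator {0<..} u * (?R u x) \<partial>lborel)"
      proof -
        have "u powr (q - 1) = u powr (q - 3) * u\<^sup>2"
          using True powr_add[of u "q - 3" 2] by simp
        then have "q * u powr (q - 1) * (4 / u\<^sup>2) = 4 * q * u powr (q - 3)" using True by simp
        then have "ennreal (q * u powr (q - 1)) * ennreal (4 / u\<^sup>2) = ennreal (4 * q * u powr (q - 3)) * indicator {0<..} u"
          using q2 True by (simp add: ennreal_mult'[symmetric])
        then show ?thesis by (simp only: mult.assoc[symmetric])
      qed
      finally show ?thesis .
    next
      case False
      then have "ennreal (q * u powr (q - 1)) * indicator {0..norm (fourier f \<xi>)} u = 0" for \<xi>
        by (cases "u = 0") auto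
      then show ?thesis by (simp only: nn_integral_const) simp
    qed
  qed
  also have "\<dots> = (\<integral>\<^sup>+x. \<integral>\<^sup>+u. ennreal (4 * q * u powr (q - 3)) * indicator {0<..} u * (?R u x) \<partial>lborel \<partial>lborel)"
    by (rule lborel_pair.Fubini') (simp add: indicator_def, measurable)
  also have "\<dots> \<le> (\<integral>\<^sup>+x. ennreal (4 * q / (q - 2) * 2 powr (q - 2)) * ennreal (norm (f x) powr p) \<partial>lborel)"
  proof (intro nn_integral_mono)
    fix x
    show "(\<integral>\<^sup>+u. ennreal (4 * q * u powr (q - 3)) * indicator {0<..} u * (?R u x) \<partial>lborel)
      \<le> ennreal (4 * q / (q - 2) * 2 powr (q - 2)) * ennreal (norm (f x) powr p)"
    proof (cases "f x = 0")
      case False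
      define v where "v = norm (f x)"
      have v: "0 < v" using False by (simp add: v_def)
      let ?c = "2 * v powr (1 - p)"
      have imp: "u \<le> ?c" if "0 < u" "v \<le> ?s u" for u
      proof -
        have "v powr (p - 1) \<le> ?s u powr (p - 1)" using that v p by (intro powr_mono2) auto
        also have "\<dots> = (u / 2) powr (- 1)" using p by (simp add: powr_powr)
        also have "\<dots> = 2 / u" using that by (simp add: powr_minus_divide)
        finally have "u * v powr (p - 1) \<le> 2" using that by (simp add: field_simps)
        then have "u * v powr (p - 1) * v powr (1 - p) \<le> ?c" by (intro mult_right_mono) auto
        then show ?thesis using v by (simp add: mult.assoc powr_add[symmetric])
      qed
      have "(\<integral>\<^sup>+u. ennreal (4 * q * u powr (q - 3)) * indicator {0<..} u * (?R u x) \<partial>lborel)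
        \<le> (\<integral>\<^sup>+u. ennreal (4 * q / (q - 2) * v\<^sup>2) * (ennreal ((q - 2) * u powr (q - 2 - 1)) * indicator {0..?c} u) \<partial>lborel)"
      proof (intro nn_integral_mono)
        fix u :: real
        have "4 * q * u powr (q - 3) * v\<^sup>2 = 4 * q / (q - 2) * v\<^sup>2 * ((q - 2) * u powr (q - 2 - 1))" using q2 by simp
        then have "ennreal (4 * q * u powr (q - 3)) * ennreal (v\<^sup>2) = ennreal (4 * q / (q - 2) * v\<^sup>2) * ennreal ((q - 2) * u powr (q - 2 - 1))"
          using q2 by (subst (1 2) ennreal_mult'[symmetric]) auto
        then show "ennreal (4 * q * u powr (q - 3)) * indicator {0<..} u * (?R u x)
           \<le> ennreal (4 * q / (q - 2) * v\<^sup>2) * (ennreal ((q - 2) * u powr (q - 2 - 1)) * indicator {0..?c} u)"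
          using imp[of u] by (auto simp: indicator_def v_def)
      qed
      also have "\<dots> = ennreal (4 * q / (q - 2) * v\<^sup>2) * ennreal (?c powr (q - 2))"
        using q2 by (subst nn_integral_cmult, measurable, subst layer_cake_power) auto
      also have "\<dots> = ennreal (4 * q / (q - 2) * 2 powr (q - 2)) * ennreal (norm (f x) powr p)"
      proof -
        have "v\<^sup>2 * (v powr (1 - p)) powr (q - 2) = v powr p"
          using v exponent powr_add[of v 2 "(1 - p) * (q - 2)"] by (simp add: powr_powr)
        then have "4 * q / (q - 2) * v\<^sup>2 * ?c powr (q - 2) = 4 * q / (q - 2) * 2 powr (q - 2) * v powr p"
          by (simp add: powr_mult mult_ac)
        then show ?thesis using q2 by (simp add: ennreal_mult'[symmetric] v_def)
      qed
      finally show ?thesis .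
    qed simp
  qed
  also have "\<dots> = ennreal (4 * q / (q - 2) * 2 powr (q - 2)) * ennreal (LINT x|lborel. norm (f x) powr p)"
    by (subst nn_integral_cmult) (auto simp: nn_integral_eq_integral[OF fp])
  also have "\<dots> \<le> ennreal (4 * q / (q - 2) * 2 powr (q - 2)) * 1"
    using one by (intro mult_left_mono) auto
  finally show ?thesis by simp
qed

lemma lebesgue_lborel_transfer:
  fixes f g :: "'a::euclidean_space \<Rightarrow> complex"
  assumes f: "integrable lebesgue f" and g: "g \<in> borel_measurable borel" and ae: "AE x in lebesgue. f x = g x"
  shows "integrable lborel g"
proof -
  have gm: "g \<in> borel_measurable lebesgue" by (rule measurable_completion) (use g in simp)
  have "integrable lebesgue g" by (rule integrable_cong_AE_imp[OF f gm]) (use ae in auto)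
  then show ?thesis using g integrable_completion[of g lborel] by simp
qed

text \<open>
  The case \<open>p = 2\<close> is Plancherel's inequality; for \<open>p < 2\<close> the normalised inequality is applied to a
  multiple of \<open>f\<close>. The constant depends on \<open>p\<close> and is not the optimal one, which is 1 at most.
\<close>

theorem Hausdorff_Young:
  assumes p: "1 < p" "p \<le> 2" and q: "1 / p + 1 / q = 1"
  shows "\<exists>C\<ge>0. \<forall>f :: real^'n::finite \<Rightarrow> complex. integrable lebesgue f \<longrightarrow> f \<in> Lp_space p \<longrightarrow>
    fourier f \<in> Lp_space q \<and> Lp_norm q (fourier f) \<le> C * Lp_norm p f"
proof -
  have q1: "1 < q"
  proof -
    have "1 / q = (p - 1) / p" using q p by (simp add: field_simps)
    then have "0 < 1 / q" "1 / q < 1" using p by simp_all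
    then show ?thesis by (simp add: divide_less_eq zero_less_divide_iff split: if_splits)
  qed
  have "\<exists>C\<ge>0. \<forall>f :: real^'n \<Rightarrow> complex. integrable lborel f \<longrightarrow> integrable lborel (\<lambda>x. norm (f x) powr p) \<longrightarrow>
      (LINT x|lborel. norm (f x) powr p) \<le> 1 \<longrightarrow> (\<integral>\<^sup>+\<xi>. ennreal (norm (fourier f \<xi>) powr q) \<partial>lborel) \<le> ennreal C"
  proof (cases "p = 2")
    case True
    then have q2: "q = 2" using q by (simp add: field_simps)
    have "(\<integral>\<^sup>+\<xi>. ennreal (norm (fourier f \<xi>) powr q) \<partial>lborel) \<le> ennreal 1"
      if "integrable lborel f" "integrable lborel (\<lambda>x. norm (f x) powr p)" "(LINT x|lborel. norm (f x) powr p) \<le> 1" for f :: "real^'n \<Rightarrow> complex"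
    proof -
      have "(\<integral>\<^sup>+\<xi>. ennreal (norm (fourier f \<xi>) powr q) \<partial>lborel) \<le> (\<integral>\<^sup>+x. ennreal (norm (f x) powr p) \<partial>lborel)"
        using Plancherel_inequality[OF that(1)] by (simp add: True q2)
      also have "\<dots> = ennreal (LINT x|lborel. norm (f x) powr p)" by (intro nn_integral_eq_integral that) simp
      also have "\<dots> \<le> ennreal 1" using that(3) by (rule ennreal_leI)
      finally show ?thesis .
    qed
    then show ?thesis by (intro exI[of _ 1]) auto
  next
    case False
    have "2 < q"
    proof -
      have "1 / q = (p - 1) / p" using q p by (simp add: field_simps)
      also have "\<dots> < 1 / 2" using p False by (simp add: field_simps)
      finally show ?thesis using q1 by (simp add: field_simps)
    qed
    then show ?thesis
      using Hausdorff_Young_normalized[OF p(1) _ q] p False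
      by (intro exI[of _ "4 * q / (q - 2) * 2 powr (q - 2)"]) auto
  qed
  then obtain C where C: "0 \<le> C" and HY: "\<And>f :: real^'n \<Rightarrow> complex. integrable lborel f \<Longrightarrow> integrable lborel (\<lambda>x. norm (f x) powr p) \<Longrightarrow>
      (LINT x|lborel. norm (f x) powr p) \<le> 1 \<Longrightarrow> (\<integral>\<^sup>+\<xi>. ennreal (norm (fourier f \<xi>) powr q) \<partial>lborel) \<le> ennreal C" by blast
  have normalized: "fourier f \<in> Lp_space q \<and> Lp_norm q (fourier f) \<le> C powr (1 / q)"
    if f: "integrable lebesgue f" "f \<in> Lp_space p" "Lp_norm p f \<le> 1" for f :: "real^'n \<Rightarrow> complex"
  proof -
    obtain g where g: "g \<in> borel_measurable borel" and fg: "AE x in lebesgue. f x = g x"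
      using borel_representative[OF Lp_space_measurable[OF f(2)]] by blast
    have gm: "g \<in> borel_measurable lebesgue" by (rule measurable_completion) (use g in simp)
    have four: "fourier f = fourier g" by (intro fourier_cong_AE Lp_space_measurable[OF f(2)] gm fg)
    have gL: "g \<in> Lp_space p" using Lp_space_cong_AE[OF f(2), of g] p fg by (auto simp: eq_commute)
    have "Lp_norm p f = Lp_norm p g" by (intro Lp_norm_cong_AE Lp_space_measurable[OF f(2)] gm fg)
    then have "(LINT x|lebesgue. norm (g x) powr p) \<le> 1" using f(3) p Lp_norm_le_iff[of p 1 g] by simp
    moreover have m[measurable]: "(\<lambda>x. norm (g x) powr p) \<in> borel_measurable borel" using g by measurable
    ultimately have one: "(LINT x|lborel. norm (g x) powr p) \<le> 1" by (simp add: integral_completion)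
    have gp: "integrable lborel (\<lambda>x. norm (g x) powr p)"
      using Lp_space_integrable[OF gL] m by (simp add: integrable_completion)
    have le: "(\<integral>\<^sup>+\<xi>. ennreal (norm (fourier f \<xi>) powr q) \<partial>lborel) \<le> ennreal C"
      unfolding four by (rule HY[OF lebesgue_lborel_transfer[OF f(1) g fg] gp one])
    have [measurable]: "fourier f \<in> borel_measurable borel" by (rule fourier_borel[OF f(1)])
    have i: "integrable lborel (\<lambda>\<xi>. norm (fourier f \<xi>) powr q)"
      using le by (auto simp: integrable_iff_bounded top_unique less_top[symmetric])
    have "fourier f \<in> borel_measurable lebesgue" by (rule measurable_completion) simp
    then have L: "fourier f \<in> Lp_space q" using integrable_lebesgue_of_lborel[OF i] by (simp add: Lp_space_def)
    have "(LINT \<xi>|lebesgue. norm (fourier f \<xi>) powr q) = (LINT \<xi>|lborel. norm (fourier f \<xi>) powr q)"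
      by (intro integral_completion) measurable
    also have "\<dots> \<le> C" using le C by (simp add: nn_integral_eq_integral[OF i])
    finally have "Lp_norm q (fourier f) \<le> C powr (1 / q)"
      unfolding Lp_norm_def using q1 by (intro powr_mono2) auto
    with L show ?thesis by simp
  qed
  have "fourier f \<in> Lp_space q \<and> Lp_norm q (fourier f) \<le> C powr (1 / q) * Lp_norm p f"
    if f: "integrable lebesgue f" "f \<in> Lp_space p" for f :: "real^'n \<Rightarrow> complex"
  proof (cases "Lp_norm p f = 0")
    case True
    then have "AE x in lebesgue. f x = 0" using Lp_norm_eq_0_iff[OF f(2)] p by simp
    then have "fourier f = fourier (\<lambda>x. 0)" by (intro fourier_cong_AE Lp_space_measurable[OF f(2)]) auto
    also have "\<dots> = (\<lambda>x. 0)" by (simp add: fourier_def fun_eq_iff)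
    finally show ?thesis by (simp add: zero_in_Lp_space Lp_norm_zero True)
  next
    case False
    define c where "c = complex_of_real (1 / Lp_norm p f)"
    have pos: "0 < Lp_norm p f" using False Lp_norm_nonneg[of p f] by simp
    have "Lp_norm p (\<lambda>x. c * f x) = 1"
      by (subst Lp_norm_scale) (use p pos in \<open>simp_all add: c_def norm_divide\<close>)
    then have "fourier (\<lambda>x. c * f x) \<in> Lp_space q \<and> Lp_norm q (fourier (\<lambda>x. c * f x)) \<le> C powr (1 / q)"
      using f by (intro normalized Lp_space_scale) auto
    moreover have eq: "fourier f = (\<lambda>\<xi>. (1 / c) * fourier (\<lambda>x. c * f x) \<xi>)"
      unfolding fourier_scale using pos by (simp add: c_def)
    ultimately show ?thesis
      using pos q1 by (subst (1 2) eq) (auto intro!: Lp_space_scale mult_left_mono simp: Lp_norm_scale c_def norm_divide mult.commute)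
  qed
  then show ?thesis by (intro exI[of _ "C powr (1 / q)"]) auto
qed

section \<open>Injectivity of the Fourier transform\<close>

lemma integral_heat_kernel_average:
  fixes \<eta> :: "real^'n::finite" and h :: "real^'n \<Rightarrow> complex"
  assumes t: "0 < t" and [measurable]: "h \<in> borel_measurable borel"
  shows "(LINT \<xi>|lborel. h \<xi> * complex_of_real (heat_kernel t (\<xi> - \<eta>))) = (LINT z|lborel. h (\<eta> + sqrt t *\<^sub>R z) * complex_of_real (gaussian 1 z))"
proof -
  have scale: "sqrt t ^ CARD('n) * heat_kernel t (sqrt t *\<^sub>R z) = gaussian 1 z" for z :: "real^'n"
    using t by (simp add: heat_kernel_def gaussian_def power_mult_distrib power_divide)
  have "(LINT \<xi>|lborel. h \<xi> * complex_of_real (heat_kernel t (\<xi> - \<eta>)))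
     = (LINT z|lborel. (sqrt t ^ CARD('n)) *\<^sub>R (h (\<eta> + sqrt t *\<^sub>R z) * complex_of_real (heat_kernel t (sqrt t *\<^sub>R z))))"
    using t by (subst lborel_affine[of "sqrt t" \<eta>]) (simp_all add: integral_density integral_distr)
  also have "\<dots> = (LINT z|lborel. h (\<eta> + sqrt t *\<^sub>R z) * complex_of_real (sqrt t ^ CARD('n) * heat_kernel t (sqrt t *\<^sub>R z)))"
    by (simp add: scaleR_conv_of_real mult_ac)
  finally show ?thesis by (simp only: scale)
qed

lemma integral_gaussian: "(LINT z|lborel. gaussian 1 (z :: real^'n::finite)) = 1"
  by (intro integral_eq_nn_integral[THEN trans]) (auto simp: nn_integral_gaussian gaussian_pos less_imp_le)

lemma fourier_zero_imp_heat_average_zero: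
  fixes B :: "real^'n::finite \<Rightarrow> complex"
  assumes B: "integrable lborel B" and zero: "\<And>y. fourier B y = 0" and t: "0 < t"
  shows "(LINT \<xi>|lborel. B \<xi> * complex_of_real (heat_kernel t (\<xi> - \<eta>))) = 0"
  using fourier_multiplication[OF B integrable_modulated_gaussian[OF t, of \<eta>]]
  by (simp add: fourier_modulated_gaussian[OF t] zero)

text \<open>
  Averages of \<open>B\<close> against heat kernels vanish by the multiplication formula. Averaging these over
  the centres in the box gives \<open>\<integral> B * \<psi> t = 0\<close>, where \<open>\<psi> t\<close> is the indicator of the box smoothed by
  the heat kernel. As \<open>t\<close> tends to 0, \<open>\<psi> t\<close> converges boundedly to the indicator off the boundary.
\<close>

lemma fourier_zero_imp_box_integral_zero:
  fixes B :: "real^'n::finite \<Rightarrow> complex"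
  assumes B: "integrable lborel B" and zero: "\<And>y. fourier B y = 0"
  shows "(LINT \<xi>|lborel. B \<xi> * indicator (box a b) \<xi>) = 0"
proof -
  have [measurable]: "B \<in> borel_measurable borel" using B borel_measurable_integrable by auto
  define \<psi> where "\<psi> t \<xi> = (LINT z|lborel. indicator (box a b) (\<xi> + sqrt t *\<^sub>R z) * complex_of_real (gaussian 1 z))" for t \<xi>
  have [measurable]: "\<psi> t \<in> borel_measurable borel" for t unfolding \<psi>_def by measurable
  have norm_le: "norm (indicator (box a b) (\<xi> + sqrt t *\<^sub>R z) * complex_of_real (gaussian 1 z)) \<le> gaussian 1 z" for \<xi> t z
    by (auto simp: indicator_def gaussian_pos less_imp_le)
  have gint: "integrable lborel (\<lambda>z::real^'n. gaussian 1 z)"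
    using integrable_gaussian[of 1, where 'n='n] by (simp only: complex_of_real_integrable_eq)
  have \<psi>1: "norm (\<psi> t \<xi>) \<le> 1" for t \<xi>
  proof -
    have "norm (\<psi> t \<xi>) \<le> (LINT z|lborel. norm (indicator (box a b) (\<xi> + sqrt t *\<^sub>R z) * complex_of_real (gaussian 1 z)))"
      unfolding \<psi>_def by (rule integral_norm_bound)
    also have "\<dots> \<le> (LINT z|lborel. gaussian 1 (z::real^'n))"
      by (rule integral_mono'[OF gint]) (auto intro: norm_le simp: gaussian_pos less_imp_le simp del: norm_mult)
    finally show ?thesis by (simp add: integral_gaussian)
  qed
  have \<psi>_zero: "(LINT \<xi>|lborel. B \<xi> * \<psi> t \<xi>) = 0" if t: "0 < t" for t
  proof -
    let ?k = "\<lambda>\<xi> \<eta>. B \<xi> * (indicator (box a b) \<eta> * complex_of_real (heat_kernel t (\<eta> - \<xi>)))"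
    have hint: "integrable lborel (\<lambda>\<eta>. complex_of_real (heat_kernel t (\<eta> - \<xi>)))" for \<xi> :: "real^'n"
      unfolding complex_of_real_integrable_eq using t nn_integral_heat_kernel[OF t, of \<xi>]
      by (auto simp: integrable_iff_bounded heat_kernel_pos less_imp_le)
    have ihint: "integrable lborel (\<lambda>\<eta>. indicator (box a b) \<eta> * complex_of_real (heat_kernel t (\<eta> - \<xi>)))" for \<xi> :: "real^'n"
      by (rule Bochner_Integration.integrable_bound[OF hint[of \<xi>]]) (auto simp: indicator_def)
    have avg: "(LINT \<eta>|lborel. indicator (box a b) \<eta> * complex_of_real (heat_kernel t (\<eta> - \<xi>))) = \<psi> t \<xi>" for \<xi>
      unfolding \<psi>_def by (rule integral_heat_kernel_average[OF t]) measurable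
    have int: "integrable (lborel \<Otimes>\<^sub>M lborel) (\<lambda>(\<xi>, \<eta>). ?k \<xi> \<eta>)"
    proof (rule lborel_pair.Fubini_integrable)
      have nk: "norm (?k \<xi> \<eta>) = norm (B \<xi>) * Re (indicator (box a b) \<eta> * complex_of_real (heat_kernel t (\<eta> - \<xi>)))" for \<xi> \<eta>
        using t by (auto simp: norm_mult indicator_def heat_kernel_pos less_imp_le)
      have "(LINT \<eta>|lborel. norm (?k \<xi> \<eta>)) = norm (B \<xi>) * Re (\<psi> t \<xi>)" for \<xi>
        unfolding nk avg[symmetric] integral_mult_right_zero
        by (subst integral_bounded_linear[OF bounded_linear_Re ihint]) simp
      moreover have "integrable lborel (\<lambda>\<xi>. norm (B \<xi>) * Re (\<psi> t \<xi>))"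
      proof (rule Bochner_Integration.integrable_bound[OF B])
        have "\<bar>Re (\<psi> t \<xi>)\<bar> \<le> 1" for \<xi> using abs_Re_le_cmod[of "\<psi> t \<xi>"] \<psi>1[of t \<xi>] by linarith
        then show "AE \<xi> in lborel. norm (norm (B \<xi>) * Re (\<psi> t \<xi>)) \<le> norm (B \<xi>)"
          by (auto simp: abs_mult intro!: mult_left_le)
      qed measurable
      ultimately show "integrable lborel (\<lambda>\<xi>. LINT \<eta>|lborel. norm (case (\<xi>, \<eta>) of (\<xi>, \<eta>) \<Rightarrow> ?k \<xi> \<eta>))" by simp
      show "AE \<xi> in lborel. integrable lborel (\<lambda>\<eta>. case (\<xi>, \<eta>) of (\<xi>, \<eta>) \<Rightarrow> ?k \<xi> \<eta>)"
        using ihint by simp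
    qed measurable
    have "(LINT \<xi>|lborel. B \<xi> * \<psi> t \<xi>) = (LINT \<xi>|lborel. LINT \<eta>|lborel. ?k \<xi> \<eta>)"
      by (simp add: avg)
    also have "\<dots> = (LINT \<eta>|lborel. LINT \<xi>|lborel. ?k \<xi> \<eta>)"
      using lborel_pair.Fubini_integral[OF int] by simp
    also have "\<dots> = (LINT \<eta>|lborel. indicator (box a b) \<eta> * (LINT \<xi>|lborel. B \<xi> * complex_of_real (heat_kernel t (\<xi> - \<eta>))))"
      by (simp add: heat_kernel_minus[of t "_ :: real^'n" "_ :: real^'n"] mult.left_commute[of _ "indicator (box a b) _"])
    also have "\<dots> = 0" by (simp add: fourier_zero_imp_heat_average_zero[OF B zero t])
    finally show ?thesis .
  qed
  have t0: "(\<lambda>k. sqrt (1 / real (Suc k))) \<longlonglongrightarrow> sqrt 0"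
    by (intro tendsto_real_sqrt LIMSEQ_Suc[OF lim_1_over_n])
  have "AE \<xi> in lborel. \<xi> \<notin> cbox a b - box a b"
    by (intro AE_not_in null_sets_cbox_Diff_box)
  then have lim: "AE \<xi> in lborel. (\<lambda>k. \<psi> (1 / real (Suc k)) \<xi>) \<longlonglongrightarrow> indicator (box a b) \<xi>"
  proof eventually_elim
    case (elim \<xi>)
    have "(\<lambda>k. indicator (box a b) (\<xi> + sqrt (1 / real (Suc k)) *\<^sub>R z) :: complex) \<longlonglongrightarrow> indicator (box a b) \<xi>" for z
    proof -
      have "(\<lambda>k. \<xi> + sqrt (1 / real (Suc k)) *\<^sub>R z) \<longlonglongrightarrow> \<xi> + sqrt 0 *\<^sub>R z" by (intro tendsto_intros t0)
      then have L: "(\<lambda>k. \<xi> + sqrt (1 / real (Suc k)) *\<^sub>R z) \<longlonglongrightarrow> \<xi>" by simp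
      show ?thesis
      proof (cases "\<xi> \<in> box a b")
        case True
        have "\<forall>\<^sub>F k in sequentially. \<xi> + sqrt (1 / real (Suc k)) *\<^sub>R z \<in> box a b"
          using topological_tendstoD[OF L open_box True] .
        then show ?thesis by (intro tendsto_eventually, elim eventually_mono) (use True in simp)
      next
        case False
        have "\<forall>\<^sub>F k in sequentially. \<xi> + sqrt (1 / real (Suc k)) *\<^sub>R z \<in> - cbox a b"
          using topological_tendstoD[OF L open_Compl[OF closed_cbox]] False elim by auto
        then show ?thesis
          by (intro tendsto_eventually, elim eventually_mono) (use False box_subset_cbox[of a b] in \<open>auto simp: indicator_def\<close>)
      qed
    qed
    then have "(\<lambda>k. \<psi> (1 / real (Suc k)) \<xi>) \<longlonglongrightarrow> (LINT z|lborel. indicator (box a b) \<xi> * complex_of_real (gaussian 1 (z::real^'n)))"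
      unfolding \<psi>_def
      by (intro integral_dominated_convergence[where w = "gaussian 1"] AE_I2 norm_le gint tendsto_mult tendsto_const) measurable
    also have "(LINT z|lborel. indicator (box a b) \<xi> * complex_of_real (gaussian 1 (z::real^'n))) = indicator (box a b) \<xi>"
      using integral_gaussian[where 'n='n] by simp
    finally show ?case .
  qed
  have "(\<lambda>k. LINT \<xi>|lborel. B \<xi> * \<psi> (1 / real (Suc k)) \<xi>) \<longlonglongrightarrow> (LINT \<xi>|lborel. B \<xi> * indicator (box a b) \<xi>)"
  proof (rule integral_dominated_convergence[where w = "\<lambda>\<xi>. norm (B \<xi>)"])
    show "AE \<xi> in lborel. (\<lambda>k. B \<xi> * \<psi> (1 / real (Suc k)) \<xi>) \<longlonglongrightarrow> B \<xi> * indicator (box a b) \<xi>"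
      using lim by eventually_elim (intro tendsto_mult tendsto_const)
    show "AE \<xi> in lborel. norm (B \<xi> * \<psi> (1 / real (Suc k)) \<xi>) \<le> norm (B \<xi>)" for k
      using \<psi>1 by (auto simp: norm_mult intro!: mult_left_le)
    show "integrable lborel (\<lambda>\<xi>. norm (B \<xi>))" using B by simp
  qed measurable
  moreover have "(LINT \<xi>|lborel. B \<xi> * \<psi> (1 / real (Suc k)) \<xi>) = 0" for k by (rule \<psi>_zero) simp
  ultimately show ?thesis by (simp add: LIMSEQ_const_iff)
qed

text \<open>
  The sets over which \<open>B\<close> integrates to 0 form a Dynkin system containing the boxes. The whole
  space belongs to it because the integral of \<open>B\<close> is \<open>fourier B 0\<close>.
\<close>

theorem fourier_injective:
  fixes B :: "real^'n::finite \<Rightarrow> complex"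
  assumes B: "integrable lborel B" and zero: "\<And>y. fourier B y = 0"
  shows "AE x in lborel. B x = 0"
proof (rule sigma_finite_measure.density_zero[OF lborel.sigma_finite_measure_axioms B])
  have [measurable]: "B \<in> borel_measurable borel" using B borel_measurable_integrable by auto
  have total: "(LINT x|lborel. B x) = 0"
    using zero[of 0] by (simp add: fourier_lborel character_def)
  fix A :: "(real^'n) set" assume "A \<in> sets lborel"
  then have A: "A \<in> sigma_sets UNIV (range (\<lambda>(a, b). box a b :: (real^'n) set))" by (simp add: borel_eq_box)
  have stable: "Int_stable (range (\<lambda>(a, b). box a b :: (real^'n) set))" by (auto simp: Int_stable_def box_Int_box)
  have sub: "range (\<lambda>(a, b). box a b :: (real^'n) set) \<subseteq> Pow UNIV" by simp
  from stable sub A have "(LINT x:A|lborel. B x) = 0"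
  proof (induction rule: sigma_sets_induct_disjoint)
    case (basic A)
    have "indicator (box a b) x *\<^sub>R B x = B x * indicator (box a b) x" for a b x by (simp add: indicator_def)
    with basic show ?case using fourier_zero_imp_box_integral_zero[OF B zero]
      by (auto simp: set_lebesgue_integral_def)
  next
    case empty
    show ?case by (simp add: set_lebesgue_integral_def)
  next
    case (compl A)
    then have A: "A \<in> sets lborel" by (simp add: borel_eq_box)
    have "(LINT x|lborel. B x) = (LINT x:A|lborel. B x) + (LINT x:UNIV - A|lborel. B x)"
    proof -
      have i: "integrable lborel (\<lambda>x. indicator S x *\<^sub>R B x)" if "S \<in> sets lborel" for S
        using that B by (rule integrable_mult_indicator)
      have "(LINT x|lborel. B x) = (LINT x|lborel. indicator A x *\<^sub>R B x + indicator (UNIV - A) x *\<^sub>R B x)"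
        by (intro Bochner_Integration.integral_cong) (auto simp: indicator_def)
      then show ?thesis
        unfolding set_lebesgue_integral_def using A by (simp add: i)
    qed
    then show ?case using compl total by simp
  next
    case (union A)
    then have A: "A i \<in> sets lborel" for i by (auto simp: borel_eq_box)
    have "(LINT x:(\<Union>i. A i)|lborel. B x) = (\<Sum>i. (LINT x:(A i)|lborel. B x))"
      using A B union(1) by (intro lebesgue_integral_countable_add)
        (auto simp: set_integrable_def disjoint_family_on_def intro!: integrable_mult_indicator)
    then show ?case using union by simp
  qed
  then show "(LINT x:A|lborel. B x) = 0" .
qed

section \<open>Bounded functionals on Lebesgue spaces\<close>

abbreviation Lp_dual :: "real \<Rightarrow> (('a::euclidean_space \<Rightarrow> complex) \<Rightarrow> complex) set" where
  "Lp_dual p \<equiv> dual_space (Lp_space p) (Lp_norm p)"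

abbreviation Lp_dual_norm :: "real \<Rightarrow> (('a::euclidean_space \<Rightarrow> complex) \<Rightarrow> complex) \<Rightarrow> real" where
  "Lp_dual_norm p \<equiv> dual_norm (Lp_space p) (Lp_norm p)"

lemma dual_norm_bounds:
  assumes K: "\<And>f. f \<in> Lp_space p \<Longrightarrow> norm (e f) \<le> K * Lp_norm p f" and K0: "0 \<le> K"
  shows "0 \<le> Lp_dual_norm p e" "Lp_dual_norm p e \<le> K"
proof -
  have le: "norm (e f) \<le> K" if "f \<in> Lp_space p" "Lp_norm p f \<le> 1" for f
    using K[OF that(1)] mult_left_mono[OF that(2) K0] by simp
  have zero: "(\<lambda>x. 0) \<in> {f \<in> Lp_space p. Lp_norm p f \<le> 1}" by (simp add: zero_in_Lp_space Lp_norm_zero)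
  have bdd: "bdd_above ((\<lambda>f. norm (e f)) ` {f \<in> Lp_space p. Lp_norm p f \<le> 1})"
    using le by (intro bdd_aboveI2[of _ _ K]) auto
  show "0 \<le> Lp_dual_norm p e"
    unfolding dual_norm_def by (rule order_trans[OF norm_ge_zero cSUP_upper[OF zero bdd]])
  show "Lp_dual_norm p e \<le> K"
    unfolding dual_norm_def using zero le by (intro cSUP_least) blast+
qed

lemma dual_space_norm_le:
  assumes e: "e \<in> Lp_dual p" and p: "0 < p"
  shows "0 \<le> Lp_dual_norm p e"
    and "f \<in> Lp_space p \<Longrightarrow> norm (e f) \<le> Lp_dual_norm p e * Lp_norm p f"
proof -
  obtain C where C: "\<And>f. f \<in> Lp_space p \<Longrightarrow> norm (e f) \<le> C * Lp_norm p f"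
    using e unfolding dual_space_def by blast
  define K where "K = \<bar>C\<bar>"
  have K: "norm (e f) \<le> K * Lp_norm p f" if "f \<in> Lp_space p" for f
    using C[OF that] mult_right_mono[OF abs_ge_self Lp_norm_nonneg, of C p f] by (simp add: K_def)
  show "0 \<le> Lp_dual_norm p e"
    by (rule dual_norm_bounds(1)[OF K]) (auto simp: K_def)
  show "norm (e f) \<le> Lp_dual_norm p e * Lp_norm p f" if f: "f \<in> Lp_space p"
  proof (cases "Lp_norm p f = 0")
    case True
    then show ?thesis using K[OF f] by simp
  next
    case False
    define c where "c = complex_of_real (1 / Lp_norm p f)"
    have pos: "0 < Lp_norm p f" using False Lp_norm_nonneg[of p f] by simp
    have "Lp_norm p (\<lambda>x. c * f x) = 1"
      by (subst Lp_norm_scale) (use p pos in \<open>simp_all add: c_def norm_divide\<close>)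
    then have mem: "(\<lambda>x. c * f x) \<in> {f \<in> Lp_space p. Lp_norm p f \<le> 1}" using f by (simp add: Lp_space_scale)
    have "norm (e f) \<le> K" if "f \<in> Lp_space p" "Lp_norm p f \<le> 1" for f
      using K[OF that(1)] mult_left_mono[OF that(2), of K] by (simp add: K_def)
    then have bdd: "bdd_above ((\<lambda>f. norm (e f)) ` {f \<in> Lp_space p. Lp_norm p f \<le> 1})"
      by (intro bdd_aboveI2[of _ _ K]) auto
    have "e (\<lambda>x. c * f x) = c * e f" using e f by (simp add: dual_space_def)
    then have "norm c * norm (e f) \<le> Lp_dual_norm p e"
      using cSUP_upper[OF mem bdd] by (simp add: dual_norm_def norm_mult)
    then show ?thesis using pos by (simp add: c_def norm_divide field_simps)
  qed
qed

definition truncate :: "nat \<Rightarrow> ('a::euclidean_space \<Rightarrow> complex) \<Rightarrow> 'a \<Rightarrow> complex" where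
  "truncate n f x = indicator (ball 0 (real n)) x * f x"

lemma truncate_add: "truncate n (\<lambda>x. f x + g x) = (\<lambda>x. truncate n f x + truncate n g x)"
  by (simp add: truncate_def distrib_left fun_eq_iff)

lemma truncate_scale: "truncate n (\<lambda>x. c * f x) = (\<lambda>x. c * truncate n f x)"
  by (simp add: truncate_def fun_eq_iff)

lemma truncate_Lp:
  fixes f :: "'a::euclidean_space \<Rightarrow> complex"
  assumes p: "1 < p" and f: "f \<in> Lp_space p"
  shows "truncate n f \<in> Lp_space p" "Lp_norm p (truncate n f) \<le> Lp_norm p f"
    "integrable lebesgue (truncate n f)"
    "(\<lambda>n. Lp_norm p (\<lambda>x. truncate n f x - f x)) \<longlonglongrightarrow> 0"
proof -
  have q: "1 < p / (p - 1)" "1 / (p / (p - 1)) + 1 / p = 1" "0 < p" using p by (auto simp: field_simps)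
  have "ball (0::'a) (real n) \<in> sets lebesgue" for n by simp
  then have ind: "(\<lambda>x::'a. indicator (ball 0 (real n)) x :: complex) \<in> Lp_space s" if "0 < s" for s n
    using that emeasure_lborel_ball_finite[of "0::'a" "real n"] by (intro indicator_Lp) auto
  have m: "truncate n f \<in> borel_measurable lebesgue" for n
    unfolding truncate_def[abs_def]
    by (intro borel_measurable_times Lp_space_measurable[OF f] Lp_space_measurable[OF ind[of 1]]) simp
  have le: "norm (truncate n f x) \<le> norm (f x)" for n x
    by (simp add: truncate_def indicator_def)
  show "truncate n f \<in> Lp_space p" "Lp_norm p (truncate n f) \<le> Lp_norm p f"
    using Lp_space_dominated[OF f q(3) m[of n]] le by auto
  show "integrable lebesgue (truncate n f)"
    unfolding truncate_def[abs_def] using q p by (intro Holder(1)[OF q(1) p q(2)] ind f) auto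
  show "(\<lambda>n. Lp_norm p (\<lambda>x. truncate n f x - f x)) \<longlonglongrightarrow> 0"
  proof (rule Lp_dominated_convergence[OF q(3) m Lp_space_measurable[OF f] _ f])
    show "AE x in lebesgue. norm (truncate n f x) \<le> norm (f x)" for n using le by simp
    show "AE x in lebesgue. (\<lambda>n. truncate n f x) \<longlonglongrightarrow> f x"
    proof (intro AE_I2)
      fix x :: 'a
      obtain N where N: "norm x < real N" using reals_Archimedean2 by blast
      have "\<forall>\<^sub>F n in sequentially. truncate n f x = f x"
        by (rule eventually_sequentiallyI[of N]) (use N in \<open>auto simp: truncate_def indicator_def\<close>)
      then show "(\<lambda>n. truncate n f x) \<longlonglongrightarrow> f x" by (rule tendsto_eventually)
    qed
  qed
qed

text \<open>
  Functionals involving the Fourier integral are only defined on integrable functions. Truncation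
  to balls is linear and maps \<open>L\<^sup>p\<close> into \<open>L\<^sup>1 \<inter> L\<^sup>p\<close>, so \<open>e f = lim (\<lambda>n. l (truncate n f))\<close> is a linear
  extension by construction.
\<close>

lemma extend_bounded_functional:
  fixes l :: "('a::euclidean_space \<Rightarrow> complex) \<Rightarrow> complex"
  assumes p: "1 < p" and K0: "0 \<le> K"
    and l_add: "\<And>f g. f \<in> Lp_space p \<Longrightarrow> g \<in> Lp_space p \<Longrightarrow> integrable lebesgue f \<Longrightarrow> integrable lebesgue g \<Longrightarrow>
      l (\<lambda>x. f x + g x) = l f + l g"
    and l_scale: "\<And>c f. f \<in> Lp_space p \<Longrightarrow> integrable lebesgue f \<Longrightarrow> l (\<lambda>x. c * f x) = c * l f"
    and l_bound: "\<And>f. f \<in> Lp_space p \<Longrightarrow> integrable lebesgue f \<Longrightarrow> norm (l f) \<le> K * Lp_norm p f"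
  shows "\<exists>e\<in>Lp_dual p. (\<forall>f\<in>Lp_space p. norm (e f) \<le> K * Lp_norm p f) \<and>
    (\<forall>f\<in>Lp_space p. integrable lebesgue f \<longrightarrow> e f = l f)"
proof -
  have p1: "1 \<le> p" using p by simp
  note T = truncate_Lp[OF p]
  have l_diff: "l (\<lambda>x. f x - g x) = l f - l g"
    if "f \<in> Lp_space p" "g \<in> Lp_space p" "integrable lebesgue f" "integrable lebesgue g" for f g
    using l_add[OF that(1) Lp_space_scale[OF that(2), of "-1"] that(3)] l_scale[OF that(2,4), of "-1"] that by simp
  have l_close: "norm (l f - l g) \<le> K * Lp_norm p (\<lambda>x. f x - g x)"
    if "f \<in> Lp_space p" "g \<in> Lp_space p" "integrable lebesgue f" "integrable lebesgue g" for f g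
    using l_bound[OF Lp_space_diff(1)[OF p1 that(1,2)]] l_diff[OF that] that by simp
  define e where "e f = lim (\<lambda>n. l (truncate n f))" for f
  have conv: "(\<lambda>n. l (truncate n f)) \<longlonglongrightarrow> e f" if f: "f \<in> Lp_space p" for f
  proof -
    have "Cauchy (\<lambda>n. l (truncate n f))"
    proof (rule metric_CauchyI)
      fix \<epsilon> :: real assume "0 < \<epsilon>"
      \<comment> \<open>\<open>K + 1\<close> instead of \<open>K\<close>, since \<open>K\<close> may be 0.\<close>
      define \<delta> where "\<delta> = \<epsilon> / (2 * (K + 1))"
      have pos: "0 < \<delta>" using K0 \<open>0 < \<epsilon>\<close> by (simp add: \<delta>_def)
      have "\<delta> * (2 * (K + 1)) = \<epsilon>" using K0 by (simp add: \<delta>_def)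
      then have \<delta>: "K * (\<delta> + \<delta>) = \<epsilon> - 2 * \<delta>" by (simp add: algebra_simps)
      obtain N where N: "\<And>n. n \<ge> N \<Longrightarrow> Lp_norm p (\<lambda>x. truncate n f x - f x) < \<delta>"
        using order_tendstoD(2)[OF T(4)[OF f] pos] by (auto simp: eventually_sequentially)
      have "dist (l (truncate m f)) (l (truncate n f)) < \<epsilon>" if "m \<ge> N" "n \<ge> N" for m n
      proof -
        have "dist (l (truncate m f)) (l (truncate n f)) \<le> K * Lp_norm p (\<lambda>x. truncate m f x - truncate n f x)"
          unfolding dist_norm by (intro l_close T f)
        also have "Lp_norm p (\<lambda>x. truncate m f x - truncate n f x)
            \<le> Lp_norm p (\<lambda>x. truncate m f x - f x) + Lp_norm p (\<lambda>x. f x - truncate n f x)"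
          by (intro Lp_norm_triangle_diff p1 T f)
        also have "\<dots> \<le> \<delta> + \<delta>"
          using N[OF that(1)] N[OF that(2)] by (simp add: Lp_norm_minus_commute[of p f])
        also have "K * (\<delta> + \<delta>) < \<epsilon>" using \<delta> pos by simp
        finally show ?thesis using K0 by (simp add: mult_left_mono)
      qed
      then show "\<exists>N. \<forall>m\<ge>N. \<forall>n\<ge>N. dist (l (truncate m f)) (l (truncate n f)) < \<epsilon>" by blast
    qed
    then show ?thesis unfolding e_def by (simp add: Cauchy_convergent_iff convergent_LIMSEQ_iff)
  qed
  have e_add: "e (\<lambda>x. f x + g x) = e f + e g" if "f \<in> Lp_space p" "g \<in> Lp_space p" for f g
  proof (rule LIMSEQ_unique[OF conv])
    show "(\<lambda>x. f x + g x) \<in> Lp_space p" by (intro Lp_space_triangle p1 that)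
    show "(\<lambda>n. l (truncate n (\<lambda>x. f x + g x))) \<longlonglongrightarrow> e f + e g"
      unfolding truncate_add using tendsto_add[OF conv[OF that(1)] conv[OF that(2)]] by (simp add: l_add T that)
  qed
  have e_scale: "e (\<lambda>x. c * f x) = c * e f" if "f \<in> Lp_space p" for f c
  proof (rule LIMSEQ_unique[OF conv])
    show "(\<lambda>x. c * f x) \<in> Lp_space p" by (intro Lp_space_scale that)
    show "(\<lambda>n. l (truncate n (\<lambda>x. c * f x))) \<longlonglongrightarrow> c * e f"
      unfolding truncate_scale using tendsto_mult[OF tendsto_const conv[OF that], of c] by (simp add: l_scale T that)
  qed
  have e_bound: "norm (e f) \<le> K * Lp_norm p f" if f: "f \<in> Lp_space p" for f
  proof (rule LIMSEQ_le_const2[OF tendsto_norm[OF conv[OF f]]], intro exI allI impI)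
    fix n
    have "norm (l (truncate n f)) \<le> K * Lp_norm p (truncate n f)" by (intro l_bound T f)
    also have "\<dots> \<le> K * Lp_norm p f" by (intro mult_left_mono T f K0)
    finally show "norm (l (truncate n f)) \<le> K * Lp_norm p f" .
  qed
  have e_eq: "e f = l f" if f: "f \<in> Lp_space p" "integrable lebesgue f" for f
  proof (rule LIMSEQ_unique[OF conv[OF f(1)]])
    have "(\<lambda>n. l (truncate n f) - l f) \<longlonglongrightarrow> 0"
    proof (rule Lim_null_comparison[OF always_eventually[OF allI]])
      show "norm (l (truncate n f) - l f) \<le> K * Lp_norm p (\<lambda>x. truncate n f x - f x)" for n
        by (intro l_close T f)
      show "(\<lambda>n. K * Lp_norm p (\<lambda>x. truncate n f x - f x)) \<longlonglongrightarrow> 0"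
        by (rule tendsto_mult_right_zero[OF T(4)[OF f(1)]])
    qed
    then show "(\<lambda>n. l (truncate n f)) \<longlonglongrightarrow> l f" by (simp add: Lim_null[symmetric])
  qed
  have "e \<in> Lp_dual p"
    unfolding dual_space_def using e_add e_scale e_bound by (intro CollectI conjI exI[of _ K]) auto
  then show ?thesis using e_bound e_eq by blast
qed

section \<open>Series with summable norms\<close>

text \<open>
  The terms of the given series tend to 0, so eventually \<open>a k * b k \<le> 1\<close>, and then raising to a power
  \<open>r \<le> 1\<close> only increases the product.
\<close>

lemma summable_powr_imp_summable:
  fixes a b :: "nat \<Rightarrow> real"
  assumes r: "0 < r" "r \<le> 1" and a: "\<And>k. 0 \<le> a k" and b: "\<And>k. 0 \<le> b k"
    and sm: "summable (\<lambda>k. a k powr r * b k powr r)"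
  shows "summable (\<lambda>k. a k * b k)"
proof -
  have sm': "summable (\<lambda>k. (a k * b k) powr r)" using sm a b by (simp add: powr_mult)
  have "\<forall>\<^sub>F k in sequentially. (a k * b k) powr r < 1"
    using order_tendstoD(2)[OF summable_LIMSEQ_zero[OF sm'], of 1] by simp
  then have "\<forall>\<^sub>F k in sequentially. norm (a k * b k) \<le> (a k * b k) powr r"
  proof eventually_elim
    case (elim k)
    have ab: "0 \<le> a k * b k" using a b by simp
    have "a k * b k \<le> 1"
    proof (rule ccontr)
      assume "\<not> a k * b k \<le> 1"
      then have "1 \<le> (a k * b k) powr r" using r by (intro ge_one_powr_ge_zero) auto
      with elim show False by simp
    qed
    then have "(a k * b k) powr 1 \<le> (a k * b k) powr r" using r ab by (intro powr_mono') auto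
    then show ?case using ab by simp
  qed
  then show ?thesis by (rule summable_comparison_test_ev[OF _ sm'])
qed

lemma integrable_cong_AE_lebesgue:
  fixes f g :: "'a::euclidean_space \<Rightarrow> complex"
  assumes f: "integrable lebesgue f" and ae: "AE x in lebesgue. f x = g x"
  shows "integrable lebesgue g" "integral\<^sup>L lebesgue g = integral\<^sup>L lebesgue f"
proof -
  have g: "g \<in> borel_measurable lebesgue" by (rule borel_measurable_AE[OF borel_measurable_integrable[OF f] ae])
  show "integrable lebesgue g" by (rule integrable_cong_AE_imp[OF f g]) (use ae in auto)
  show "integral\<^sup>L lebesgue g = integral\<^sup>L lebesgue f"
    by (rule integral_cong_AE[OF g borel_measurable_integrable[OF f]]) (use ae in auto)
qed

lemma Lp_series_scaled:
  fixes g :: "nat \<Rightarrow> 'a::euclidean_space \<Rightarrow> complex"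
  assumes p: "1 \<le> p" and g: "\<And>k. g k \<in> Lp_space p" and sm: "summable (\<lambda>k. norm (c k) * Lp_norm p (g k))"
  shows "AE \<xi> in lebesgue. summable (\<lambda>k. norm (c k * g k \<xi>))"
    "(\<lambda>\<xi>. \<Sum>k. c k * g k \<xi>) \<in> Lp_space p"
    "(\<lambda>N. Lp_norm p (\<lambda>\<xi>. (\<Sum>k. c k * g k \<xi>) - (\<Sum>k<N. c k * g k \<xi>))) \<longlonglongrightarrow> 0"
proof -
  have "summable (\<lambda>k. Lp_norm p (\<lambda>\<xi>. c k * g k \<xi>))" using sm p by (simp add: Lp_norm_scale)
  note ser = Lp_series[OF p Lp_space_scale[OF g] this]
  show "AE \<xi> in lebesgue. summable (\<lambda>k. norm (c k * g k \<xi>))"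
    "(\<lambda>\<xi>. \<Sum>k. c k * g k \<xi>) \<in> Lp_space p"
    "(\<lambda>N. Lp_norm p (\<lambda>\<xi>. (\<Sum>k. c k * g k \<xi>) - (\<Sum>k<N. c k * g k \<xi>))) \<longlonglongrightarrow> 0"
    using ser by auto
qed

text \<open>
  By Hoelder's inequality, convergence in \<open>L\<^sup>p\<close> allows the series to be integrated term by term
  against a fixed function in \<open>L\<^sup>q\<close>.
\<close>

lemma series_pairing:
  fixes g :: "nat \<Rightarrow> 'a::euclidean_space \<Rightarrow> complex"
  assumes pq: "1 < p" "1 < q" "1 / p + 1 / q = 1"
    and g: "\<And>k. g k \<in> Lp_space p" and sm: "summable (\<lambda>k. norm (c k) * Lp_norm p (g k))" and F: "F \<in> Lp_space q"
  shows "integrable lebesgue (\<lambda>\<xi>. (\<Sum>k. c k * g k \<xi>) * F \<xi>)"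
    and "(\<lambda>k. c k * (LINT \<xi>|lebesgue. g k \<xi> * F \<xi>)) sums (LINT \<xi>|lebesgue. (\<Sum>k. c k * g k \<xi>) * F \<xi>)"
proof -
  have p: "1 \<le> p" using pq by simp
  note ser = Lp_series_scaled[OF p g sm]
  let ?I = "\<lambda>k. LINT \<xi>|lebesgue. g k \<xi> * F \<xi>"
  let ?P = "\<lambda>N \<xi>. \<Sum>k<N. c k * g k \<xi>"
  let ?S = "\<lambda>\<xi>. \<Sum>k. c k * g k \<xi>"
  show i: "integrable lebesgue (\<lambda>\<xi>. ?S \<xi> * F \<xi>)"
    by (rule Holder(1)[OF pq ser(2) F])
  have gi: "integrable lebesgue (\<lambda>\<xi>. g k \<xi> * F \<xi>)" for k by (rule Holder(1)[OF pq g F])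
  have part: "(\<lambda>\<xi>. \<Sum>k<N. c k * g k \<xi>) \<in> Lp_space p" for N
    using Lp_space_sum[OF p, of "{..<N}" "\<lambda>k \<xi>. c k * g k \<xi>"] Lp_space_scale[OF g] by simp
  have "(\<lambda>N. (\<Sum>k<N. c k * ?I k) - (LINT \<xi>|lebesgue. ?S \<xi> * F \<xi>)) \<longlonglongrightarrow> 0"
  proof (rule Lim_null_comparison[OF always_eventually[OF allI]])
    fix N
    have "(\<Sum>k<N. c k * ?I k) = (LINT \<xi>|lebesgue. ?P N \<xi> * F \<xi>)"
      using gi by (simp add: sum_distrib_right mult.assoc)
    also have "\<dots> - (LINT \<xi>|lebesgue. ?S \<xi> * F \<xi>) = (LINT \<xi>|lebesgue. (?P N \<xi> - ?S \<xi>) * F \<xi>)"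
      using i Holder(1)[OF pq part F] by (simp add: left_diff_distrib)
    also have "norm \<dots> \<le> (LINT \<xi>|lebesgue. norm ((?P N \<xi> - ?S \<xi>) * F \<xi>))"
      by (rule integral_norm_bound)
    also have "\<dots> \<le> Lp_norm p (\<lambda>\<xi>. ?P N \<xi> - ?S \<xi>) * Lp_norm q F"
      by (intro Holder(2)[OF pq] Lp_space_diff p part ser F)
    also have "\<dots> = Lp_norm p (\<lambda>\<xi>. ?S \<xi> - ?P N \<xi>) * Lp_norm q F"
      by (subst Lp_norm_minus_commute) simp
    finally show "norm ((\<Sum>k<N. c k * ?I k) - (LINT \<xi>|lebesgue. ?S \<xi> * F \<xi>))
      \<le> Lp_norm p (\<lambda>\<xi>. ?S \<xi> - ?P N \<xi>) * Lp_norm q F" .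
  next
    show "(\<lambda>N. Lp_norm p (\<lambda>\<xi>. ?S \<xi> - ?P N \<xi>) * Lp_norm q F) \<longlonglongrightarrow> 0"
      by (rule tendsto_mult_left_zero[OF ser(3)])
  qed
  then show "(\<lambda>k. c k * ?I k) sums (LINT \<xi>|lebesgue. ?S \<xi> * F \<xi>)"
    unfolding sums_def by (simp add: Lim_null[symmetric])
qed

text \<open>
  Applied with \<open>N k = \<parallel>g k\<parallel>\<close>: for almost every \<open>x\<close> the coefficients \<open>h k x\<close> are admissible in
  \<open>series_pairing\<close>.
\<close>

lemma AE_summable_coefficients:
  fixes h :: "nat \<Rightarrow> 'a::euclidean_space \<Rightarrow> complex" and N :: "nat \<Rightarrow> real"
  assumes p: "1 \<le> p" and h: "\<And>k. h k \<in> Lp_space p" and N: "\<And>k. 0 \<le> N k" and sm: "summable (\<lambda>k. N k * Lp_norm p (h k))"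
  shows "AE x in lebesgue. summable (\<lambda>k. norm (h k x) * N k)"
  using Lp_series_scaled(1)[OF p h, of "\<lambda>k. complex_of_real (N k)"] sm N
  by (simp add: norm_mult mult.commute)

section \<open>Almost everywhere statements on products\<close>

lemma AE_lebesgue_sections:
  assumes "AE z in (lebesgue :: ('a::euclidean_space \<times> 'b::euclidean_space) measure). P z"
  shows "AE x in lebesgue. AE y in lebesgue. P (x, y)"
proof -
  have "AE z in (lborel \<Otimes>\<^sub>M lborel :: ('a \<times> 'b) measure). P z"
    using assms unfolding lborel_prod by (simp add: AE_completion_iff)
  from lborel_pair.AE_pair[OF this] show ?thesis by (simp add: AE_completion_iff)
qed

text \<open>
  Measurability of \<open>P\<close> is essential: a set all of whose sections are null need not be measurable.
\<close>

lemma AE_lebesgue_pairI: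
  assumes "Measurable.pred (borel :: ('a::euclidean_space \<times> 'b::euclidean_space) measure) P"
    and "AE x in lebesgue. AE y in lebesgue. P (x, y)"
  shows "AE z in lebesgue. P z"
proof -
  have "AE z in (lborel \<Otimes>\<^sub>M lborel :: ('a \<times> 'b) measure). P z"
  proof (rule lborel_pair.AE_pair_measure)
    have "{z. P z} \<in> sets (borel :: ('a \<times> 'b) measure)" using assms(1) by (simp add: pred_def)
    then show "{x \<in> space (lborel \<Otimes>\<^sub>M lborel). P x} \<in> sets (lborel \<Otimes>\<^sub>M lborel :: ('a \<times> 'b) measure)"
      unfolding lborel_prod by simp
    show "AE x in lborel. AE y in lborel. P (x, y)" using assms(2) by (simp add: AE_completion_iff)
  qed
  then show ?thesis unfolding lborel_prod by (simp add: AE_completion_iff)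
qed

lemma AE_lebesgue_fst_snd:
  fixes P :: "'a::euclidean_space \<Rightarrow> bool" and Q :: "'b::euclidean_space \<Rightarrow> bool"
  assumes P: "AE x in lebesgue. P x" and Q: "AE y in lebesgue. Q y"
  shows "AE z in (lebesgue :: ('a \<times> 'b) measure). P (fst z) \<and> Q (snd z)"
proof -
  obtain N where N: "N \<in> null_sets lborel" "{x. \<not> P x} \<subseteq> N"
    using P unfolding AE_completion_iff by (auto simp: eventually_ae_filter)
  obtain M where M: "M \<in> null_sets lborel" "{x. \<not> Q x} \<subseteq> M"
    using Q unfolding AE_completion_iff by (auto simp: eventually_ae_filter)
  have [measurable]: "N \<in> sets borel" "M \<in> sets borel" using N M by (auto simp: null_sets_def)
  have "AE z in (lebesgue :: ('a \<times> 'b) measure). fst z \<notin> N \<and> snd z \<notin> M"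
  proof (rule AE_lebesgue_pairI)
    have "(\<lambda>z::'a \<times> 'b. fst z) \<in> borel_measurable borel" "(\<lambda>z::'a \<times> 'b. snd z) \<in> borel_measurable borel"
      by (auto intro!: borel_measurable_continuous_onI continuous_intros)
    then show "Measurable.pred borel (\<lambda>z::'a \<times> 'b. fst z \<notin> N \<and> snd z \<notin> M)" by measurable
    show "AE x in lebesgue. AE y in lebesgue. fst (x::'a, y::'b) \<notin> N \<and> snd (x, y) \<notin> M"
      using AE_not_in[OF N(1)] AE_not_in[OF M(1)] by (auto simp: AE_completion_iff elim: eventually_mono)
  qed
  then show ?thesis by (rule eventually_mono) (use N M in auto)
qed

section \<open>From the symbol to the operator\<close>

lemma conjugate_exponent:
  fixes p :: real
  assumes "1 < p"
  shows "1 < p / (p - 1)" "1 / p + 1 / (p / (p - 1)) = 1"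
  using assms by (auto simp: field_simps)

lemma FIO_scale: "FIO \<phi> a (\<lambda>x. c * f x) x = c * FIO \<phi> a f x"
proof -
  have "FIO_integrand \<phi> a (\<lambda>x. c * f x) x = (\<lambda>\<xi>. c * FIO_integrand \<phi> a f x \<xi>)"
    by (simp add: FIO_integrand_def fourier_scale fun_eq_iff)
  then show ?thesis by (simp add: FIO_def)
qed

lemma FIO_add:
  fixes f g :: "real^'n::finite \<Rightarrow> complex"
  assumes "integrable lebesgue f" "integrable lebesgue g"
    and "integrable lebesgue (FIO_integrand \<phi> a f x)" "integrable lebesgue (FIO_integrand \<phi> a g x)"
  shows "FIO \<phi> a (\<lambda>x. f x + g x) x = FIO \<phi> a f x + FIO \<phi> a g x"
proof -
  have "FIO_integrand \<phi> a (\<lambda>x. f x + g x) x = (\<lambda>\<xi>. FIO_integrand \<phi> a f x \<xi> + FIO_integrand \<phi> a g x \<xi>)"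
    using assms by (simp add: FIO_integrand_def fourier_add distrib_left fun_eq_iff)
  then show ?thesis using assms by (simp add: FIO_def)
qed

lemma schwartz_integrable:
  fixes f :: "real^'n::finite \<Rightarrow> complex"
  assumes "f \<in> schwartz_space"
  shows "integrable lebesgue f"
proof -
  have "f \<in> Lp_space 1" using assms by (intro schwartz_Lp) auto
  then have "f \<in> borel_measurable lebesgue" "integrable lebesgue (\<lambda>x. norm (f x))" by (auto simp: Lp_space_def)
  then show ?thesis by (simp add: integrable_norm_iff)
qed

text \<open>
  The functionals are \<open>e k f = \<integral> g k * fourier f\<close>, extended from \<open>L\<^sup>1 \<inter> L\<^sup>p\<^sup>1\<close> to \<open>L\<^sup>p\<^sup>1\<close>. For almost
  every \<open>x\<close>, integrating the series of the kernel term by term against \<open>fourier f\<close> gives absolute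
  convergence of the operator's integral together with \<open>FIO \<phi> a f x = (\<Sum>k. e k f * h k x)\<close>.
\<close>

lemma decomposition_imp_nuclear:
  fixes \<phi> :: "real^'n::finite \<Rightarrow> real^'n \<Rightarrow> real"
  assumes r: "0 < r" "r \<le> 1" and p1: "1 < p1" "p1 \<le> 2" and p2: "1 \<le> p2"
    and D: "symbol_decomposition r p1 p2 \<phi> a"
  shows "FIO_r_nuclear r p1 p2 \<phi> a"
proof -
  define q where "q = p1 / (p1 - 1)"
  have q: "1 < q" "1 / p1 + 1 / q = 1" unfolding q_def using conjugate_exponent[OF p1(1)] by auto
  have p1': "1 \<le> p1" "0 < p1" and p2': "0 < p2" using p1 p2 by auto
  obtain g h where g: "\<And>k. g k \<in> Lp_space p1" and h: "\<And>k. h k \<in> Lp_space p2"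
    and sm: "summable (\<lambda>k. Lp_norm p1 (g k) powr r * Lp_norm p2 (h k) powr r)"
    and ae: "AE (x, \<xi>) in lebesgue. summable (\<lambda>k. h k x * g k \<xi>) \<and>
       a x \<xi> = 1 / exp (\<i> * of_real (\<phi> x \<xi>)) * (\<Sum>k. h k x * g k \<xi>)"
    using D unfolding symbol_decomposition_def by blast
  obtain C where C0: "0 \<le> C" and HY: "\<And>f :: real^'n \<Rightarrow> complex. integrable lebesgue f \<Longrightarrow> f \<in> Lp_space p1 \<Longrightarrow>
      fourier f \<in> Lp_space q \<and> Lp_norm q (fourier f) \<le> C * Lp_norm p1 f"
    using Hausdorff_Young[OF p1 q(2), where 'n='n] by blast
  have sm1: "summable (\<lambda>k. Lp_norm p1 (g k) * Lp_norm p2 (h k))"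
    by (rule summable_powr_imp_summable[OF r _ _ sm]) (simp_all add: Lp_norm_nonneg)
  let ?l = "\<lambda>k f. LINT \<xi>|lebesgue. g k \<xi> * fourier f \<xi>"
  have "\<exists>e\<in>Lp_dual p1.
      (\<forall>f\<in>Lp_space p1. norm (e f) \<le> C * Lp_norm p1 (g k) * Lp_norm p1 f) \<and>
      (\<forall>f\<in>Lp_space p1. integrable lebesgue f \<longrightarrow> e f = (?l k f))" for k
  proof (rule extend_bounded_functional[OF p1(1)])
    show "0 \<le> C * Lp_norm p1 (g k)" by (intro mult_nonneg_nonneg C0 Lp_norm_nonneg)
    have I: "integrable lebesgue (\<lambda>\<xi>. g k \<xi> * fourier f \<xi>)" if "f \<in> Lp_space p1" "integrable lebesgue f" for f
      using HY[OF that(2,1)] by (intro Holder(1)[OF p1(1) q g]) auto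
    show "(?l k (\<lambda>x. f x + f' x))
        = (?l k f) + (?l k f')"
      if "f \<in> Lp_space p1" "f' \<in> Lp_space p1" "integrable lebesgue f" "integrable lebesgue f'" for f f'
      using that I by (simp add: fourier_add distrib_left)
    show "(?l k (\<lambda>x. c * f x)) = c * (?l k f)"
      if "f \<in> Lp_space p1" "integrable lebesgue f" for c f
      by (simp add: fourier_scale mult.left_commute[of _ c])
    show "norm (?l k f) \<le> C * Lp_norm p1 (g k) * Lp_norm p1 f"
      if "f \<in> Lp_space p1" "integrable lebesgue f" for f
    proof -
      have "norm (?l k f) \<le> (LINT \<xi>|lebesgue. norm (g k \<xi> * fourier f \<xi>))"
        by (rule integral_norm_bound)
      also have "\<dots> \<le> Lp_norm p1 (g k) * Lp_norm q (fourier f)"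
        using HY[OF that(2,1)] by (intro Holder(2)[OF p1(1) q g]) auto
      also have "\<dots> \<le> Lp_norm p1 (g k) * (C * Lp_norm p1 f)"
        using HY[OF that(2,1)] by (intro mult_left_mono Lp_norm_nonneg) auto
      finally show ?thesis by (simp add: mult_ac)
    qed
  qed
  then have "\<forall>k. \<exists>e. e \<in> Lp_dual p1 \<and>
      (\<forall>f\<in>Lp_space p1. norm (e f) \<le> C * Lp_norm p1 (g k) * Lp_norm p1 f) \<and>
      (\<forall>f\<in>Lp_space p1. integrable lebesgue f \<longrightarrow> e f = (?l k f))"
    unfolding Bex_def by (intro allI)
  from choice[OF this] obtain e where eP: "\<forall>k. e k \<in> Lp_dual p1 \<and>
      (\<forall>f\<in>Lp_space p1. norm (e k f) \<le> C * Lp_norm p1 (g k) * Lp_norm p1 f) \<and>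
      (\<forall>f\<in>Lp_space p1. integrable lebesgue f \<longrightarrow> e k f = (?l k f))" ..
  have e: "e k \<in> Lp_dual p1" for k
    using eP by blast
  have e_bound: "norm (e k f) \<le> C * Lp_norm p1 (g k) * Lp_norm p1 f" if "f \<in> Lp_space p1" for k f
    using eP that by blast
  have e_eq: "e k f = (?l k f)" if "f \<in> Lp_space p1" "integrable lebesgue f" for k f
    using eP that by blast
  have SL: "f \<in> Lp_space p1" "integrable lebesgue f" if "f \<in> schwartz_space" for f :: "real^'n \<Rightarrow> complex"
    using that schwartz_Lp[OF _ p1'(1)] schwartz_integrable by auto
  have good: "AE x in lebesgue. summable (\<lambda>k. norm (h k x) * Lp_norm p1 (g k))"
    using sm1 by (intro AE_summable_coefficients[OF p2 h]) (auto simp: Lp_norm_nonneg)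
  have kernel: "AE x in lebesgue. integrable lebesgue (FIO_integrand \<phi> a f x) \<and> (\<lambda>k. e k f * h k x) sums FIO \<phi> a f x"
    if f: "f \<in> schwartz_space" for f
    using good AE_lebesgue_sections[OF ae]
  proof eventually_elim
    case (elim x)
    have F: "fourier f \<in> Lp_space q" using HY SL[OF f] by blast
    note P = series_pairing[OF p1(1) q g elim(1) F]
    have eq: "AE \<xi> in lebesgue. (\<Sum>k. h k x * g k \<xi>) * fourier f \<xi> = FIO_integrand \<phi> a f x \<xi>"
      using elim(2)
    proof eventually_elim
      case (elim \<xi>)
      then have "exp (\<i> * of_real (\<phi> x \<xi>)) * a x \<xi> = (\<Sum>k. h k x * g k \<xi>)" by simp
      then show ?case by (simp only: FIO_integrand_def)
    qed
    have "(\<lambda>k. h k x * e k f) sums FIO \<phi> a f x"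
      using P(2) integrable_cong_AE_lebesgue(2)[OF P(1) eq] by (simp add: e_eq SL f FIO_def)
    then show ?case using integrable_cong_AE_lebesgue(1)[OF P(1) eq] by (simp add: mult.commute)
  qed
  have coeff: "summable (\<lambda>k. norm (e k f) * Lp_norm p2 (h k))" if f: "f \<in> schwartz_space" for f
  proof (rule summable_comparison_test'[where N = 0])
    show "summable (\<lambda>k. C * Lp_norm p1 f * (Lp_norm p1 (g k) * Lp_norm p2 (h k)))" by (intro summable_mult sm1)
    fix k
    have "norm (e k f) * Lp_norm p2 (h k) \<le> C * Lp_norm p1 (g k) * Lp_norm p1 f * Lp_norm p2 (h k)"
      by (intro mult_right_mono e_bound SL f Lp_norm_nonneg)
    then show "norm (norm (e k f) * Lp_norm p2 (h k)) \<le> C * Lp_norm p1 f * (Lp_norm p1 (g k) * Lp_norm p2 (h k))"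
      by (simp add: mult_ac Lp_norm_nonneg abs_mult)
  qed
  have FIO_eq: "AE x in lebesgue. FIO \<phi> a f x = (\<Sum>k. e k f * h k x)" if f: "f \<in> schwartz_space" for f
    using kernel[OF f] by eventually_elim (auto simp: sums_iff)
  have T: "FIO \<phi> a f \<in> Lp_space p2" if f: "f \<in> schwartz_space" for f
    by (rule Lp_space_cong_AE[OF Lp_series_scaled(2)[OF p2 h coeff[OF f]] p2' FIO_eq[OF f]])
  have conv: "(\<lambda>N. Lp_norm p2 (\<lambda>x. FIO \<phi> a f x - (\<Sum>k<N. e k f * h k x))) \<longlonglongrightarrow> 0" if f: "f \<in> schwartz_space" for f
  proof -
    have part: "(\<lambda>x. \<Sum>k<N. e k f * h k x) \<in> Lp_space p2" for N
      using Lp_space_sum[OF p2, of "{..<N}" "\<lambda>k x. e k f * h k x"] Lp_space_scale[OF h] by simp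
    have "Lp_norm p2 (\<lambda>x. FIO \<phi> a f x - (\<Sum>k<N. e k f * h k x)) = Lp_norm p2 (\<lambda>x. (\<Sum>k. e k f * h k x) - (\<Sum>k<N. e k f * h k x))" for N
      using FIO_eq[OF f]
      by (intro Lp_norm_cong_AE Lp_space_measurable[OF Lp_space_diff(1)[OF p2 T[OF f] part]]
          Lp_space_measurable[OF Lp_space_diff(1)[OF p2 Lp_series_scaled(2)[OF p2 h coeff[OF f]] part]]) auto
    then show ?thesis using Lp_series_scaled(3)[OF p2 h coeff[OF f]] by simp
  qed
  have zero: "(\<lambda>x. 0) \<in> (schwartz_space :: (real^'n \<Rightarrow> complex) set)"
    using schwartz_scale[OF flat_bump_schwartz[of 1 1 0], of 0] by simp
  have null: "Lp_norm p2 u = 0" if "u \<in> Lp_space p2" "AE x in lebesgue. u x = 0" for u :: "real^'n \<Rightarrow> complex"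
    using Lp_norm_eq_0_iff[OF that(1) p2'] that(2) by simp
  have dense: "\<exists>g\<in>schwartz_space. Lp_norm p1 (\<lambda>x. f x - g x) < \<epsilon>" if "f \<in> Lp_space p1" "0 < \<epsilon>" for f :: "real^'n \<Rightarrow> complex" and \<epsilon>
    using schwartz_dense[OF p1'(1) that(1)] that(2) by (auto simp: Lp_closure_def)
  have add: "Lp_norm p2 (\<lambda>y. FIO \<phi> a (\<lambda>x. f x + g x) y - (FIO \<phi> a f y + FIO \<phi> a g y)) = 0"
    if fg: "f \<in> schwartz_space" "g \<in> schwartz_space" for f g
  proof (rule null)
    show "(\<lambda>y. FIO \<phi> a (\<lambda>x. f x + g x) y - (FIO \<phi> a f y + FIO \<phi> a g y)) \<in> Lp_space p2"
      by (intro Lp_space_diff Lp_space_triangle p2 T schwartz_add fg)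
    show "AE y in lebesgue. FIO \<phi> a (\<lambda>x. f x + g x) y - (FIO \<phi> a f y + FIO \<phi> a g y) = 0"
      using kernel[OF fg(1)] kernel[OF fg(2)] by eventually_elim (simp add: FIO_add SL fg)
  qed
  have welldef: "FIO \<phi> a f = FIO \<phi> a g" if "f \<in> schwartz_space" "g \<in> schwartz_space" "Lp_norm p1 (\<lambda>x. f x - g x) = 0" for f g
  proof -
    have "AE x in lebesgue. f x - g x = 0"
      using Lp_norm_eq_0_iff[OF Lp_space_diff(1)[OF p1'(1)] p1'(2)] SL that by blast
    then have "fourier f = fourier g"
      by (intro fourier_cong_AE Lp_space_measurable[of _ p1] SL that) auto
    then show ?thesis by (simp add: FIO_def[abs_def] FIO_integrand_def[abs_def])
  qed
  have densely: "densely_defined_operator (Lp_space p1) (Lp_norm p1) (Lp_space p2) (Lp_norm p2) schwartz_space (FIO \<phi> a)"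
    unfolding densely_defined_operator_def
  proof (intro conjI ballI allI impI)
    show "(schwartz_space :: (real^'n \<Rightarrow> complex) set) \<subseteq> Lp_space p1" using SL(1) by blast
    show "Lp_norm p2 (\<lambda>y. FIO \<phi> a (\<lambda>x. c * f x) y - c * FIO \<phi> a f y) = 0" for c f
      by (simp add: FIO_scale Lp_norm_zero)
    show "Lp_norm p2 (\<lambda>y. FIO \<phi> a f y - FIO \<phi> a g y) = 0"
      if "f \<in> schwartz_space" "g \<in> schwartz_space" "Lp_norm p1 (\<lambda>x. f x - g x) = 0" for f g
      using welldef[OF that] by (simp add: Lp_norm_zero)
  qed (fact zero schwartz_add schwartz_scale dense T add | assumption)+
  have "summable (\<lambda>k. Lp_dual_norm p1 (e k) powr r * Lp_norm p2 (h k) powr r)"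
  proof (rule summable_comparison_test'[where N = 0])
    show "summable (\<lambda>k. C powr r * (Lp_norm p1 (g k) powr r * Lp_norm p2 (h k) powr r))" by (intro summable_mult sm)
    fix k
    have "Lp_dual_norm p1 (e k) powr r \<le> (C * Lp_norm p1 (g k)) powr r"
      using dual_norm_bounds[OF e_bound[of _ k]] C0 Lp_norm_nonneg[of p1 "g k"] r by (intro powr_mono2) auto
    then have "Lp_dual_norm p1 (e k) powr r \<le> C powr r * Lp_norm p1 (g k) powr r"
      using C0 Lp_norm_nonneg[of p1 "g k"] by (simp add: powr_mult)
    then show "norm (Lp_dual_norm p1 (e k) powr r * Lp_norm p2 (h k) powr r)
        \<le> C powr r * (Lp_norm p1 (g k) powr r * Lp_norm p2 (h k) powr r)"
      by (simp add: mult.assoc[symmetric] mult_right_mono)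
  qed
  then have "r_nuclear r (Lp_space p1) (Lp_norm p1) (Lp_space p2) (Lp_norm p2) schwartz_space (FIO \<phi> a)"
    unfolding r_nuclear_def using densely e h conv by (intro conjI exI[of _ e] exI[of _ h]) auto
  moreover have "\<forall>f\<in>schwartz_space. AE x in lebesgue. integrable lebesgue (FIO_integrand \<phi> a f x)"
    using kernel by (auto elim: eventually_mono)
  ultimately show ?thesis by (simp add: FIO_r_nuclear_def)
qed

section \<open>From the operator to the symbol\<close>

text \<open>
  Translating by \<open>y\<close> multiplies the transform by the character of \<open>y\<close>. Testing the kernel with all
  translates therefore amounts to computing the Fourier transform of the kernel times a Gaussian.
\<close>

definition test_function :: "real^'n::finite \<Rightarrow> real^'n \<Rightarrow> complex" where
  "test_function y x = complex_of_real (gaussian 1 (x - y))"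

lemma heat_kernel_1: "heat_kernel 1 x = gaussian 1 x"
  by (simp add: heat_kernel_def)

lemma test_function_schwartz: "test_function y \<in> schwartz_space"
proof -
  have "test_function y = flat_bump 1 y (\<chi> i. 1 / sqrt pi)"
  proof
    fix x
    have "((x $ i - y $ i) / (1 / sqrt pi)) ^ (2 * 1) = pi * (x $ i - y $ i)\<^sup>2" for i
      by (simp add: power_mult_distrib)
    then show "test_function y x = flat_bump 1 y (\<chi> i. 1 / sqrt pi) x"
      unfolding flat_bump_def test_function_def of_real_prod[symmetric]
      by (simp add: gaussian_def norm_square_cart exp_sum[symmetric] sum_distrib_left sum_negf)
  qed
  then show ?thesis by (simp add: flat_bump_schwartz)
qed

lemma fourier_test_function:
  fixes y :: "real^'n::finite"
  shows "fourier (test_function y) \<xi> = character y \<xi> * complex_of_real (gaussian 1 \<xi>)"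
proof -
  have "fourier (test_function y) \<xi> = (LINT x|lborel. character x \<xi> * complex_of_real (heat_kernel 1 (x - y)))"
    by (subst fourier_lborel) (simp_all add: test_function_def[abs_def] heat_kernel_1)
  also have "\<dots> = (LINT z|lborel. character (y + sqrt 1 *\<^sub>R z) \<xi> * complex_of_real (gaussian 1 z))"
    by (rule integral_heat_kernel_average) simp_all
  also have "\<dots> = (LINT z|lborel. character y \<xi> * (character z \<xi> * complex_of_real (gaussian 1 z)))"
    by (simp add: character_eq cis_mult inner_add_left algebra_simps)
  also have "\<dots> = character y \<xi> * fourier (\<lambda>z. complex_of_real (gaussian 1 z)) \<xi>"
    by (subst fourier_lborel) simp_all
  finally show ?thesis by (simp add: fourier_gaussian heat_kernel_1)
qed

text \<open>
  Conjugating before and after the transform gives the inverse transform. For these functions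
  Fourier inversion is an explicit computation.
\<close>

lemma inverse_fourier_test_function:
  "cnj (fourier (\<lambda>\<xi>. cnj (fourier (test_function y) \<xi>)) x) = test_function y x"
proof -
  have "(\<lambda>\<xi>. cnj (fourier (test_function y) \<xi>)) = (\<lambda>\<xi>. cnj (character \<xi> y) * complex_of_real (gaussian 1 \<xi>))"
    by (simp add: fourier_test_function character_commute[of y])
  then show ?thesis by (simp add: fourier_modulated_gaussian heat_kernel_1 test_function_def)
qed

text \<open>
  The functional \<open>v \<mapsto> e (inv v)\<close>, where \<open>inv\<close> is the inverse Fourier transform, is bounded on
  \<open>L\<^sup>1 \<inter> L\<^sup>2\<close>; its Riesz representative is \<open>g\<close>.
\<close>

lemma L2_functional_on_transforms:
  fixes e :: "(real^'n::finite \<Rightarrow> complex) \<Rightarrow> complex"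
  shows "\<exists>C\<ge>0. \<forall>e\<in>Lp_dual 2. \<exists>g\<in>Lp_space 2.
    Lp_norm 2 g \<le> C * Lp_dual_norm 2 e \<and>
    (\<forall>y::real^'n. e (test_function y) = (LINT \<xi>|lebesgue. g \<xi> * fourier (test_function y) \<xi>))"
proof -
  obtain C where C0: "0 \<le> C" and HY: "\<And>f :: real^'n \<Rightarrow> complex. integrable lebesgue f \<Longrightarrow> f \<in> Lp_space 2 \<Longrightarrow>
      fourier f \<in> Lp_space 2 \<and> Lp_norm 2 (fourier f) \<le> C * Lp_norm 2 f"
    using Hausdorff_Young[of 2 2, where 'n='n] by auto
  define inv where "inv v x = cnj (fourier (\<lambda>\<xi>. cnj (v \<xi>)) x)" for v :: "real^'n \<Rightarrow> complex" and x
  have norm_cnj: "Lp_norm 2 (\<lambda>x. cnj (u x)) = Lp_norm 2 u" for u :: "real^'n \<Rightarrow> complex" by (simp add: Lp_norm_def)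
  have inv: "inv v \<in> Lp_space 2 \<and> Lp_norm 2 (inv v) \<le> C * Lp_norm 2 v" if "integrable lebesgue v" "v \<in> Lp_space 2" for v
    using HY[of "\<lambda>\<xi>. cnj (v \<xi>)"] that Lp_space_cnj[of v 2] Lp_space_cnj[of "fourier (\<lambda>\<xi>. cnj (v \<xi>))" 2]
    by (simp add: inv_def[abs_def] norm_cnj)
  have inv_add: "inv (\<lambda>x. v x + w x) = (\<lambda>x. inv v x + inv w x)" if "integrable lebesgue v" "integrable lebesgue w" for v w
    using that by (simp add: inv_def fourier_add fun_eq_iff)
  have inv_scale: "inv (\<lambda>x. c * v x) = (\<lambda>x. c * inv v x)" for c v
    by (simp add: inv_def fourier_scale fun_eq_iff)
  define V where "V = {v :: real^'n \<Rightarrow> complex. v \<in> Lp_space 2 \<and> integrable lebesgue v}"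
  have "\<exists>g\<in>Lp_space 2. Lp_norm 2 g \<le> 2 * C * Lp_dual_norm 2 e \<and>
    (\<forall>y::real^'n. e (test_function y) = (LINT \<xi>|lebesgue. g \<xi> * fourier (test_function y) \<xi>))"
    if e: "e \<in> Lp_dual 2" for e :: "(real^'n \<Rightarrow> complex) \<Rightarrow> complex"
  proof -
    let ?B = "Lp_dual_norm 2 e"
    note B = dual_space_norm_le[OF e, simplified]
    have "\<exists>u\<in>Lp_space 2. Lp_norm 2 u \<le> 2 * (?B * C) \<and> (\<forall>v\<in>V. e (inv v) = (LINT x|lebesgue. v x * u x))"
    proof (rule Riesz_representation_subspace)
      show "V \<subseteq> Lp_space 2" "(\<lambda>x. 0) \<in> V" by (auto simp: V_def zero_in_Lp_space)
      show "(\<lambda>x. f x + g x) \<in> V" if "f \<in> V" "g \<in> V" for f g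
        using that Lp_space_triangle[of 2 f g] by (simp add: V_def)
      show "(\<lambda>x. c * f x) \<in> V" if "f \<in> V" for c f
        using that Lp_space_scale[of f 2 c] by (simp add: V_def)
      show "e (inv (\<lambda>x. f x + g x)) = e (inv f) + e (inv g)" if "f \<in> V" "g \<in> V" for f g
        using that e inv[of f] inv[of g] by (simp add: V_def inv_add dual_space_def)
      show "e (inv (\<lambda>x. c * f x)) = c * e (inv f)" if "f \<in> V" for c f
        using that e inv[of f] by (simp add: V_def inv_scale dual_space_def)
      show "norm (e (inv f)) \<le> ?B * C * Lp_norm 2 f" if f: "f \<in> V" for f
      proof -
        have "norm (e (inv f)) \<le> ?B * Lp_norm 2 (inv f)" using f inv[of f] by (intro B(2)) (simp add: V_def)
        also have "\<dots> \<le> ?B * (C * Lp_norm 2 f)" using f inv[of f] by (intro mult_left_mono B(1)) (simp add: V_def)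
        finally show ?thesis by (simp add: mult.assoc)
      qed
      show "0 \<le> ?B * C" using B(1) C0 by simp
    qed
    then obtain g where g: "g \<in> Lp_space 2" "Lp_norm 2 g \<le> 2 * (?B * C)" "\<And>v. v \<in> V \<Longrightarrow> e (inv v) = (LINT x|lebesgue. v x * g x)" by blast
    have "e (test_function y) = (LINT \<xi>|lebesgue. g \<xi> * fourier (test_function y) \<xi>)" for y
    proof -
      have "fourier (test_function y) \<in> V"
      proof -
        have "integrable lborel (\<lambda>\<xi>. character \<xi> y * complex_of_real (gaussian 1 \<xi>))"
          by (intro integrable_character_lborel integrable_gaussian) simp
        then have "integrable lebesgue (fourier (test_function y))"
          using integrable_lebesgue_of_lborel by (simp add: fourier_test_function[abs_def] character_commute[of y])
        moreover have "fourier (test_function y) \<in> Lp_space 2"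
          using HY[OF schwartz_integrable schwartz_Lp, OF test_function_schwartz test_function_schwartz] by simp
        ultimately show ?thesis by (simp add: V_def)
      qed
      from g(3)[OF this] show ?thesis
        by (simp add: inv_def[abs_def] inverse_fourier_test_function mult.commute)
    qed
    then show ?thesis using g by (intro bexI[of _ g]) (auto simp: mult_ac)
  qed
  then show ?thesis using C0 by (intro exI[of _ "2 * C"]) auto
qed

lemma fourier_zero_on_dense:
  fixes B :: "real^'n::finite \<Rightarrow> complex"
  assumes B: "integrable lebesgue B" and Y: "\<And>X. open X \<Longrightarrow> X \<noteq> {} \<Longrightarrow> \<exists>d\<in>Y. d \<in> X"
    and zero: "\<And>y. y \<in> Y \<Longrightarrow> fourier B y = 0"
  shows "AE x in lebesgue. B x = 0"
proof -
  have all: "fourier B y = 0" for y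
  proof (rule ccontr)
    assume "fourier B y \<noteq> 0"
    moreover have "open {y. fourier B y \<noteq> 0}"
      by (intro open_Collect_neq fourier_continuous[OF B] continuous_on_const)
    ultimately show False using Y[of "{y. fourier B y \<noteq> 0}"] zero by auto
  qed
  obtain g where g: "g \<in> borel_measurable borel" and Bg: "AE x in lebesgue. B x = g x"
    using borel_representative[OF borel_measurable_integrable[OF B]] by blast
  have gm: "g \<in> borel_measurable lebesgue" by (rule measurable_completion) (use g in simp)
  have "fourier B = fourier g" by (intro fourier_cong_AE borel_measurable_integrable[OF B] gm Bg)
  then have "AE x in lborel. g x = 0"
    using fourier_injective[OF lebesgue_lborel_transfer[OF B g Bg]] all by simp
  then have "AE x in lebesgue. g x = 0" by (rule AE_completion)
  with Bg show ?thesis by eventually_elim simp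
qed

text \<open>
  Fix \<open>x\<close> outside a null set. The values \<open>FIO \<phi> a (test_function y) x\<close> can be computed from the
  symbol and from the nuclear series, for \<open>y\<close> in a countable dense set. Hence the product \<open>B\<close> of
  \<open>e\<^sup>i\<^sup>\<phi> a - K\<close> with the standard Gaussian has a Fourier transform that vanishes on this set. The
  Gaussian is what makes \<open>B\<close> integrable.
\<close>

lemma nuclear_imp_sections:
  fixes \<phi> :: "real^'n::finite \<Rightarrow> real^'n \<Rightarrow> real"
  assumes r: "0 < r" "r \<le> 1" and p2: "1 \<le> p2"
    and N: "FIO_r_nuclear r 2 p2 \<phi> a"
  shows "\<exists>g h. (\<forall>k. g k \<in> Lp_space 2) \<and> (\<forall>k. h k \<in> Lp_space p2) \<and>
    summable (\<lambda>k. Lp_norm 2 (g k) powr r * Lp_norm p2 (h k) powr r) \<and>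
    (AE x in lebesgue. AE \<xi> in lebesgue. summable (\<lambda>k. h k x * g k \<xi>) \<and>
       exp (\<i> * of_real (\<phi> x \<xi>)) * a x \<xi> = (\<Sum>k. h k x * g k \<xi>))"
proof -
  have p2': "0 < p2" using p2 by simp
  obtain e h where e: "\<And>k. e k \<in> Lp_dual 2" and h: "\<And>k. h k \<in> Lp_space p2"
    and conv: "\<And>f. f \<in> schwartz_space \<Longrightarrow> (\<lambda>N. Lp_norm p2 (\<lambda>x. FIO \<phi> a f x - (\<Sum>k<N. e k f * h k x))) \<longlonglongrightarrow> 0"
    and sm: "summable (\<lambda>k. Lp_dual_norm 2 (e k) powr r * Lp_norm p2 (h k) powr r)"
    and D: "densely_defined_operator (Lp_space 2) (Lp_norm 2) (Lp_space p2) (Lp_norm p2) schwartz_space (FIO \<phi> a)"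
    and int: "\<And>f. f \<in> schwartz_space \<Longrightarrow> AE x in lebesgue. integrable lebesgue (FIO_integrand \<phi> a f x)"
    using N unfolding FIO_r_nuclear_def r_nuclear_def by blast
  have T: "FIO \<phi> a f \<in> Lp_space p2" if "f \<in> schwartz_space" for f
    using D that by (simp add: densely_defined_operator_def)
  obtain C where C0: "0 \<le> C" and C: "\<forall>e\<in>Lp_dual 2. \<exists>g\<in>Lp_space 2.
    Lp_norm 2 g \<le> C * Lp_dual_norm 2 e \<and>
    (\<forall>y::real^'n. e (test_function y) = (LINT \<xi>|lebesgue. g \<xi> * fourier (test_function y) \<xi>))"
    using L2_functional_on_transforms by blast
  have "\<forall>k. \<exists>g. g \<in> Lp_space 2 \<and> Lp_norm 2 g \<le> C * Lp_dual_norm 2 (e k) \<and>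
    (\<forall>y::real^'n. e k (test_function y) = (LINT \<xi>|lebesgue. g \<xi> * fourier (test_function y) \<xi>))"
    using C e by blast
  from choice[OF this] obtain g where gP: "\<forall>k. g k \<in> Lp_space 2 \<and> Lp_norm 2 (g k) \<le> C * Lp_dual_norm 2 (e k) \<and>
    (\<forall>y::real^'n. e k (test_function y) = (LINT \<xi>|lebesgue. g k \<xi> * fourier (test_function y) \<xi>))" ..
  have g: "g k \<in> Lp_space 2" and g_norm: "Lp_norm 2 (g k) \<le> C * Lp_dual_norm 2 (e k)"
    and g_eq: "e k (test_function y) = (LINT \<xi>|lebesgue. g k \<xi> * fourier (test_function y) \<xi>)" for k y
    using gP by blast+
  note B0 = dual_space_norm_le(1)[OF e, simplified]
  have gsm: "summable (\<lambda>k. Lp_norm 2 (g k) powr r * Lp_norm p2 (h k) powr r)"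
  proof (rule summable_comparison_test'[where N = 0])
    show "summable (\<lambda>k. C powr r * (Lp_dual_norm 2 (e k) powr r * Lp_norm p2 (h k) powr r))" by (intro summable_mult sm)
    fix k
    have "Lp_norm 2 (g k) powr r \<le> (C * Lp_dual_norm 2 (e k)) powr r"
      using g_norm[of k] r by (intro powr_mono2 Lp_norm_nonneg) auto
    then have "Lp_norm 2 (g k) powr r \<le> C powr r * Lp_dual_norm 2 (e k) powr r"
      using C0 B0[of k] by (simp add: powr_mult)
    then show "norm (Lp_norm 2 (g k) powr r * Lp_norm p2 (h k) powr r)
      \<le> C powr r * (Lp_dual_norm 2 (e k) powr r * Lp_norm p2 (h k) powr r)"
      by (simp add: mult.assoc[symmetric] mult_right_mono)
  qed
  have sm1: "summable (\<lambda>k. Lp_norm 2 (g k) * Lp_norm p2 (h k))"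
    by (rule summable_powr_imp_summable[OF r _ _ gsm]) (simp_all add: Lp_norm_nonneg)
  have sm2: "summable (\<lambda>k. Lp_dual_norm 2 (e k) * Lp_norm p2 (h k))"
    by (rule summable_powr_imp_summable[OF r _ _ sm]) (simp_all add: Lp_norm_nonneg B0)
  have good: "AE x in lebesgue. summable (\<lambda>k. norm (h k x) * Lp_norm 2 (g k))"
    using sm1 by (intro AE_summable_coefficients[OF p2 h]) (auto simp: Lp_norm_nonneg)
  have vals: "AE x in lebesgue. integrable lebesgue (FIO_integrand \<phi> a (test_function y) x) \<and>
      FIO \<phi> a (test_function y) x = (\<Sum>k. e k (test_function y) * h k x)" for y
  proof -
    let ?f = "test_function y"
    have f: "?f \<in> Lp_space 2" by (intro schwartz_Lp test_function_schwartz) simp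
    have "summable (\<lambda>k. norm (e k ?f) * Lp_norm p2 (h k))"
    proof (rule summable_comparison_test'[where N = 0])
      show "summable (\<lambda>k. Lp_norm 2 ?f * (Lp_dual_norm 2 (e k) * Lp_norm p2 (h k)))" by (intro summable_mult sm2)
      fix k
      have "norm (e k ?f) * Lp_norm p2 (h k) \<le> Lp_dual_norm 2 (e k) * Lp_norm 2 ?f * Lp_norm p2 (h k)"
        by (intro mult_right_mono dual_space_norm_le(2)[OF e] f Lp_norm_nonneg) simp
      then show "norm (norm (e k ?f) * Lp_norm p2 (h k)) \<le> Lp_norm 2 ?f * (Lp_dual_norm 2 (e k) * Lp_norm p2 (h k))"
        by (simp add: mult_ac Lp_norm_nonneg abs_mult)
    qed
    note ser = Lp_series_scaled[OF p2 h this]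
    let ?P = "\<lambda>N x. \<Sum>k<N. e k ?f * h k x"
    let ?S = "\<lambda>x. \<Sum>k. e k ?f * h k x"
    have Tf: "FIO \<phi> a ?f \<in> Lp_space p2" by (intro T test_function_schwartz)
    have part: "(\<lambda>x. ?P N x) \<in> Lp_space p2" for N
      using Lp_space_sum[OF p2, of "{..<N}" "\<lambda>k x. e k ?f * h k x"] Lp_space_scale[OF h] by simp
    have "Lp_norm p2 (\<lambda>x. FIO \<phi> a ?f x - ?S x) \<le> 0"
    proof (rule LIMSEQ_le_const)
      show "(\<lambda>N. Lp_norm p2 (\<lambda>x. FIO \<phi> a ?f x - ?P N x) + Lp_norm p2 (\<lambda>x. ?S x - ?P N x)) \<longlonglongrightarrow> 0"
        using tendsto_add[OF conv[OF test_function_schwartz] ser(3)] by simp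
      show "\<exists>N0. \<forall>N\<ge>N0. Lp_norm p2 (\<lambda>x. FIO \<phi> a ?f x - ?S x)
          \<le> Lp_norm p2 (\<lambda>x. FIO \<phi> a ?f x - ?P N x) + Lp_norm p2 (\<lambda>x. ?S x - ?P N x)"
      proof (intro exI allI impI)
        fix N
        show "Lp_norm p2 (\<lambda>x. FIO \<phi> a ?f x - ?S x)
          \<le> Lp_norm p2 (\<lambda>x. FIO \<phi> a ?f x - ?P N x) + Lp_norm p2 (\<lambda>x. ?S x - ?P N x)"
          using Lp_norm_triangle_diff[OF p2 Tf part[of N] ser(2)]
            Lp_norm_minus_commute[of p2 "\<lambda>x. ?P N x" ?S] by simp
      qed
    qed
    then have "Lp_norm p2 (\<lambda>x. FIO \<phi> a ?f x - ?S x) = 0"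
      by (rule antisym[OF _ Lp_norm_nonneg])
    then have "AE x in lebesgue. FIO \<phi> a ?f x - ?S x = 0"
      using Lp_norm_eq_0_iff[OF Lp_space_diff(1)[OF p2 Tf ser(2)] p2'] by simp
    with int[OF test_function_schwartz[of y]] show ?thesis by eventually_elim simp
  qed
  obtain Y0 :: "(real^'n) set" where Y0: "countable Y0" "\<And>X. open X \<Longrightarrow> X \<noteq> {} \<Longrightarrow> \<exists>d\<in>Y0. d \<in> X"
    by (erule countable_dense_setE)
  \<comment> \<open>The centre 0 is included because it yields the integrability of \<open>B\<close>.\<close>
  define Y where "Y = insert 0 Y0"
  have Y: "countable Y" "\<And>X. open X \<Longrightarrow> X \<noteq> {} \<Longrightarrow> \<exists>d\<in>Y. d \<in> X" using Y0 by (auto simp: Y_def)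
  have "AE x in lebesgue. \<forall>y\<in>Y. integrable lebesgue (FIO_integrand \<phi> a (test_function y) x) \<and>
      FIO \<phi> a (test_function y) x = (\<Sum>k. e k (test_function y) * h k x)"
    using vals by (subst AE_ball_countable[OF Y(1)]) auto
  with good have "AE x in lebesgue. AE \<xi> in lebesgue. summable (\<lambda>k. h k x * g k \<xi>) \<and>
       exp (\<i> * of_real (\<phi> x \<xi>)) * a x \<xi> = (\<Sum>k. h k x * g k \<xi>)"
  proof eventually_elim
    case (elim x)
    let ?K = "\<lambda>\<xi>. \<Sum>k. h k x * g k \<xi>"
    define B where "B \<xi> = (exp (\<i> * of_real (\<phi> x \<xi>)) * a x \<xi> - ?K \<xi>) * complex_of_real (gaussian 1 \<xi>)" for \<xi>
    have F: "fourier (test_function y) \<in> Lp_space 2" for y :: "real^'n"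
    proof -
      have "test_function y \<in> Lp_space 2" by (intro schwartz_Lp test_function_schwartz) simp
      then show ?thesis
        using Hausdorff_Young[of 2 2, where 'n='n] schwartz_integrable[OF test_function_schwartz[of y]] by auto
    qed
    have pair: "integrable lebesgue (\<lambda>\<xi>. ?K \<xi> * fourier (test_function y) \<xi>)"
      "(\<lambda>k. h k x * e k (test_function y)) sums (LINT \<xi>|lebesgue. ?K \<xi> * fourier (test_function y) \<xi>)" for y
      using series_pairing[of 2 2, OF _ _ _ g elim(1) F[of y]] by (simp_all add: g_eq)
    have B_char: "character \<xi> y * B \<xi> = FIO_integrand \<phi> a (test_function y) x \<xi> - ?K \<xi> * fourier (test_function y) \<xi>" for \<xi> y
      by (simp add: B_def FIO_integrand_def fourier_test_function character_commute[of y] algebra_simps)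
    have "integrable lebesgue (\<lambda>\<xi>. character \<xi> 0 * B \<xi>)"
      unfolding B_char using elim(2) pair(1)[of 0] by (intro Bochner_Integration.integrable_diff) (auto simp: Y_def)
    then have Bint: "integrable lebesgue B" by (simp add: character_def)
    have "fourier B y = 0" if "y \<in> Y" for y
    proof -
      have "fourier B y = FIO \<phi> a (test_function y) x - (LINT \<xi>|lebesgue. ?K \<xi> * fourier (test_function y) \<xi>)"
        unfolding fourier_character[of B] B_char FIO_def using elim(2) that pair(1)[of y] by simp
      also have "\<dots> = 0" using elim(2) that sums_unique[OF pair(2)[of y]] by (simp add: mult.commute)
      finally show ?thesis .
    qed
    then have "AE \<xi> in lebesgue. B \<xi> = 0" by (intro fourier_zero_on_dense[OF Bint Y(2)]) auto
    moreover have "AE \<xi> in lebesgue. summable (\<lambda>k. norm (h k x * g k \<xi>))"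
      by (intro Lp_series_scaled(1)[of 2] g elim(1)) simp
    ultimately show ?case
    proof eventually_elim
      case (elim \<xi>)
      then show ?case using gaussian_pos[of 1 \<xi>] by (auto simp: B_def intro: summable_norm_cancel)
    qed
  qed
  then show ?thesis using g h gsm by blast
qed

text \<open>
  Passing from sections to the product requires a measurable set, so \<open>g k\<close>, \<open>h k\<close> and the symbol are
  exchanged for Borel representatives and back.
\<close>

lemma nuclear_imp_decomposition:
  fixes \<phi> :: "real^'n::finite \<Rightarrow> real^'n \<Rightarrow> real" and a :: "real^'n \<Rightarrow> real^'n \<Rightarrow> complex"
  assumes r: "0 < r" "r \<le> 1" and p2: "1 \<le> p2"
    and \<phi>: "(\<lambda>(x, \<xi>). \<phi> x \<xi>) \<in> borel_measurable lebesgue" and a: "(\<lambda>(x, \<xi>). a x \<xi>) \<in> borel_measurable lebesgue"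
    and N: "FIO_r_nuclear r 2 p2 \<phi> a"
  shows "symbol_decomposition r 2 p2 \<phi> a"
proof -
  obtain g h where g: "\<And>k. g k \<in> Lp_space 2" and h: "\<And>k. h k \<in> Lp_space p2"
    and sm: "summable (\<lambda>k. Lp_norm 2 (g k) powr r * Lp_norm p2 (h k) powr r)"
    and sec: "AE x in lebesgue. AE \<xi> in lebesgue. summable (\<lambda>k. h k x * g k \<xi>) \<and>
       exp (\<i> * of_real (\<phi> x \<xi>)) * a x \<xi> = (\<Sum>k. h k x * g k \<xi>)"
    using nuclear_imp_sections[OF r p2 N] by (elim exE conjE) (rule that; assumption | blast)
  let ?c = "\<lambda>z. exp (\<i> * of_real (\<phi> (fst z) (snd z))) * a (fst z) (snd z)"
  have [measurable]: "(\<lambda>z. \<phi> (fst z) (snd z)) \<in> borel_measurable lebesgue" "(\<lambda>z. a (fst z) (snd z)) \<in> borel_measurable lebesgue"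
    by (fact \<phi>[unfolded case_prod_unfold] a[unfolded case_prod_unfold])+
  have "?c \<in> borel_measurable lebesgue" by measurable
  then obtain c where c[measurable]: "c \<in> borel_measurable borel" and cc: "AE z in lebesgue. ?c z = c z"
    using borel_representative by blast
  have "\<forall>k. \<exists>g'. g' \<in> borel_measurable borel \<and> (AE \<xi> in lebesgue. g k \<xi> = g' \<xi>)"
    using borel_representative[OF Lp_space_measurable[OF g]] by blast
  then obtain g' where g'[measurable]: "\<And>k. g' k \<in> borel_measurable borel" and gg: "\<And>k. AE \<xi> in lebesgue. g k \<xi> = g' k \<xi>" by metis
  have "\<forall>k. \<exists>h'. h' \<in> borel_measurable borel \<and> (AE x in lebesgue. h k x = h' x)"
    using borel_representative[OF Lp_space_measurable[OF h]] by blast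
  then obtain h' where h'[measurable]: "\<And>k. h' k \<in> borel_measurable borel" and hh: "\<And>k. AE x in lebesgue. h k x = h' k x" by metis
  have gg': "AE \<xi> in lebesgue. \<forall>k. g k \<xi> = g' k \<xi>" using gg by (simp add: AE_all_countable)
  have hh': "AE x in lebesgue. \<forall>k. h k x = h' k x" using hh by (simp add: AE_all_countable)
  let ?t = "\<lambda>z k. h' k (fst z) * g' k (snd z)"
  have "AE z in lebesgue. summable (?t z) \<and> c z = (\<Sum>k. ?t z k)"
  proof (rule AE_lebesgue_pairI)
    have [measurable]: "(\<lambda>z::(real^'n) \<times> (real^'n). fst z) \<in> borel_measurable borel" "(\<lambda>z::(real^'n) \<times> (real^'n). snd z) \<in> borel_measurable borel"
      by (auto intro!: borel_measurable_continuous_onI continuous_intros)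
    have terms[measurable]: "(\<lambda>z. ?t z k) \<in> borel_measurable borel" for k by measurable
    have "{z \<in> space borel. Cauchy (\<lambda>n. \<Sum>k<n. ?t z k)} \<in> sets borel"
      by (rule sets_Collect_Cauchy) measurable
    then have [measurable]: "Measurable.pred borel (\<lambda>z. summable (?t z))"
      by (simp add: pred_def summable_iff_convergent Cauchy_convergent_iff)
    have "{z \<in> space borel. c z = (\<Sum>k. ?t z k)} \<in> sets borel"
      by (rule measurable_equality_set) measurable
    then have [measurable]: "Measurable.pred borel (\<lambda>z. c z = (\<Sum>k. ?t z k))"
      by (simp add: pred_def)
    show "Measurable.pred borel (\<lambda>z. summable (?t z) \<and> c z = (\<Sum>k. ?t z k))"
      by measurable
    show "AE x in lebesgue. AE \<xi> in lebesgue. summable (?t (x, \<xi>)) \<and>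
        c (x, \<xi>) = (\<Sum>k. ?t (x, \<xi>) k)"
      using sec AE_lebesgue_sections[OF cc] hh'
    proof eventually_elim
      case (elim x)
      from elim(1,2) gg' show ?case by eventually_elim (use elim(3) in auto)
    qed
  qed
  with cc AE_lebesgue_fst_snd[OF hh' gg'] have "AE z in lebesgue. summable (\<lambda>k. h k (fst z) * g k (snd z)) \<and> ?c z = (\<Sum>k. h k (fst z) * g k (snd z))"
    by eventually_elim auto
  then have "AE (x, \<xi>) in lebesgue. summable (\<lambda>k. h k x * g k \<xi>) \<and> a x \<xi> = 1 / exp (\<i> * of_real (\<phi> x \<xi>)) * (\<Sum>k. h k x * g k \<xi>)"
  proof eventually_elim
    case (elim z)
    then show ?case by (simp add: case_prod_beta nonzero_eq_divide_eq mult.commute)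
  qed
  then show ?thesis unfolding symbol_decomposition_def using g h sm by blast
qed

theorem theorem1p2:
  fixes r p1 p2 :: real
    and \<phi> :: "real^'n::finite \<Rightarrow> real^'n \<Rightarrow> real"
    and a :: "real^'n \<Rightarrow> real^'n \<Rightarrow> complex"
  assumes "0 < r" "r \<le> 1"
    and "1 < p1" "p1 \<le> 2"
    and "1 \<le> p2"
    and "(\<lambda>(x, \<xi>). \<phi> x \<xi>) \<in> borel_measurable lebesgue"
    and "(\<lambda>(x, \<xi>). a x \<xi>) \<in> borel_measurable lebesgue"
  shows "(symbol_decomposition r p1 p2 \<phi> a \<longrightarrow> FIO_r_nuclear r p1 p2 \<phi> a) \<and>
    (p1 = 2 \<longrightarrow> (FIO_r_nuclear r p1 p2 \<phi> a \<longleftrightarrow> symbol_decomposition r p1 p2 \<phi> a))"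
  using decomposition_imp_nuclear[of r p1 p2 \<phi> a] nuclear_imp_decomposition[of r p2 \<phi> a] assms by blast

end
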